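(* Let $f$ be three times continuously differentiable on $[0,\infty)$ such that all derivatives of $f$ are polynomially bounded. For a strike $a$, let $\lambda_n(a)$ be given by $$\lambda_n(a)=\frac{\log\left(\frac a{S_0}\right)-(2j_0-1-n)\sigma\sqrt{\Delta t}}{n\sigma^2\Delta t},\quad \tilde\gamma=\frac{\log\left(\frac a{S_0}\right)+n\sigma\sqrt{\Delta t}}{2\sigma\sqrt{\Delta t}},\quad j_0=\min\{m\in\mathbb{N}: m\ge\tilde\gamma\},$$ and let $V^D_{n,\lambda(a)}(a)$ denote the price of the digital option with strike $a$ in the $n$-period (center) binomial model with parameter $\lambda_n(a)$. If $0<\alpha<\frac13$, then $$\begin{aligned}V^f_{t,n}&=\frac{n^{\alpha-1}}2\sum_{k=0}^{n-1}f'(kn^{\alpha-1})V^D_{n,\lambda(kn^{\alpha-1})}(kn^{\alpha-1})\\&\quad+\frac{n^{\alpha-1}}2\sum_{k=0}^{n-1}f'((k+1)n^{\alpha-1})V^D_{n,\lambda((k+1)n^{\alpha-1})}((k+1)n^{\alpha-1})\end{aligned}$$ converges smoothly to the Black–Scholes price $V^f_{BS}$ with order $\frac1n$, i.e. $$V^f_{t,n}=V^f_{BS}+\frac Cn+o\left(\frac1n\right),$$ where $C=\int_0^\infty f'(a)C(a)\,\mathrm da$ and $$C(a)=\frac{e^{-rT}e^{-d_2^2/2}}{\sqrt{2\pi}}\cdot\frac{d_1^3+d_1d_2^2+2d_2-4d_1}{24}+\frac{e^{-rT}e^{-d_2^2/2}}{\sqrt{2\pi}}\left[\frac{(2-d_1d_2-d_1^2)\sqrt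 T}{6\sigma}r+\frac{Td_1r^2}{2\sigma^2}\right].$$
   Context: $S_0>0$ is the initial stock price, $\sigma>0$ the volatility, $r$ the continuously compounded interest rate, $T>0$ the maturity, the bond is $B_t=e^{rt}$, and $\Delta t=T/n$. Black–Scholes price: $V^f_{BS}=e^{-rT}\mathbb E[f(S_T)]$ with $S_T=S_0\exp((r-\sigma^2/2)T+\sigma\sqrt TZ)$, $Z$ standard normal. The $n$-period binomial model with parameter $\lambda_n$ has up and down factors $u=e^{\sigma\sqrt{\Delta t}+\lambda_n\sigma^2\Delta t}$ and $d=e^{-\sigma\sqrt{\Delta t}+\lambda_n\sigma^2\Delta t}$, risk-neutral probability $p_n=(e^{r\Delta t}-d)/(u-d)$ (in $(0,1)$ for large $n$), terminal stock price $S^n_T=S_0u^jd^{n-j}$ with probability $\binom nj p_n^j(1-p_n)^{n-j}$, and the price of the digital option $\mathbf 1_{S^n_T>a}$ is $e^{-rT}$ times the risk-neutral probability of $\{S^n_T>a\}$. For strike $a=0$ the digital price is $e^{-rT}$. $d_1=\dfrac{\log\frac{S_0}{a}+(r+\frac{\sigma^2}2)T}{\sigma\sqrt T}$ and $d_2=d_1-\sigma\sqrt T$ are functions of $a$. A function $\phi$ on $[0,\infty)$ is polynomially bounded if $|\phi(a)|\le c_1+c_2a^p$ for all $a\ge0$ for some positive constants $c_1,c_2,p$. A sequence $a_n$ converges smoothly to $a$ with order $\beta$ if $a_n=a+Cn^{-\beta}+o(n^{-\beta})$ for some constant $C$; "order $\frac1n$" in the claim means the displayed expansion, i.e. $\b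eta=1$.
   Formalization: The printed expansion fails when f(0)≠0 (f=1 gives V^f_{t,n}=0, C=0, but V_BS=e^{-rT}); it is proved as printed for f(0)=0, and for every f with the bond term e^{-rT}f(0) added to V^f_{t,n}. *)

theory Defs
  imports "HOL-Probability.Probability" "HOL-Library.Landau_Symbols"
begin

text \<open>
  Parameters throughout: initial stock price \<open>S0\<close>, volatility \<open>\<sigma>\<close>, continuously compounded
  interest rate \<open>r\<close>, maturity \<open>T\<close>, number of periods \<open>n\<close> (so that the step is \<open>T / n\<close>).
\<close>

definition poly_bounded :: "(real \<Rightarrow> real) \<Rightarrow> bool" where
  "poly_bounded \<phi> \<longleftrightarrow>
     (\<exists>c1 > 0. \<exists>c2 > 0. \<exists>p > 0. \<forall>a \<ge> 0. \<bar>\<phi> a\<bar> \<le> c1 + c2 * a powr p)"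

definition std_normal :: "real measure" where
  "std_normal = density lborel std_normal_density"

definition bs_stock :: "real \<Rightarrow> real \<Rightarrow> real \<Rightarrow> real \<Rightarrow> real \<Rightarrow> real" where
  "bs_stock S0 \<sigma> r T z = S0 * exp ((r - \<sigma>\<^sup>2 / 2) * T + \<sigma> * sqrt T * z)"

definition bs_price :: "real \<Rightarrow> real \<Rightarrow> real \<Rightarrow> real \<Rightarrow> (real \<Rightarrow> real) \<Rightarrow> real" where
  "bs_price S0 \<sigma> r T f = exp (- r * T) * (LINT z|std_normal. f (bs_stock S0 \<sigma> r T z))"

definition up :: "real \<Rightarrow> real \<Rightarrow> nat \<Rightarrow> real \<Rightarrow> real" where
  "up \<sigma> T n l = exp (\<sigma> * sqrt (T / n) + l * \<sigma>\<^sup>2 * (T / n))"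

definition down :: "real \<Rightarrow> real \<Rightarrow> nat \<Rightarrow> real \<Rightarrow> real" where
  "down \<sigma> T n l = exp (- \<sigma> * sqrt (T / n) + l * \<sigma>\<^sup>2 * (T / n))"

definition rn_prob :: "real \<Rightarrow> real \<Rightarrow> real \<Rightarrow> nat \<Rightarrow> real \<Rightarrow> real" where
  "rn_prob \<sigma> r T n l =
     (exp (r * (T / n)) - down \<sigma> T n l) / (up \<sigma> T n l - down \<sigma> T n l)"

definition binom_stock :: "real \<Rightarrow> real \<Rightarrow> real \<Rightarrow> nat \<Rightarrow> real \<Rightarrow> nat \<Rightarrow> real" where
  "binom_stock S0 \<sigma> T n l j = S0 * up \<sigma> T n l ^ j * down \<sigma> T n l ^ (n - j)"

text \<open>
  The binomial weights are written out because \<open>rn_prob\<close> lies in \<open>(0, 1)\<close> only for large \<open>n\<close>,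
  whereas \<open>binomial_pmf\<close> is meaningful only for a success probability in \<open>[0, 1]\<close>.
\<close>

definition digital_price :: "real \<Rightarrow> real \<Rightarrow> real \<Rightarrow> real \<Rightarrow> nat \<Rightarrow> real \<Rightarrow> real \<Rightarrow> real" where
  "digital_price S0 \<sigma> r T n l a =
     exp (- r * T) *
     (\<Sum>j | j \<le> n \<and> binom_stock S0 \<sigma> T n l j > a.
        real (n choose j) * rn_prob \<sigma> r T n l ^ j * (1 - rn_prob \<sigma> r T n l) ^ (n - j))"

definition center_gamma :: "real \<Rightarrow> real \<Rightarrow> real \<Rightarrow> nat \<Rightarrow> real \<Rightarrow> real" where
  "center_gamma S0 \<sigma> T n a =
     (ln (a / S0) + n * \<sigma> * sqrt (T / n)) / (2 * \<sigma> * sqrt (T / n))"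

definition center_j0 :: "real \<Rightarrow> real \<Rightarrow> real \<Rightarrow> nat \<Rightarrow> real \<Rightarrow> nat" where
  "center_j0 S0 \<sigma> T n a = (LEAST m::nat. real m \<ge> center_gamma S0 \<sigma> T n a)"

definition center_lambda :: "real \<Rightarrow> real \<Rightarrow> real \<Rightarrow> nat \<Rightarrow> real \<Rightarrow> real" where
  "center_lambda S0 \<sigma> T n a =
     (ln (a / S0) - (2 * real (center_j0 S0 \<sigma> T n a) - 1 - real n) * \<sigma> * sqrt (T / n))
       / (n * \<sigma>\<^sup>2 * (T / n))"

text \<open>The parameter \<open>\<lambda>\<^sub>n(a)\<close> is undefined at \<open>a = 0\<close>; there the digital option pays 1 surely.\<close>

definition center_digital_price :: "real \<Rightarrow> real \<Rightarrow> real \<Rightarrow> real \<Rightarrow> nat \<Rightarrow> real \<Rightarrow> real" where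
  "center_digital_price S0 \<sigma> r T n a =
     (if a = 0 then exp (- r * T)
      else digital_price S0 \<sigma> r T n (center_lambda S0 \<sigma> T n a) a)"

text \<open>Here \<open>f'\<close> is the derivative of the payoff; the mesh \<open>n powr (\<alpha> - 1)\<close> covers \<open>[0, n powr \<alpha>]\<close>.\<close>

definition trapezoid_price ::
    "real \<Rightarrow> real \<Rightarrow> real \<Rightarrow> real \<Rightarrow> real \<Rightarrow> (real \<Rightarrow> real) \<Rightarrow> nat \<Rightarrow> real" where
  "trapezoid_price S0 \<sigma> r T \<alpha> f' n =
     (let h = real n powr (\<alpha> - 1); V = center_digital_price S0 \<sigma> r T n in
        h / 2 * (\<Sum>k<n. f' (real k * h) * V (real k * h))
      + h / 2 * (\<Sum>k<n. f' ((real k + 1) * h) * V ((real k + 1) * h)))"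

definition d1 :: "real \<Rightarrow> real \<Rightarrow> real \<Rightarrow> real \<Rightarrow> real \<Rightarrow> real" where
  "d1 S0 \<sigma> r T a = (ln (S0 / a) + (r + \<sigma>\<^sup>2 / 2) * T) / (\<sigma> * sqrt T)"

definition d2 :: "real \<Rightarrow> real \<Rightarrow> real \<Rightarrow> real \<Rightarrow> real \<Rightarrow> real" where
  "d2 S0 \<sigma> r T a = d1 S0 \<sigma> r T a - \<sigma> * sqrt T"

definition digital_coeff :: "real \<Rightarrow> real \<Rightarrow> real \<Rightarrow> real \<Rightarrow> real \<Rightarrow> real" where
  "digital_coeff S0 \<sigma> r T a =
     (let x = d1 S0 \<sigma> r T a; y = d2 S0 \<sigma> r T a;
          w = exp (- r * T) * exp (- y\<^sup>2 / 2) / sqrt (2 * pi) in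
        w * ((x ^ 3 + x * y\<^sup>2 + 2 * y - 4 * x) / 24)
      + w * ((2 - x * y - x\<^sup>2) * sqrt T / (6 * \<sigma>) * r + T * x * r\<^sup>2 / (2 * \<sigma>\<^sup>2)))"

end

theory Submission
  imports Defs "HOL-Real_Asymp.Real_Asymp"
begin

text \<open>
  A binomial tail probability is an incomplete beta integral. In the logistic variable
  \<open>p = e\<^sup>v / (e\<^sup>v + e\<^bsup>-v\<^esup>)\<close> its integrand is \<open>e\<^bsup>m v\<^esup> / cosh\<^bsup>n+1\<^esup> v\<close> with \<open>m = 2j - 1 - n\<close>, a perturbed Gaussian,
  and the quartic term of \<open>ln cosh\<close> yields an expansion in \<open>1/n\<close> without appeal to a local limit
  theorem. Since the strike of the center model sits exactly halfway between two nodes, \<open>m\<close> is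
  \<open>\<surd>n\<close> times the standardized log-moneyness minus a number \<open>\<theta> \<in> [-1, 1]\<close>; it oscillates with \<open>n\<close>, but
  its effects on the node and, through \<open>\<lambda>\<^sub>n\<close>, on the risk-neutral probability cancel through order
  \<open>1/n\<close>. Together with an exponential Markov bound for far strikes this shows that the digital price
  in the tree is the Black--Scholes digital price plus \<open>C(a)/n + O(n\<^bsup>-17/12\<^esup>)\<close>, uniformly in \<open>a\<close> and
  with any polynomial weight in \<open>a\<close>. By Fubini the Black--Scholes price of \<open>f\<close> is
  \<open>e\<^bsup>-rT\<^esup> f(0)\<close> plus the integral of \<open>f'(a)\<close> times the digital price with strike \<open>a\<close>, and the trapezoidal
  rule with mesh \<open>n\<^bsup>\<alpha>-1\<^esup>\<close> on \<open>[0, n\<^sup>\<alpha>]\<close> contributes an error \<open>O(n\<^bsup>3\<alpha>-2\<^esup>)\<close>, which is \<open>o(1/n)\<close> because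
  \<open>\<alpha> < 1/3\<close>.
\<close>

section \<open>Bounds for \<open>ln cosh\<close>\<close>

text \<open>The trapezoidal sum runs over an interval of length n^\<alpha> with the growing weight
  f', so each digital price must be known up to o(n^(-1-\<alpha>)), uniformly and with weights in
  the strike. The expansion of the beta integral alone cannot give this: its error n^(-3/2) carries
  a factor (1 + |x|)^8 in the log-moneyness x and holds for moderate x only. A Markov bound decaying
  at any prescribed exponential rate in |x| covers the other strikes; trading one bound against the
  other costs n^(1/12). What remains, n^(-17/12), is enough because 17/12 > 4/3 > 1 + \<alpha>. The
  number \<theta> cancels because it shifts the node and the log-odds by the same -\<theta>/sqrt n;
  the two shifts are scaled by sqrt (n/(n+1)) and by its inverse, and these differ by O(1/n) only.
  Strike 0 corresponds to x = -infinity, and strike derivatives of the Black--Scholes digital price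
  contain 1/a and 1/a^2. The Gaussian density in log a decays faster than every power of a there, so
  these derivatives stay bounded and the trapezoidal rule keeps its second order.\<close>

lemma exp_sub_one_sub_self_le:
  fixes x :: real
  assumes "0 \<le> x"
  shows "0 \<le> exp x - 1 - x" "exp x - 1 - x \<le> x\<^sup>2 * exp x"
proof -
  show "0 \<le> exp x - 1 - x" using exp_ge_add_one_self[of x] by linarith
  have "exp (-x) \<ge> 1 - x" using exp_ge_add_one_self[of "-x"] by simp
  hence "1 - exp (-x) \<le> x" by simp
  hence "(1 - exp (-x)) * exp x \<le> x * exp x" by (intro mult_right_mono) auto
  hence 1: "exp x - 1 \<le> x * exp x" by (simp add: algebra_simps flip: exp_add)
  hence "x * (exp x - 1) \<le> x * (x * exp x)" using assms by (intro mult_left_mono)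
  moreover have "exp x - 1 - x \<le> x * (exp x - 1)"
    using 1 by (simp add: algebra_simps)
  ultimately show "exp x - 1 - x \<le> x\<^sup>2 * exp x" by (simp add: power2_eq_square algebra_simps)
qed

lemma nonneg_by_deriv:
  fixes F F' :: "real \<Rightarrow> real"
  assumes "\<And>x. x \<ge> 0 \<Longrightarrow> (F has_real_derivative F' x) (at x)"
    and "\<And>x. x \<ge> 0 \<Longrightarrow> F' x \<ge> 0" and "F 0 = 0" and "x \<ge> 0"
  shows "F x \<ge> 0"
  using DERIV_nonneg_imp_nondecreasing[of 0 x F] assms by (metis)

lemma tanh_le_self: "tanh x \<le> x" if "x \<ge> 0" for x :: real
proof -
  have "x - tanh x \<ge> 0"
    by (rule nonneg_by_deriv[where F' = "\<lambda>x. (tanh x)\<^sup>2"])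
       (use that in \<open>auto intro!: derivative_eq_intros simp: cosh_real_nonzero\<close>)
  thus ?thesis by simp
qed

text \<open>Since \<open>tanh\<close> has derivative 1 - tanh^2, squaring one bound and integrating
  gives the next: this one comes from \<open>tanh_le_self\<close>, and the quintic bound comes from
  this one.\<close>

lemma tanh_ge_cubic: "tanh x \<ge> x - x ^ 3 / 3" if "x \<ge> 0" for x :: real
proof -
  have "tanh x - x + x ^ 3 / 3 \<ge> 0"
    by (rule nonneg_by_deriv[where F' = "\<lambda>x. x\<^sup>2 - (tanh x)\<^sup>2"])
       (use that in \<open>auto intro!: derivative_eq_intros power_mono tanh_le_self simp: cosh_real_nonzero\<close>)
  thus ?thesis by simp
qed

lemma tanh_le_quintic: "tanh x \<le> x - x ^ 3 / 3 + 2 * x ^ 5 / 15" if "x \<ge> 0" for x :: real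
proof -
  have "x - x ^ 3 / 3 + 2 * x ^ 5 / 15 - tanh x \<ge> 0"
  proof (rule nonneg_by_deriv[where F = "\<lambda>x. x - x ^ 3 / 3 + 2 * x ^ 5 / 15 - tanh x"
        and F' = "\<lambda>x. (tanh x)\<^sup>2 - x\<^sup>2 + 2 * x ^ 4 / 3"])
    fix x :: real assume x: "x \<ge> 0"
    show "((\<lambda>x. x - x ^ 3 / 3 + 2 * x ^ 5 / 15 - tanh x) has_real_derivative
          (tanh x)\<^sup>2 - x\<^sup>2 + 2 * x ^ 4 / 3) (at x)"
      by (rule derivative_eq_intros refl | simp)+
    show "(tanh x)\<^sup>2 - x\<^sup>2 + 2 * x ^ 4 / 3 \<ge> 0"
    \<comment> \<open>Squaring the cubic bound needs x - x^3/3 >= 0, that is x^2 <= 3. Beyond that,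
      2 x^4/3 >= 2 x^2 already outweighs x^2.\<close>
    proof (cases "x\<^sup>2 \<le> 3")
      case True
      hence "x * x\<^sup>2 \<le> x * 3" using x by (intro mult_left_mono)
      hence "x - x ^ 3 / 3 \<ge> 0" by (simp add: power2_eq_square power3_eq_cube)
      hence "(x - x ^ 3 / 3)\<^sup>2 \<le> (tanh x)\<^sup>2"
        using tanh_ge_cubic[OF x] by (intro power_mono)
      moreover have "(x - x ^ 3 / 3)\<^sup>2 = x\<^sup>2 - 2 * x ^ 4 / 3 + x ^ 6 / 9"
        by (simp add: power2_eq_square eval_nat_numeral algebra_simps)
      moreover have "x ^ 6 \<ge> 0" by simp
      ultimately show ?thesis by linarith
    next
      case False
      hence "x\<^sup>2 * 3 \<le> x\<^sup>2 * x\<^sup>2" by (intro mult_left_mono) auto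
      hence "x\<^sup>2 * 3 \<le> x ^ 4" by (simp add: eval_nat_numeral)
      moreover have "(tanh x)\<^sup>2 \<ge> 0" "x\<^sup>2 \<ge> 0" by simp_all
      ultimately show ?thesis by linarith
    qed
  qed (use that in auto)
  thus ?thesis by simp
qed

lemma has_real_derivative_ln_cosh [derivative_intros]:
  "((\<lambda>x. ln (cosh x)) has_real_derivative tanh x) (at x)" for x :: real
  by (auto intro!: derivative_eq_intros simp: cosh_real_pos cosh_real_nonneg tanh_def field_simps)

text \<open>Integrals of the three \<open>tanh\<close> bounds, carried to negative v by evenness.
  The first two control the size of the Gaussian remainder below, the third identifies its leading
  term.\<close>

lemma ln_cosh_bounds:
  fixes v :: real
  shows "ln (cosh v) \<le> v\<^sup>2 / 2"
    and "v\<^sup>2 / 2 - v ^ 4 / 12 \<le> ln (cosh v)"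
    and "ln (cosh v) \<le> v\<^sup>2 / 2 - v ^ 4 / 12 + v ^ 6 / 45"
proof -
  have *: "x\<^sup>2 / 2 - ln (cosh x) \<ge> 0" "ln (cosh x) - x\<^sup>2 / 2 + x ^ 4 / 12 \<ge> 0"
    "x\<^sup>2 / 2 - x ^ 4 / 12 + x ^ 6 / 45 - ln (cosh x) \<ge> 0" if "x \<ge> 0" for x :: real
  proof -
    show "x\<^sup>2 / 2 - ln (cosh x) \<ge> 0"
      by (rule nonneg_by_deriv[where F' = "\<lambda>x. x - tanh x"])
         (use that tanh_le_self in \<open>auto intro!: derivative_eq_intros\<close>)
    show "ln (cosh x) - x\<^sup>2 / 2 + x ^ 4 / 12 \<ge> 0"
    proof (rule nonneg_by_deriv[where F = "\<lambda>x. ln (cosh x) - x\<^sup>2 / 2 + x ^ 4 / 12"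
          and F' = "\<lambda>x. tanh x - x + x ^ 3 / 3"])
      show "((\<lambda>x. ln (cosh x) - x\<^sup>2 / 2 + x ^ 4 / 12) has_real_derivative
             tanh y - y + y ^ 3 / 3) (at y)" for y :: real
        by (rule derivative_eq_intros refl | simp)+
      show "0 \<le> tanh y - y + y ^ 3 / 3" if "y \<ge> 0" for y :: real
        using tanh_ge_cubic[OF that] by linarith
    qed (use that in simp_all)
    show "x\<^sup>2 / 2 - x ^ 4 / 12 + x ^ 6 / 45 - ln (cosh x) \<ge> 0"
    proof (rule nonneg_by_deriv[where F = "\<lambda>x. x\<^sup>2 / 2 - x ^ 4 / 12 + x ^ 6 / 45 - ln (cosh x)"
          and F' = "\<lambda>x. x - x ^ 3 / 3 + 2 * x ^ 5 / 15 - tanh x"])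
      show "((\<lambda>x. x\<^sup>2 / 2 - x ^ 4 / 12 + x ^ 6 / 45 - ln (cosh x)) has_real_derivative
             y - y ^ 3 / 3 + 2 * y ^ 5 / 15 - tanh y) (at y)" for y :: real
        by (rule derivative_eq_intros refl | simp)+
      show "0 \<le> y - y ^ 3 / 3 + 2 * y ^ 5 / 15 - tanh y" if "y \<ge> 0" for y :: real
        using tanh_le_quintic[OF that] by linarith
    qed (use that in simp_all)
  qed
  have "cosh \<bar>v\<bar> = cosh v" by (simp add: abs_if)
  thus "ln (cosh v) \<le> v\<^sup>2 / 2" "v\<^sup>2 / 2 - v ^ 4 / 12 \<le> ln (cosh v)"
    "ln (cosh v) \<le> v\<^sup>2 / 2 - v ^ 4 / 12 + v ^ 6 / 45"
    using *[of "\<bar>v\<bar>"] by (auto simp: power_even_abs)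
qed

lemma cosh_ge_half_exp: "cosh v \<ge> exp \<bar>v\<bar> / 2" for v :: real
  by (auto simp: cosh_def abs_if)

text \<open>From cosh v >= e^|v| / 2 and ln 2 <= 25/36 < 0.7. It replaces the lower bound v^2/2 -
  v^4/12, which is negative for large v.\<close>

lemma ln_cosh_ge_linear:
  fixes v :: real assumes "\<bar>v\<bar> \<ge> 1" shows "ln (cosh v) \<ge> 0.3 * \<bar>v\<bar>"
proof -
  have "ln (cosh v) \<ge> ln (exp \<bar>v\<bar> / 2)" using cosh_ge_half_exp by (subst ln_le_cancel_iff) (auto simp: cosh_real_pos)
  also have "ln (exp \<bar>v\<bar> / 2) = \<bar>v\<bar> - ln 2" by (simp add: ln_div)
  finally show ?thesis using ln2_le_25_over_36 assms by auto
qed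

text \<open>The power -N of cosh (y / sqrt N) is exp (-y^2/2 + \<open>gauss_remainder N y\<close>),
  so this is the deviation of the exponent from a Gaussian one, y^4/(12 N) to leading order.\<close>

definition gauss_remainder :: "real \<Rightarrow> real \<Rightarrow> real" where
  "gauss_remainder N y = y\<^sup>2 / 2 - N * ln (cosh (y / sqrt N))"

lemma gauss_remainder_bounds:
  fixes y :: real assumes "N > 0"
  shows "0 \<le> gauss_remainder N y" "gauss_remainder N y \<le> y ^ 4 / (12 * N)"
    "gauss_remainder N y \<ge> y ^ 4 / (12 * N) - y ^ 6 / (45 * N\<^sup>2)"
proof -
  define v where "v = y / sqrt N"
  have y: "y = sqrt N * v" using assms by (simp add: v_def)
  have s: "sqrt N ^ 2 = N" "sqrt N ^ 4 = N\<^sup>2" "sqrt N ^ 6 = N ^ 3"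
    using assms power_mult[of "sqrt N" 2 2] power_mult[of "sqrt N" 2 3] by simp_all
  have R: "gauss_remainder N y = N * (v\<^sup>2 / 2 - ln (cosh v))"
    using assms by (simp add: gauss_remainder_def y power_mult_distrib s algebra_simps)
  have e: "y ^ 4 / (12 * N) = N * (v ^ 4 / 12)" "y ^ 6 / (45 * N\<^sup>2) = N * (v ^ 6 / 45)"
    using assms by (simp_all add: y power_mult_distrib s power2_eq_square power3_eq_cube field_simps)
  show "0 \<le> gauss_remainder N y" unfolding R using ln_cosh_bounds(1)[of v] assms by simp
  show "gauss_remainder N y \<le> y ^ 4 / (12 * N)"
    unfolding R e using ln_cosh_bounds(2)[of v] assms by (intro mult_left_mono) auto
  show "gauss_remainder N y \<ge> y ^ 4 / (12 * N) - y ^ 6 / (45 * N\<^sup>2)"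
    unfolding R e right_diff_distrib[symmetric] using ln_cosh_bounds(3)[of v] assms
    by (intro mult_left_mono) auto
qed

text \<open>The exponent -w^2/2 + y^4/(12 N) with y = \<mu> + w is unbounded, so three ranges are
  needed: |w| <= |\<mu>|, where the quartic term is at most 2; |y| <= sqrt N, where it is at most
  y^2/12 <= w^2/3; and |y| > sqrt N, where the linear growth of ln cosh outweighs the drift \<mu>
  y.\<close>

lemma gauss_remainder_domination:
  fixes N \<mu> w :: real
  assumes N: "N \<ge> 1" and \<mu>: "10 * \<bar>\<mu>\<bar> \<le> sqrt N" "\<mu> ^ 4 \<le> N"
  shows "exp (- w\<^sup>2 / 2 + gauss_remainder N (\<mu> + w)) \<le> exp (3 - \<bar>w\<bar> / 10)"
proof -
  define y where "y = \<mu> + w"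
  \<comment> \<open>The second range leaves exactly -w^2/6 of -w^2/2.\<close>
  have quad: "- w\<^sup>2 / 6 \<le> 1 - \<bar>w\<bar> / 10"
  proof -
    have "0 \<le> (\<bar>w\<bar> - 3 / 10)\<^sup>2" by simp
    also have "\<dots> = w\<^sup>2 - 6/10 * \<bar>w\<bar> + 9/100" by (simp add: power2_diff power_divide)
    finally show ?thesis by linarith
  qed
  have N0: "N > 0" using N by simp
  have "- w\<^sup>2 / 2 + gauss_remainder N y \<le> 3 - \<bar>w\<bar> / 10"
  proof (cases "\<bar>w\<bar> \<le> \<bar>\<mu>\<bar>")
    case True
    have "\<bar>y\<bar> \<le> 2 * \<bar>\<mu>\<bar>" using True by (simp add: y_def)
    hence "\<bar>y\<bar> ^ 4 \<le> (2 * \<bar>\<mu>\<bar>) ^ 4" by (intro power_mono) auto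
    hence "y ^ 4 \<le> 16 * N" using \<mu>(2) by (simp add: power_mult_distrib power_even_abs)
    hence "y ^ 4 / (12 * N) \<le> 2" using N0 by (simp add: divide_simps)
    moreover have "w\<^sup>2 \<ge> 0" by simp
    ultimately show ?thesis using gauss_remainder_bounds(2)[OF N0, of y] quad by linarith
  next
    case w: False
    show ?thesis
    proof (cases "\<bar>y\<bar> \<le> sqrt N")
      case True
      have "y\<^sup>2 \<le> N" using True N0 by (metis abs_le_square_iff abs_of_nonneg real_sqrt_ge_zero real_sqrt_pow2 less_imp_le)
      hence "y\<^sup>2 * y\<^sup>2 \<le> N * y\<^sup>2" by (intro mult_right_mono) auto
      hence "y ^ 4 / (12 * N) \<le> y\<^sup>2 / 12" using N0 by (simp add: field_simps eval_nat_numeral)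
      moreover have "\<bar>y\<bar> \<le> 2 * \<bar>w\<bar>" using w by (simp add: y_def)
      hence "\<bar>y\<bar>\<^sup>2 \<le> (2 * \<bar>w\<bar>)\<^sup>2" by (intro power_mono) auto
      hence "y\<^sup>2 \<le> 4 * w\<^sup>2" by (simp add: power_mult_distrib)
      ultimately show ?thesis using gauss_remainder_bounds(2)[OF N0, of y] quad by linarith
    next
      case False
      define v where "v = y / sqrt N"
      have sN: "sqrt N \<ge> 1" using N by simp
      have v: "\<bar>v\<bar> \<ge> 1" using False sN by (simp add: v_def divide_simps)
      have "N * (0.3 * \<bar>v\<bar>) \<le> N * ln (cosh v)" using ln_cosh_ge_linear[OF v] N0 by (intro mult_left_mono) auto
      moreover have "N * \<bar>v\<bar> = sqrt N * \<bar>y\<bar>" using N0 by (simp add: v_def real_div_sqrt abs_divide flip: times_divide_eq_left)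
      ultimately have 1: "0.3 * sqrt N * \<bar>y\<bar> \<le> N * ln (cosh v)" by (simp add: algebra_simps)
      have 2: "\<mu> * y \<le> 0.1 * sqrt N * \<bar>y\<bar>"
      proof -
        have "\<mu> * y \<le> \<bar>\<mu>\<bar> * \<bar>y\<bar>" by (metis abs_ge_self abs_mult)
        also have "\<dots> \<le> (0.1 * sqrt N) * \<bar>y\<bar>" using \<mu>(1) by (intro mult_right_mono) auto
        finally show ?thesis .
      qed
      have "\<bar>w\<bar> \<le> \<bar>y\<bar> + \<bar>\<mu>\<bar>" by (simp add: y_def)
      also have "\<dots> \<le> 2 * \<bar>y\<bar>" using \<mu>(1) False by simp
      finally have 3: "\<bar>w\<bar> \<le> 2 * \<bar>y\<bar>" .
      have "1 * \<bar>y\<bar> \<le> sqrt N * \<bar>y\<bar>" using sN by (intro mult_right_mono) auto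
      hence 4: "\<bar>w\<bar> / 10 \<le> 0.2 * sqrt N * \<bar>y\<bar>" using 3 by simp
      \<comment> \<open>Undoing the completed square removes y^2/2, which a linear bound on ln cosh
        could not beat.\<close>
      have "- w\<^sup>2 / 2 + gauss_remainder N y = \<mu> * y - \<mu>\<^sup>2 / 2 - N * ln (cosh v)"
      proof -
        have "gauss_remainder N y = y\<^sup>2 / 2 - N * ln (cosh v)" by (simp add: gauss_remainder_def v_def)
        moreover have "\<mu> * y - \<mu>\<^sup>2 / 2 = y\<^sup>2 / 2 - w\<^sup>2 / 2"
          by (simp add: y_def power2_eq_square algebra_simps)
        ultimately show ?thesis by linarith
      qed
      also have "\<dots> \<le> 0.1 * sqrt N * \<bar>y\<bar> - 0.3 * sqrt N * \<bar>y\<bar>" using 1 2 zero_le_power2[of \<mu>] by linarith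
      finally show ?thesis using 4 by linarith
    qed
  qed
  thus ?thesis by (simp add: y_def)
qed

section \<open>Uniform first-order approximation of the perturbed Gaussian integrand\<close>

lemma bounded_of_tendsto_zero_both:
  fixes g :: "real \<Rightarrow> real"
  assumes "continuous_on UNIV g" "(g \<longlongrightarrow> 0) at_top" "(g \<longlongrightarrow> 0) at_bot"
  shows "\<exists>K\<ge>0. \<forall>x. \<bar>g x\<bar> \<le> K"
proof -
  have "eventually (\<lambda>x. \<bar>g x\<bar> < 1) at_top" "eventually (\<lambda>x. \<bar>g x\<bar> < 1) at_bot"
    using assms(2,3) by (auto simp: tendsto_iff dist_real_def)
  then obtain a b where ab: "\<And>x. x \<ge> a \<Longrightarrow> \<bar>g x\<bar> < 1" "\<And>x. x \<le> b \<Longrightarrow> \<bar>g x\<bar> < 1"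
    unfolding eventually_at_top_linorder eventually_at_bot_linorder by auto
  have "compact ((\<lambda>x. \<bar>g x\<bar>) ` {b..a})"
    using assms(1) by (intro compact_continuous_image continuous_intros) (auto intro: continuous_on_subset)
  hence "bdd_above ((\<lambda>x. \<bar>g x\<bar>) ` {b..a})" by (simp add: bounded_imp_bdd_above compact_imp_bounded)
  then obtain M where "\<forall>y\<in>(\<lambda>x. \<bar>g x\<bar>) ` {b..a}. y \<le> M" unfolding bdd_above_def by blast
  hence M: "\<And>x. x \<in> {b..a} \<Longrightarrow> \<bar>g x\<bar> \<le> M" by blast
  have "\<bar>g x\<bar> \<le> max M 1" for x
    using ab(1)[of x] ab(2)[of x] M[of x] by (cases "x \<ge> a"; cases "x \<le> b") auto
  thus ?thesis by (intro exI[of _ "max M 1"]) auto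
qed

lemma add_power8_le: "(a + b) ^ 8 \<le> 128 * (a ^ 8 + b ^ 8)" for a b :: real
proof -
  have sq: "(x + y)\<^sup>2 \<le> 2 * (x\<^sup>2 + y\<^sup>2)" for x y :: real
    using zero_le_power2[of "x - y"] by (simp add: power2_sum power2_diff)
  have "(a + b) ^ 8 = (((a + b)\<^sup>2)\<^sup>2)\<^sup>2" by simp
  also have "\<dots> \<le> ((2 * (a\<^sup>2 + b\<^sup>2))\<^sup>2)\<^sup>2" by (intro power_mono sq) auto
  also have "\<dots> = 16 * ((a\<^sup>2 + b\<^sup>2)\<^sup>2)\<^sup>2" unfolding power_mult_distrib by simp
  also have "\<dots> \<le> 16 * (2 * ((a\<^sup>2)\<^sup>2 + (b\<^sup>2)\<^sup>2))\<^sup>2" by (intro mult_left_mono power_mono sq) auto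
  also have "\<dots> = 64 * ((a\<^sup>2)\<^sup>2 + (b\<^sup>2)\<^sup>2)\<^sup>2" unfolding power_mult_distrib by simp
  also have "\<dots> \<le> 64 * (2 * (((a\<^sup>2)\<^sup>2)\<^sup>2 + ((b\<^sup>2)\<^sup>2)\<^sup>2))" by (intro mult_left_mono sq) auto
  finally show ?thesis by simp
qed

lemma power6_le_power8: "y ^ 6 \<le> 1 + y ^ 8" for y :: real
proof (cases "\<bar>y\<bar> \<le> 1")
  case True
  hence "\<bar>y\<bar> ^ 6 \<le> 1" by (intro power_le_one) auto
  thus ?thesis by (simp add: power_even_abs add_increasing2)
next
  case False
  hence "\<bar>y\<bar> ^ 6 \<le> \<bar>y\<bar> ^ 8" by (intro power_increasing) auto
  thus ?thesis by (simp add: power_even_abs)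
qed

text \<open>With R the remainder and R0 = y^4/(12 N), the error is (e^R - 1 - R) - (R0 - R): at most
  R0^2 e^R plus y^6/(45 N^2), both of order 1/N^2. The factor 1/(1 + w^2) is the derivative of
  \<open>arctan\<close>, against which the estimate is integrated later.\<close>

lemma laplace_integrand_bound:
  "\<exists>K>0. \<forall>N \<mu> w. N \<ge> 1 \<longrightarrow> 10 * \<bar>\<mu>\<bar> \<le> sqrt N \<longrightarrow> \<mu> ^ 4 \<le> N \<longrightarrow>
     \<bar>exp (- w\<^sup>2 / 2 + gauss_remainder N (\<mu> + w)) - exp (- w\<^sup>2 / 2) * (1 + (\<mu> + w) ^ 4 / (12 * N))\<bar>
       \<le> K * (1 + \<mu> ^ 8) / N\<^sup>2 / (1 + w\<^sup>2)"
proof -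
  have "\<exists>K\<ge>0. \<forall>x::real. \<bar>(1 + x ^ 8) * (1 + x\<^sup>2) * exp (3 - \<bar>x\<bar> / 10)\<bar> \<le> K"
    by (rule bounded_of_tendsto_zero_both, intro continuous_intros, simp) real_asymp+
  then obtain K1 where K1: "K1 \<ge> 0" "\<And>x::real. (1 + x ^ 8) * (1 + x\<^sup>2) * exp (3 - \<bar>x\<bar> / 10) \<le> K1" by force
  have "\<exists>K\<ge>0. \<forall>x::real. \<bar>(1 + x ^ 8) * (1 + x\<^sup>2) * exp (- x\<^sup>2 / 2)\<bar> \<le> K"
    by (rule bounded_of_tendsto_zero_both, intro continuous_intros, simp) real_asymp+
  then obtain K2 where K2: "K2 \<ge> 0" "\<And>x::real. (1 + x ^ 8) * (1 + x\<^sup>2) * exp (- x\<^sup>2 / 2) \<le> K2" by force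
  define K where "K = 1 + 128 * K1 + 129 * K2"
  show ?thesis
  proof (intro exI[of _ K] conjI allI impI)
    show "K > 0" using K1(1) K2(1) by (simp add: K_def)
    fix N \<mu> w :: real
    assume A: "N \<ge> 1" "10 * \<bar>\<mu>\<bar> \<le> sqrt N" "\<mu> ^ 4 \<le> N"
    define y where "y = \<mu> + w"
    define R where "R = gauss_remainder N y"
    define R0 where "R0 = y ^ 4 / (12 * N)"
    define e where "e = exp (- w\<^sup>2 / 2)"
    have N0: "N > 0" using A by simp
    have R: "0 \<le> R" "R \<le> R0" "R0 - y ^ 6 / (45 * N\<^sup>2) \<le> R"
      using gauss_remainder_bounds[OF N0, of y] by (auto simp: R_def R0_def)
    have D: "e * exp R \<le> exp (3 - \<bar>w\<bar> / 10)"
      using gauss_remainder_domination[OF A, of w] by (simp add: e_def R_def y_def flip: exp_add)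
    have y8: "y ^ 8 \<le> 128 * ((1 + \<mu> ^ 8) * (1 + w ^ 8))"
    proof -
      have "y ^ 8 \<le> 128 * (\<mu> ^ 8 + w ^ 8)" unfolding y_def by (rule add_power8_le)
      also have "\<dots> \<le> 128 * ((1 + \<mu> ^ 8) * (1 + w ^ 8))" by (simp add: algebra_simps)
      finally show ?thesis .
    qed
    have y6: "y ^ 6 \<le> 129 * ((1 + \<mu> ^ 8) * (1 + w ^ 8))"
    proof -
      have "1 * 1 \<le> (1 + \<mu> ^ 8) * (1 + w ^ 8)" by (intro mult_mono) auto
      thus ?thesis using power6_le_power8[of y] y8 by simp
    qed
    have "exp R - (1 + R0) = (exp R - 1 - R) - (R0 - R)" by simp
    also have "\<bar>\<dots>\<bar> \<le> \<bar>exp R - 1 - R\<bar> + \<bar>R0 - R\<bar>" by (rule abs_triangle_ineq4)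
    also have "\<dots> \<le> R\<^sup>2 * exp R + y ^ 6 / (45 * N\<^sup>2)"
      using exp_sub_one_sub_self_le[OF R(1)] R by (intro add_mono) auto
    also have "R\<^sup>2 * exp R \<le> R0\<^sup>2 * exp R" using R by (intro mult_right_mono power_mono) auto
    finally have "e * \<bar>exp R - (1 + R0)\<bar> \<le> e * (R0\<^sup>2 * exp R + y ^ 6 / (45 * N\<^sup>2))"
      by (intro mult_left_mono) (auto simp: e_def)
    also have "\<dots> = R0\<^sup>2 * (e * exp R) + y ^ 6 / (45 * N\<^sup>2) * e" by (simp add: algebra_simps)
    also have "\<dots> \<le> (y ^ 8 / N\<^sup>2) * (exp (3 - \<bar>w\<bar> / 10)) + (y ^ 6 / N\<^sup>2) * e"
    proof (intro add_mono mult_mono D)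
      have "R0\<^sup>2 = y ^ 8 / (144 * N\<^sup>2)" by (simp add: R0_def power_divide power_mult_distrib)
      also have "\<dots> \<le> y ^ 8 / N\<^sup>2" using N0 by (simp add: field_simps)
      finally show "R0\<^sup>2 \<le> y ^ 8 / N\<^sup>2" .
      show "y ^ 6 / (45 * N\<^sup>2) \<le> y ^ 6 / N\<^sup>2" using N0 by (simp add: field_simps)
    qed (auto simp: e_def)
    also have "\<dots> \<le> (128 * ((1 + \<mu> ^ 8) * (1 + w ^ 8)) / N\<^sup>2) * (exp (3 - \<bar>w\<bar> / 10))
        + (129 * ((1 + \<mu> ^ 8) * (1 + w ^ 8)) / N\<^sup>2) * e"
      by (intro add_mono mult_right_mono divide_right_mono y8 y6) (auto simp: e_def)
    also have "\<dots> = (1 + \<mu> ^ 8) / N\<^sup>2 / (1 + w\<^sup>2) *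
        (128 * ((1 + w ^ 8) * (1 + w\<^sup>2) * exp (3 - \<bar>w\<bar> / 10)) + 129 * ((1 + w ^ 8) * (1 + w\<^sup>2) * e))"
    proof -
      have "128 * (A * W) / M * E + 129 * (A * W) / M * c = A / M / D * (128 * (W * D * E) + 129 * (W * D * c))"
        if "D \<noteq> 0" for A W D E M c :: real
        using that by (cases "M = 0") (simp_all add: field_simps)
      moreover have "1 + w\<^sup>2 \<noteq> 0" using zero_le_power2[of w] by linarith
      ultimately show ?thesis by blast
    qed
    also have "\<dots> \<le> (1 + \<mu> ^ 8) / N\<^sup>2 / (1 + w\<^sup>2) * (128 * K1 + 129 * K2)"
      using K1(2)[of w] K2(2)[of w] by (intro mult_left_mono add_mono) (auto simp: e_def)
    also have "\<dots> \<le> (1 + \<mu> ^ 8) / N\<^sup>2 / (1 + w\<^sup>2) * K"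
      by (intro mult_left_mono) (auto simp: K_def)
    finally have *: "e * \<bar>exp R - (1 + R0)\<bar> \<le> K * (1 + \<mu> ^ 8) / N\<^sup>2 / (1 + w\<^sup>2)" by (simp add: algebra_simps)
    have "exp (- w\<^sup>2 / 2 + gauss_remainder N (\<mu> + w)) - exp (- w\<^sup>2 / 2) * (1 + (\<mu> + w) ^ 4 / (12 * N))
       = e * (exp R - (1 + R0))"
      unfolding e_def R_def R0_def y_def exp_add by (simp add: right_diff_distrib)
    thus "\<bar>exp (- w\<^sup>2 / 2 + gauss_remainder N (\<mu> + w)) - exp (- w\<^sup>2 / 2) * (1 + (\<mu> + w) ^ 4 / (12 * N))\<bar>
       \<le> K * (1 + \<mu> ^ 8) / N\<^sup>2 / (1 + w\<^sup>2)"
      using * by (simp add: abs_mult e_def)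
  qed
qed

section \<open>Gaussian estimates\<close>

text \<open>The normal distribution function, written as an upper tail because the stock exceeds the
  strike exactly when z > -\<open>d2\<close>.\<close>

definition Phi :: "real \<Rightarrow> real" where
  "Phi w = measure std_normal {-w<..}"

interpretation std_normal: real_distribution std_normal
  unfolding std_normal_def real_distribution_def real_distribution_axioms_def
  by (auto intro: prob_space_normal_density)

lemma Phi_eq_cdf: "Phi w = 1 - cdf std_normal (- w)"
proof -
  have "{..-w} = space std_normal - {-w<..}" by (auto simp: std_normal_def)
  moreover have "measure std_normal (space std_normal - {-w<..}) = 1 - measure std_normal {-w<..}"
    by (rule std_normal.prob_compl) (simp add: std_normal_def)
  ultimately have "cdf std_normal (-w) = 1 - measure std_normal {-w<..}"
    unfolding cdf_def by simp
  thus ?thesis by (simp add: Phi_def)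
qed

lemma Phi_bounds: "0 \<le> Phi w" "Phi w \<le> 1"
  by (simp_all add: Phi_def)

lemma Phi_at_bot: "(Phi \<longlongrightarrow> 0) at_bot"
proof -
  have "((\<lambda>w. 1 - cdf std_normal (- w)) \<longlongrightarrow> 1 - 1) at_bot"
    by (intro tendsto_intros filterlim_compose[OF std_normal.cdf_lim_at_top_prob] filterlim_uminus_at_top_at_bot)
  thus ?thesis by (simp add: Phi_eq_cdf[abs_def])
qed

lemma Phi_at_top: "(Phi \<longlongrightarrow> 1) at_top"
proof -
  have "((\<lambda>w. 1 - cdf std_normal (- w)) \<longlongrightarrow> 1 - 0) at_top"
    by (intro tendsto_intros filterlim_compose[OF std_normal.cdf_lim_at_bot] filterlim_uminus_at_bot_at_top)
  thus ?thesis by (simp add: Phi_eq_cdf[abs_def])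
qed

lemma has_real_derivative_std_normal_density:
  "(std_normal_density has_real_derivative - w * std_normal_density w) (at w)"
proof -
  have "((\<lambda>w. c * exp (- w\<^sup>2 / 2)) has_real_derivative - w * (c * exp (- w\<^sup>2 / 2))) (at w)" for c
    by (auto intro!: derivative_eq_intros)
  thus ?thesis unfolding std_normal_density_def[abs_def] .
qed

lemma continuous_std_normal_density [continuous_intros]:
  "continuous_on A std_normal_density"
  unfolding std_normal_density_def by (intro continuous_intros) auto

lemma cdf_std_normal_has_derivative:
  "(cdf std_normal has_real_derivative std_normal_density w) (at w)"
proof -
  \<comment> \<open>The base point w - 1 makes w an interior point of the interval of integration,
    so that the derivative of the integral is two-sided.\<close>
  have eq: "cdf std_normal x = cdf std_normal (w - 1) + integral {w - 1..x} std_normal_density"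
    if x: "x > w - 1" for x
  proof -
    have "cdf std_normal x - cdf std_normal (w - 1) = measure std_normal {w - 1<..x}"
      using std_normal.cdf_diff_eq[OF x] .
    also have "\<dots> = enn2real (emeasure std_normal {w - 1<..x})" by (simp add: measure_def)
    also have "emeasure std_normal {w - 1<..x}
        = (\<integral>\<^sup>+ u. ennreal (std_normal_density u * indicator {w - 1<..x} u) \<partial>lborel)"
      unfolding std_normal_def
      by (subst emeasure_density) (auto intro!: nn_integral_cong simp: indicator_def)
    also have "\<dots> = (\<integral>\<^sup>+ u. ennreal (std_normal_density u * indicator {w - 1..x} u) \<partial>lborel)"
    proof (rule nn_integral_cong_AE)
      show "AE u in lborel. ennreal (std_normal_density u * indicator {w - 1<..x} u)
          = ennreal (std_normal_density u * indicator {w - 1..x} u)"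
        using AE_lborel_singleton[of "w - 1"] by eventually_elim (simp add: indicator_def)
    qed
    also have "\<dots> = ennreal (integral {w - 1..x} std_normal_density)"
    proof -
      have "std_normal_density absolutely_integrable_on {w - 1..x}"
        by (intro absolutely_integrable_continuous_real continuous_intros)
      hence "(\<lambda>u. std_normal_density u) integrable_on {w - 1..x}"
        by (rule absolutely_integrable_on_def[THEN iffD1, THEN conjunct1])
      hence "(std_normal_density has_integral integral {w - 1..x} std_normal_density) {w - 1..x}"
        by blast
      from nn_integral_has_integral_lebesgue[OF _ this] show ?thesis
        by (simp add: mult.commute)
    qed
    also have "enn2real \<dots> = integral {w - 1..x} std_normal_density"
      by (intro enn2real_ennreal integral_nonneg integrable_continuous_real continuous_intros) auto
    finally show ?thesis by simp
  qed
  have "((\<lambda>x. cdf std_normal (w - 1) + integral {w - 1..x} std_normal_density)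
      has_real_derivative std_normal_density w) (at w within {w - 1..w + 1})"
    by (rule DERIV_cong[OF DERIV_add[OF DERIV_const integral_has_real_derivative]])
       (auto intro!: continuous_intros)
  hence "((\<lambda>x. cdf std_normal (w - 1) + integral {w - 1..x} std_normal_density)
      has_real_derivative std_normal_density w) (at w)"
    by (subst (asm) at_within_interior) (auto simp: interior_atLeastAtMost_real)
  thus ?thesis
  proof (rule DERIV_cong_ev[THEN iffD1, rotated -1])
    have "eventually (\<lambda>x. x > w - 1) (nhds w)" by (intro eventually_nhds_in_open[of "{w - 1<..}" w, simplified])
    thus "eventually (\<lambda>x. cdf std_normal (w - 1) + integral {w - 1..x} std_normal_density = cdf std_normal x) (nhds w)"
      by (rule eventually_mono) (simp add: eq)
  qed simp_all
qed

lemma Phi_has_real_derivative: "(Phi has_real_derivative std_normal_density w) (at w)"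
proof -
  have "((\<lambda>w. 1 - cdf std_normal (- w)) has_real_derivative 0 - std_normal_density (- w) * (- 1)) (at w)"
    by (intro DERIV_diff DERIV_const DERIV_chain2[OF cdf_std_normal_has_derivative] DERIV_minus DERIV_ident)
  thus ?thesis by (simp add: Phi_eq_cdf[abs_def] std_normal_density_def)
qed

text \<open>Expanding (x + b)^2 >= 0 gives e^(-x^2/2) <= e^(b^2/2 + b x), to be integrated from
  -infinity. The free rate b matches the free rate of the exponential bounds in the tree.\<close>

lemma Phi_le_exp: assumes "b > 0" shows "Phi w \<le> exp (b\<^sup>2 / 2) / b * exp (b * w)"
proof -
  let ?F = "\<lambda>w. exp (b\<^sup>2 / 2) / b * exp (b * w) - Phi w"
  have "?F w \<ge> 0"
  proof (rule tendsto_upperbound[of ?F 0 at_bot])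
    have "((\<lambda>w. exp (b\<^sup>2 / 2) / b * exp (b * w)) \<longlongrightarrow> 0) at_bot" using assms by real_asymp
    from tendsto_diff[OF this Phi_at_bot] show "(?F \<longlongrightarrow> 0) at_bot" by simp
    have "?F v \<le> ?F w" if "v \<le> w" for v
    proof (rule DERIV_nonneg_imp_nondecreasing[OF that], intro exI conjI)
      fix x
      show "(?F has_real_derivative exp (b\<^sup>2 / 2) * exp (b * x) - std_normal_density x) (at x)"
        using assms by (auto intro!: derivative_eq_intros Phi_has_real_derivative)
      have "0 \<le> (x + b)\<^sup>2" by simp
      also have "\<dots> = x\<^sup>2 + b\<^sup>2 + 2 * (b * x)" by (simp add: power2_sum)
      finally have "- x\<^sup>2 / 2 \<le> b\<^sup>2 / 2 + b * x" by linarith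
      hence "exp (- x\<^sup>2 / 2) \<le> exp (b\<^sup>2 / 2) * exp (b * x)" by (simp flip: exp_add)
      moreover have "1 / sqrt (2 * pi) \<le> 1" using pi_gt3 by simp
      ultimately have "1 / sqrt (2 * pi) * exp (- x\<^sup>2 / 2) \<le> 1 * (exp (b\<^sup>2 / 2) * exp (b * x))"
        by (intro mult_mono) auto
      thus "0 \<le> exp (b\<^sup>2 / 2) * exp (b * x) - std_normal_density x"
        by (simp add: std_normal_density_def)
    qed
    thus "\<forall>\<^sub>F v in at_bot. ?F v \<le> ?F w" unfolding eventually_at_bot_linorder by blast
  qed simp
  thus ?thesis by simp
qed

text \<open>The sum Phi x + Phi (-x) has derivative 0 and tends to 1.\<close>

lemma one_minus_Phi: "1 - Phi w = Phi (- w)"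
proof -
  have "DERIV (\<lambda>x. Phi x + Phi (- x)) x :> 0" for x
  proof -
    have "DERIV (\<lambda>x. Phi x + Phi (- x)) x :> std_normal_density x + std_normal_density (- x) * (- 1)"
      by (intro DERIV_add DERIV_chain2[OF Phi_has_real_derivative] Phi_has_real_derivative DERIV_minus DERIV_ident)
    thus ?thesis by (simp add: std_normal_density_def)
  qed
  hence c: "Phi x + Phi (- x) = Phi w + Phi (- w)" for x
    by (metis DERIV_isconst_all)
  have "((\<lambda>x. Phi x + Phi (- x)) \<longlongrightarrow> 1 + 0) at_top"
    by (intro tendsto_add Phi_at_top filterlim_compose[OF Phi_at_bot] filterlim_uminus_at_bot_at_top)
  moreover have "((\<lambda>x. Phi x + Phi (- x)) \<longlongrightarrow> Phi w + Phi (- w)) at_top"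
    by (subst c) simp
  ultimately show ?thesis using tendsto_unique[OF trivial_limit_at_top_linorder] by fastforce
qed

text \<open>Chosen so that the density times this polynomial is an antiderivative of -(density)
  ((\<mu> + w)^4 - m4), where m4 = \<mu>^4 + 6 \<mu>^2 + 3 is the fourth moment of \<mu> + Z for
  standard normal Z. It is the boundary term of the quartic correction integrated up to w.\<close>

definition edge_poly :: "real \<Rightarrow> real \<Rightarrow> real" where
  "edge_poly \<mu> w = w ^ 3 + 3 * w + 4 * \<mu> * (w\<^sup>2 + 2) + 6 * \<mu>\<^sup>2 * w + 4 * \<mu> ^ 3"

lemma abs_edge_poly_le: "\<bar>edge_poly \<mu> w\<bar> \<le> 26 * ((1 + \<bar>\<mu>\<bar>) ^ 3 * (1 + \<bar>w\<bar>) ^ 3)"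
proof -
  define m where "m = \<bar>\<mu>\<bar>"
  define u where "u = \<bar>w\<bar>"
  let ?B = "(1 + m) ^ 3 * (1 + u) ^ 3"
  have *: "m ^ i * u ^ j \<le> ?B" if "i \<le> 3" "j \<le> 3" for i j
  proof (intro mult_mono)
    have "m ^ i \<le> (1 + m) ^ i" by (intro power_mono) (auto simp: m_def)
    also have "\<dots> \<le> (1 + m) ^ 3" using that by (intro power_increasing) (auto simp: m_def)
    finally show "m ^ i \<le> (1 + m) ^ 3" .
    have "u ^ j \<le> (1 + u) ^ j" by (intro power_mono) (auto simp: u_def)
    also have "\<dots> \<le> (1 + u) ^ 3" using that by (intro power_increasing) (auto simp: u_def)
    finally show "u ^ j \<le> (1 + u) ^ 3" .
  qed (auto simp: m_def u_def)
  have "\<bar>edge_poly \<mu> w\<bar> \<le> \<bar>w ^ 3\<bar> + \<bar>3 * w\<bar> + \<bar>4 * \<mu> * (w\<^sup>2 + 2)\<bar> + \<bar>6 * \<mu>\<^sup>2 * w\<bar> + \<bar>4 * \<mu> ^ 3\<bar>"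
    unfolding edge_poly_def by linarith
  also have "\<dots> = u ^ 3 + 3 * u + (4 * (m * u\<^sup>2) + 8 * m) + 6 * (m\<^sup>2 * u) + 4 * m ^ 3"
  proof -
    have "\<bar>4 * \<mu> * (w\<^sup>2 + 2)\<bar> = 4 * \<bar>\<mu>\<bar> * \<bar>w\<^sup>2 + 2\<bar>" by (simp only: abs_mult abs_numeral)
    also have "\<bar>w\<^sup>2 + 2\<bar> = \<bar>w\<bar>\<^sup>2 + 2" by simp
    also have "4 * \<bar>\<mu>\<bar> * (\<bar>w\<bar>\<^sup>2 + 2) = 4 * (m * u\<^sup>2) + 8 * m" by (simp add: m_def u_def algebra_simps)
    finally show ?thesis by (simp add: abs_mult power_abs m_def u_def)
  qed
  also have "\<dots> \<le> 26 * ?B"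
    using *[of 0 3] *[of 0 1] *[of 1 2] *[of 1 0] *[of 2 1] *[of 3 0] by simp
  finally show ?thesis by (simp add: m_def u_def)
qed

lemma std_normal_poly_bounded:
  "\<exists>K>0. \<forall>w. (1 + \<bar>w\<bar>) ^ k * exp (b * w) * std_normal_density w \<le> K"
proof -
  \<comment> \<open>From 1 + |w| <= e^|w| the whole growth is at most e^(B |w|), and B |w| <= B^2/2
    + w^2/2.\<close>
  define B where "B = real k + \<bar>b\<bar>"
  have "(1 + \<bar>w\<bar>) ^ k * exp (b * w) * std_normal_density w \<le> exp (B\<^sup>2 / 2)" for w
  proof -
    have "(1 + \<bar>w\<bar>) ^ k \<le> exp \<bar>w\<bar> ^ k" by (intro power_mono exp_ge_add_one_self) auto
    moreover have "b * w \<le> \<bar>b\<bar> * \<bar>w\<bar>" by (metis abs_ge_self abs_mult)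
    ultimately have "(1 + \<bar>w\<bar>) ^ k * exp (b * w) \<le> exp \<bar>w\<bar> ^ k * exp (\<bar>b\<bar> * \<bar>w\<bar>)"
      by (intro mult_mono) auto
    also have "\<dots> = exp (B * \<bar>w\<bar>)" by (simp add: B_def algebra_simps exp_add flip: exp_of_nat_mult)
    also have "0 \<le> (B - \<bar>w\<bar>)\<^sup>2" by simp
    hence "B * \<bar>w\<bar> \<le> B\<^sup>2 / 2 + w\<^sup>2 / 2" unfolding power2_diff power2_abs by linarith
    hence "exp (B * \<bar>w\<bar>) \<le> exp (B\<^sup>2 / 2 + w\<^sup>2 / 2)" by simp
    finally have *: "(1 + \<bar>w\<bar>) ^ k * exp (b * w) \<le> exp (B\<^sup>2 / 2) * exp (w\<^sup>2 / 2)" by (simp add: exp_add)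
    have "1 / sqrt (2 * pi) \<le> 1" using pi_gt3 by simp
    hence "std_normal_density w \<le> 1 * exp (- w\<^sup>2 / 2)"
      unfolding std_normal_density_def by (intro mult_right_mono) auto
    hence "(1 + \<bar>w\<bar>) ^ k * exp (b * w) * std_normal_density w
        \<le> exp (B\<^sup>2 / 2) * exp (w\<^sup>2 / 2) * (1 * exp (- w\<^sup>2 / 2))"
      by (intro mult_mono *) auto
    thus ?thesis by (simp flip: exp_add)
  qed
  thus ?thesis by (intro exI[of _ "exp (B\<^sup>2 / 2)"]) auto
qed

lemma density_edge_poly_bound:
  "\<exists>K>0. \<forall>\<mu> w. std_normal_density w * \<bar>edge_poly \<mu> w\<bar> \<le> K * (1 + \<bar>\<mu>\<bar>) ^ 3"
proof -
  obtain K where K: "K > 0" "\<And>w. (1 + \<bar>w\<bar>) ^ 3 * exp (0 * w) * std_normal_density w \<le> K"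
    using std_normal_poly_bounded[of 3 0] by blast
  have "std_normal_density w * \<bar>edge_poly \<mu> w\<bar> \<le> 26 * K * (1 + \<bar>\<mu>\<bar>) ^ 3" for \<mu> w
  proof -
    have "std_normal_density w * \<bar>edge_poly \<mu> w\<bar> \<le> std_normal_density w * (26 * ((1 + \<bar>\<mu>\<bar>) ^ 3 * (1 + \<bar>w\<bar>) ^ 3))"
      by (intro mult_left_mono abs_edge_poly_le) auto
    also have "\<dots> = 26 * (1 + \<bar>\<mu>\<bar>) ^ 3 * ((1 + \<bar>w\<bar>) ^ 3 * exp (0 * w) * std_normal_density w)" by simp
    also have "\<dots> \<le> 26 * (1 + \<bar>\<mu>\<bar>) ^ 3 * K" by (intro mult_left_mono K) auto
    finally show ?thesis by (simp add: mult_ac)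
  qed
  thus ?thesis using K(1) by (intro exI[of _ "26 * K"]) auto
qed

lemma has_real_derivative_density_edge_poly:
  "((\<lambda>w. std_normal_density w * edge_poly \<mu> w) has_real_derivative
     - (std_normal_density w * ((\<mu> + w) ^ 4 - (\<mu> ^ 4 + 6 * \<mu>\<^sup>2 + 3)))) (at w)"
proof -
  have "(edge_poly \<mu> has_real_derivative 3 * w\<^sup>2 + 3 + 8 * \<mu> * w + 6 * \<mu>\<^sup>2) (at w)"
    unfolding edge_poly_def[abs_def] by (rule derivative_eq_intros refl | simp)+
  note DERIV_mult[OF has_real_derivative_std_normal_density this]
  moreover have "(3 * w\<^sup>2 + 3 + 8 * \<mu> * w + 6 * \<mu>\<^sup>2) - w * edge_poly \<mu> w
      = - ((\<mu> + w) ^ 4 - (\<mu> ^ 4 + 6 * \<mu>\<^sup>2 + 3))"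
    unfolding edge_poly_def by algebra
  hence "- w * std_normal_density w * edge_poly \<mu> w
      + (3 * w\<^sup>2 + 3 + 8 * \<mu> * w + 6 * \<mu>\<^sup>2) * std_normal_density w
      = - (std_normal_density w * ((\<mu> + w) ^ 4 - (\<mu> ^ 4 + 6 * \<mu>\<^sup>2 + 3)))" by algebra
  ultimately show ?thesis by simp
qed

section \<open>Integration over the line by monotonicity and limits\<close>

lemma nondecreasing_ge_limit_at_bot:
  fixes F F' :: "real \<Rightarrow> real"
  assumes "\<And>x. (F has_real_derivative F' x) (at x)" "\<And>x. F' x \<ge> 0" "(F \<longlongrightarrow> L) at_bot"
  shows "L \<le> F w"
proof (rule tendsto_upperbound[OF assms(3)])
  have "F v \<le> F w" if "v \<le> w" for v
    by (rule DERIV_nonneg_imp_nondecreasing[OF that]) (use assms(1,2) in blast)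
  thus "\<forall>\<^sub>F v in at_bot. F v \<le> F w" unfolding eventually_at_bot_linorder by blast
qed simp

lemma nondecreasing_le_limit_at_top:
  fixes F F' :: "real \<Rightarrow> real"
  assumes "\<And>x. (F has_real_derivative F' x) (at x)" "\<And>x. F' x \<ge> 0" "(F \<longlongrightarrow> L) at_top"
  shows "F w \<le> L"
proof (rule tendsto_lowerbound[OF assms(3)])
  have "F w \<le> F v" if "w \<le> v" for v
    by (rule DERIV_nonneg_imp_nondecreasing[OF that]) (use assms(1,2) in blast)
  thus "\<forall>\<^sub>F v in at_top. F w \<le> F v" unfolding eventually_at_top_linorder by blast
qed simp

text \<open>For c = 1 and c = -1 the function c D + e arctan is nondecreasing and starts from -e
  pi/2 at -infinity.\<close>

lemma abs_le_arctan_domination: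
  fixes D D' :: "real \<Rightarrow> real"
  assumes D: "\<And>x. (D has_real_derivative D' x) (at x)"
    and D': "\<And>x. \<bar>D' x\<bar> \<le> e / (1 + x\<^sup>2)" and lim: "(D \<longlongrightarrow> 0) at_bot"
  shows "\<bar>D w\<bar> \<le> e * pi"
proof -
  have e: "e \<ge> 0" using D'[of 0] by simp
  have A: "((\<lambda>x. e * arctan x) \<longlongrightarrow> e * (- (pi / 2))) at_bot"
    by (intro tendsto_intros tendsto_arctan_at_bot)
  have ar: "e * arctan w \<le> e * (pi / 2)" using arctan_ubound[of w] e by (intro mult_left_mono) auto
  have B: "- e \<le> D' x * (1 + x\<^sup>2)" "D' x * (1 + x\<^sup>2) \<le> e" for x
  proof -
    have p: "1 + x\<^sup>2 > 0" by (simp add: add_pos_nonneg)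
    have "\<bar>D' x\<bar> * (1 + x\<^sup>2) \<le> e" using D'[of x] p by (simp add: pos_le_divide_eq)
    hence "\<bar>D' x * (1 + x\<^sup>2)\<bar> \<le> e" using p by (simp add: abs_mult)
    thus "- e \<le> D' x * (1 + x\<^sup>2)" "D' x * (1 + x\<^sup>2) \<le> e" by linarith+
  qed
  have d: "((\<lambda>x. c * D x + e * arctan x) has_real_derivative c * D' x + e * inverse (1 + x\<^sup>2)) (at x)" for c x
    by (intro DERIV_add DERIV_cmult D DERIV_arctan)
  have n: "c * D' x + e * inverse (1 + x\<^sup>2) \<ge> 0" if "c = 1 \<or> c = -1" for c x
  proof -
    have p: "1 + x\<^sup>2 > 0" by (simp add: add_pos_nonneg)
    have "0 \<le> (c * (D' x * (1 + x\<^sup>2)) + e) * inverse (1 + x\<^sup>2)"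
      using that B[of x] p by (intro mult_nonneg_nonneg) auto
    also have "\<dots> = c * D' x + e * inverse (1 + x\<^sup>2)" using p by (simp add: field_simps)
    finally show ?thesis .
  qed
  have l: "c * 0 + e * (- (pi / 2)) \<le> c * D w + e * arctan w" if "c = 1 \<or> c = -1" for c
    by (rule nondecreasing_ge_limit_at_bot[OF d n[OF that] tendsto_add[OF tendsto_mult_left[OF lim] A]])
  from l[of 1] have "0 - e * (pi / 2) \<le> D w + e * arctan w" by simp
  moreover from l[of "-1"] have "- 0 - e * (pi / 2) \<le> - D w + e * arctan w" by simp
  ultimately have "\<bar>D w\<bar> \<le> e * (pi / 2) + e * (pi / 2)" using ar by linarith
  thus ?thesis by (simp add: mult.commute)
qed

lemma density_edge_poly_tendsto:
  "((\<lambda>w. std_normal_density w * edge_poly \<mu> w) \<longlongrightarrow> 0) at_bot"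
  "((\<lambda>w. std_normal_density w * edge_poly \<mu> w) \<longlongrightarrow> 0) at_top"
proof -
  have eq: "(\<lambda>w. std_normal_density w * edge_poly \<mu> w) =
     (\<lambda>w. std_normal_density w * w ^ 3 + (3 + 6 * \<mu>\<^sup>2) * (std_normal_density w * w)
       + 4 * \<mu> * (std_normal_density w * w\<^sup>2) + (8 * \<mu> + 4 * \<mu> ^ 3) * std_normal_density w)"
    unfolding edge_poly_def by (rule ext) algebra
  have bot: "((\<lambda>w. std_normal_density w * w ^ 3) \<longlongrightarrow> 0) at_bot" "((\<lambda>w. std_normal_density w * w) \<longlongrightarrow> 0) at_bot"
    "((\<lambda>w. std_normal_density w * w\<^sup>2) \<longlongrightarrow> 0) at_bot" "(std_normal_density \<longlongrightarrow> 0) at_bot"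
    unfolding std_normal_density_def[abs_def] by real_asymp+
  have top: "((\<lambda>w. std_normal_density w * w ^ 3) \<longlongrightarrow> 0) at_top" "((\<lambda>w. std_normal_density w * w) \<longlongrightarrow> 0) at_top"
    "((\<lambda>w. std_normal_density w * w\<^sup>2) \<longlongrightarrow> 0) at_top" "(std_normal_density \<longlongrightarrow> 0) at_top"
    unfolding std_normal_density_def[abs_def] by real_asymp+
  show "((\<lambda>w. std_normal_density w * edge_poly \<mu> w) \<longlongrightarrow> 0) at_bot"
    unfolding eq by (rule tendsto_eq_intros bot refl)+ simp
  show "((\<lambda>w. std_normal_density w * edge_poly \<mu> w) \<longlongrightarrow> 0) at_top"
    unfolding eq by (rule tendsto_eq_intros top refl)+ simp
qed

lemma one_plus_power8_le: "1 + \<mu> ^ 8 \<le> (1 + \<bar>\<mu>\<bar>) ^ 8" for \<mu> :: real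
proof -
  have sq: "1 + x\<^sup>2 \<le> (1 + x)\<^sup>2" if "x \<ge> 0" for x :: real
    using that by (simp add: power2_sum)
  have "1 + \<mu> ^ 8 = 1 + ((\<bar>\<mu>\<bar>\<^sup>2)\<^sup>2)\<^sup>2" by (simp add: power_even_abs)
  also have "\<dots> \<le> (1 + (\<bar>\<mu>\<bar>\<^sup>2)\<^sup>2)\<^sup>2" by (intro sq) auto
  also have "\<dots> \<le> ((1 + \<bar>\<mu>\<bar>\<^sup>2)\<^sup>2)\<^sup>2" by (intro power_mono sq) auto
  also have "\<dots> \<le> (((1 + \<bar>\<mu>\<bar>)\<^sup>2)\<^sup>2)\<^sup>2" by (intro power_mono sq) auto
  also have "\<dots> = (1 + \<bar>\<mu>\<bar>) ^ 8" by (simp flip: power_mult)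
  finally show ?thesis .
qed

text \<open>
  Multiplying the candidate \<open>b \<Phi>(w) - \<phi>(w) Q(\<mu>,w) / (12 N)\<close>, whose derivative is the first-order
  approximation of the integrand, by the unknown constant \<open>c\<close> leaves a difference controlled by
  \<open>arctan\<close>; the limit at \<open>+\<infinity>\<close> then determines \<open>c\<close>.
\<close>

lemma laplace_expansion:
  "\<exists>K>0. \<exists>N0\<ge>1. \<forall>N \<mu> c T. N \<ge> N0 \<longrightarrow> 1 + \<mu> ^ 8 \<le> N \<longrightarrow> 0 \<le> c \<longrightarrow>
     (\<forall>w. (T has_real_derivative c * exp (- w\<^sup>2 / 2 + gauss_remainder N (\<mu> + w))) (at w)) \<longrightarrow>
     (T \<longlongrightarrow> 0) at_bot \<longrightarrow> (T \<longlongrightarrow> 1) at_top \<longrightarrow>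
     (\<forall>w. \<bar>T w - (Phi w - std_normal_density w * edge_poly \<mu> w / (12 * N))\<bar>
           \<le> K * (1 + \<bar>\<mu>\<bar>) ^ 8 / N\<^sup>2)"
proof -
  obtain K1 where K1: "K1 > 0" "\<And>N \<mu> w. N \<ge> 1 \<Longrightarrow> 10 * \<bar>\<mu>\<bar> \<le> sqrt N \<Longrightarrow> \<mu> ^ 4 \<le> N \<Longrightarrow>
     \<bar>exp (- w\<^sup>2 / 2 + gauss_remainder N (\<mu> + w)) - exp (- w\<^sup>2 / 2) * (1 + (\<mu> + w) ^ 4 / (12 * N))\<bar>
       \<le> K1 * (1 + \<mu> ^ 8) / N\<^sup>2 / (1 + w\<^sup>2)"
    using laplace_integrand_bound by blast
  obtain K2 where K2: "K2 > 0" "\<And>\<mu> w. std_normal_density w * \<bar>edge_poly \<mu> w\<bar> \<le> K2 * (1 + \<bar>\<mu>\<bar>) ^ 3"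
    using density_edge_poly_bound by blast
  define K where "K = 16 * K1 + K2"
  \<comment> \<open>1000 turns 1 + \<mu>^8 <= N into 10 |\<mu>| <= sqrt N, as
    \<open>gauss_remainder_domination\<close> demands; 8 \<open>K1\<close> makes the error constant
    satisfy e pi <= 1/2.\<close>
  define N0 where "N0 = max 1000 (8 * K1)"
  show ?thesis
  proof (rule exI[of _ K], intro conjI exI[of _ N0] allI impI)
    show "K > 0" using K1 K2 by (simp add: K_def)
    show "N0 \<ge> 1" by (simp add: N0_def)
    fix N \<mu> c w :: real and T :: "real \<Rightarrow> real"
    assume N: "N \<ge> N0" and \<mu>: "1 + \<mu> ^ 8 \<le> N" and c: "c \<ge> 0"
      and T: "\<forall>w. (T has_real_derivative c * exp (- w\<^sup>2 / 2 + gauss_remainder N (\<mu> + w))) (at w)"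
      and Tbot: "(T \<longlongrightarrow> 0) at_bot" and Ttop: "(T \<longlongrightarrow> 1) at_top"
    have N1: "N \<ge> 1000" "N \<ge> 8 * K1" using N by (auto simp: N0_def)
    hence N0: "N > 0" by simp
    have \<mu>4: "\<mu> ^ 4 \<le> N"
    proof -
      have "0 \<le> (\<mu> ^ 4 - 1)\<^sup>2 + \<mu> ^ 8 + 1" by simp
      hence "2 * \<mu> ^ 4 \<le> 2 + 2 * \<mu> ^ 8" by (simp add: power2_diff)
      thus ?thesis using \<mu> by simp
    qed
    have "100 * \<mu>\<^sup>2 \<le> N"
    proof (cases "\<mu>\<^sup>2 \<le> 10")
      case False
      hence "10 ^ 3 * \<mu>\<^sup>2 \<le> (\<mu>\<^sup>2) ^ 3 * \<mu>\<^sup>2" by (intro mult_right_mono power_mono) auto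
      also have "\<dots> = \<mu> ^ 8" by (simp flip: power_mult power_add)
      finally have "1000 * \<mu>\<^sup>2 \<le> \<mu> ^ 8" by simp
      thus ?thesis using \<mu> zero_le_power2[of \<mu>] by linarith
    qed (use N1 in simp)
    hence "(10 * \<bar>\<mu>\<bar>)\<^sup>2 \<le> N" by (simp add: power_mult_distrib)
    hence \<mu>10: "10 * \<bar>\<mu>\<bar> \<le> sqrt N" by (rule real_le_rsqrt)
    define e where "e = K1 * (1 + \<mu> ^ 8) / N\<^sup>2"
    \<comment> \<open>12 B is the fourth moment of \<mu> + Z for standard normal Z, so b is the
      total mass of the first-order approximation and the limit of \<open>P\<close> at
      +infinity.\<close>
    define B where "B = (\<mu> ^ 4 + 6 * \<mu>\<^sup>2 + 3) / 12"
    define b where "b = 1 + B / N"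
    define P where "P = (\<lambda>w. b * Phi w - std_normal_density w * edge_poly \<mu> w / (12 * N))"
    define c' where "c' = c * sqrt (2 * pi)"
    define D where "D = (\<lambda>w. T w - c' * P w)"
    have B: "B \<ge> 0" by (simp add: B_def)
    have b: "b \<ge> 1" using B N0 by (simp add: b_def)
    have P: "(P has_real_derivative std_normal_density w * (1 + (\<mu> + w) ^ 4 / (12 * N))) (at w)" for w
    proof -
      have "(P has_real_derivative b * std_normal_density w
         - - (std_normal_density w * ((\<mu> + w) ^ 4 - (\<mu> ^ 4 + 6 * \<mu>\<^sup>2 + 3))) / (12 * N)) (at w)"
        unfolding P_def
        by (intro DERIV_diff DERIV_cmult DERIV_cdivide Phi_has_real_derivative has_real_derivative_density_edge_poly)
      also have "b * std_normal_density w
         - - (std_normal_density w * ((\<mu> + w) ^ 4 - (\<mu> ^ 4 + 6 * \<mu>\<^sup>2 + 3))) / (12 * N)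
         = std_normal_density w * (1 + (\<mu> + w) ^ 4 / (12 * N))"
      proof -
        have "\<mu> ^ 4 + 6 * \<mu>\<^sup>2 + 3 = 12 * B" by (simp add: B_def)
        thus ?thesis using N0 by (simp add: b_def field_simps)
      qed
      finally show ?thesis .
    qed
    have P': "std_normal_density w * (1 + (\<mu> + w) ^ 4 / (12 * N)) \<ge> 0" for w
      using N0 by simp
    have Pbot: "(P \<longlongrightarrow> 0) at_bot"
      unfolding P_def by (rule tendsto_eq_intros Phi_at_bot density_edge_poly_tendsto refl | use N0 in simp)+
    have Ptop: "(P \<longlongrightarrow> b) at_top"
      unfolding P_def by (rule tendsto_eq_intros Phi_at_top density_edge_poly_tendsto refl | use N0 in simp)+
    have P0: "0 \<le> P w" for w by (rule nondecreasing_ge_limit_at_bot[OF P P' Pbot])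
    have Pb: "P w \<le> b" for w by (rule nondecreasing_le_limit_at_top[OF P P' Ptop])
    have c'c: "c \<le> c'"
    proof -
      have "1 \<le> sqrt (2 * pi)" using pi_gt3 by simp
      hence "c * 1 \<le> c * sqrt (2 * pi)" using c by (intro mult_left_mono)
      thus ?thesis by (simp add: c'_def)
    qed
    hence c'0: "c' \<ge> 0" using c by simp
    have e0: "e \<ge> 0" using K1 N0 by (simp add: e_def)
    have epi: "e * pi \<le> 1 / 2"
    proof -
      have "e \<le> K1 * N / N\<^sup>2" unfolding e_def using \<mu> K1 N0 by (intro divide_right_mono mult_left_mono) auto
      also have "\<dots> = K1 / N" using N0 by (simp add: power2_eq_square)
      also have "\<dots> \<le> 1 / 8" using N1 N0 by (simp add: field_simps)
      finally have "e * pi \<le> 1 / 8 * 4" using pi_less_4 e0 by (intro mult_mono) auto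
      thus ?thesis by simp
    qed
    have D: "\<bar>D w\<bar> \<le> (c * e) * pi" for w
    proof (rule abs_le_arctan_domination[where D = D and D' = "\<lambda>x. c * exp (- x\<^sup>2 / 2 + gauss_remainder N (\<mu> + x))
          - c' * (std_normal_density x * (1 + (\<mu> + x) ^ 4 / (12 * N)))"])
      fix x
      show "(D has_real_derivative c * exp (- x\<^sup>2 / 2 + gauss_remainder N (\<mu> + x))
          - c' * (std_normal_density x * (1 + (\<mu> + x) ^ 4 / (12 * N)))) (at x)"
        unfolding D_def by (intro DERIV_diff DERIV_cmult P T[rule_format])
      have "c * exp (- x\<^sup>2 / 2 + gauss_remainder N (\<mu> + x))
          - c' * (std_normal_density x * (1 + (\<mu> + x) ^ 4 / (12 * N)))
          = c * (exp (- x\<^sup>2 / 2 + gauss_remainder N (\<mu> + x)) - exp (- x\<^sup>2 / 2) * (1 + (\<mu> + x) ^ 4 / (12 * N)))"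
        by (simp add: c'_def std_normal_density_def right_diff_distrib)
      hence "\<bar>c * exp (- x\<^sup>2 / 2 + gauss_remainder N (\<mu> + x))
          - c' * (std_normal_density x * (1 + (\<mu> + x) ^ 4 / (12 * N)))\<bar>
          = c * \<bar>exp (- x\<^sup>2 / 2 + gauss_remainder N (\<mu> + x)) - exp (- x\<^sup>2 / 2) * (1 + (\<mu> + x) ^ 4 / (12 * N))\<bar>"
        using c by (simp add: abs_mult)
      also have "\<dots> \<le> c * (e / (1 + x\<^sup>2))"
        unfolding e_def using K1(2)[of N \<mu> x] N1 \<mu>10 \<mu>4 c by (intro mult_left_mono) auto
      finally show "\<bar>c * exp (- x\<^sup>2 / 2 + gauss_remainder N (\<mu> + x))
          - c' * (std_normal_density x * (1 + (\<mu> + x) ^ 4 / (12 * N)))\<bar> \<le> c * e / (1 + x\<^sup>2)" by simp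
    next
      show "(D \<longlongrightarrow> 0) at_bot"
        unfolding D_def by (rule tendsto_eq_intros Tbot Pbot refl | simp)+
    qed
    have cb: "\<bar>1 - c' * b\<bar> \<le> c * e * pi"
    proof (rule tendsto_upperbound)
      show "((\<lambda>w. \<bar>D w\<bar>) \<longlongrightarrow> \<bar>1 - c' * b\<bar>) at_top"
        unfolding D_def by (intro tendsto_intros Ttop Ptop)
      show "\<forall>\<^sub>F w in at_top. \<bar>D w\<bar> \<le> c * e * pi" using D by simp
    qed simp
    \<comment> \<open>The error bound is proportional to the unknown constant, so it is bounded
      through itself: c' <= c' b <= 1 + c e pi <= 1 + c'/2.\<close>
    have c2: "c' \<le> 2"
    proof -
      have "c * (e * pi) \<le> c' * (1 / 2)" using epi c'c c'0 c e0 by (intro mult_mono) auto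
      moreover have "c' * 1 \<le> c' * b" using b c'0 by (intro mult_left_mono)
      ultimately show ?thesis using cb unfolding abs_le_iff by (simp add: mult.assoc)
    qed
    have cepi: "c * e * pi \<le> 8 * e"
    proof -
      have "c * e * pi \<le> 2 * e * 4" using c2 c'c c e0 pi_less_4 by (intro mult_mono) auto
      thus ?thesis by simp
    qed
    have Tb: "\<bar>T w - P w / b\<bar> \<le> 16 * e"
    proof -
      have "T w - P w / b = D w + (P w / b) * (c' * b - 1)" using b by (simp add: D_def field_simps)
      hence "\<bar>T w - P w / b\<bar> \<le> \<bar>D w\<bar> + \<bar>P w / b\<bar> * \<bar>c' * b - 1\<bar>"
        by (metis abs_mult abs_triangle_ineq)
      also have "\<bar>P w / b\<bar> \<le> 1" using P0[of w] Pb[of w] b by (simp add: divide_simps)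
      hence "\<bar>P w / b\<bar> * \<bar>c' * b - 1\<bar> \<le> 1 * (c * e * pi)"
        using cb by (intro mult_mono) (auto simp: abs_minus_commute)
      finally show ?thesis using D[of w] cepi by linarith
    qed
    \<comment> \<open>Dividing \<open>P\<close> by b restores \<open>Phi\<close> exactly and changes
      the edge term, already of order 1/N, only by the relative amount B/(N b).\<close>
    have E: "\<bar>P w / b - (Phi w - std_normal_density w * edge_poly \<mu> w / (12 * N))\<bar>
        \<le> K2 * (1 + \<bar>\<mu>\<bar>) ^ 8 / N\<^sup>2"
    proof -
      have "P w / b - (Phi w - std_normal_density w * edge_poly \<mu> w / (12 * N))
         = (std_normal_density w * edge_poly \<mu> w) * (B / (12 * N\<^sup>2 * b))"
      proof -
        have "1 - 1 / b = (b - 1) / b" using b by (simp add: diff_divide_distrib)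
        hence *: "1 - 1 / b = B / (N * b)" by (simp add: b_def)
        define X where "X = std_normal_density w * edge_poly \<mu> w / (12 * N)"
        have "P w / b = Phi w - X / b" using b by (simp add: P_def X_def diff_divide_distrib)
        hence "P w / b - (Phi w - X) = X * (1 - 1 / b)" by (simp add: right_diff_distrib)
        also have "\<dots> = (std_normal_density w * edge_poly \<mu> w) * (B / (12 * N\<^sup>2 * b))"
          unfolding * X_def by (simp add: power2_eq_square)
        finally show ?thesis by (simp add: X_def)
      qed
      hence "\<bar>P w / b - (Phi w - std_normal_density w * edge_poly \<mu> w / (12 * N))\<bar>
         = (std_normal_density w * \<bar>edge_poly \<mu> w\<bar>) * (B / (12 * N\<^sup>2 * b))"
        using B b by (simp add: abs_mult)
      also have "\<dots> \<le> (K2 * (1 + \<bar>\<mu>\<bar>) ^ 3) * ((1 + \<bar>\<mu>\<bar>) ^ 5 / N\<^sup>2)"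
      proof (rule mult_mono[OF K2(2)])
        have "\<mu> ^ 4 = \<bar>\<mu>\<bar> ^ 4" "\<mu>\<^sup>2 = \<bar>\<mu>\<bar>\<^sup>2" by (simp_all add: power_even_abs)
        hence "12 * B = \<bar>\<mu>\<bar> ^ 4 + 6 * \<bar>\<mu>\<bar>\<^sup>2 + 3" by (simp add: B_def)
        also have "\<dots> \<le> 12 * (1 + \<bar>\<mu>\<bar>) ^ 4"
        proof -
          have "12 * (1 + \<bar>\<mu>\<bar>) ^ 4 = 12 + 48 * \<bar>\<mu>\<bar> + 72 * \<bar>\<mu>\<bar>\<^sup>2 + 48 * \<bar>\<mu>\<bar> ^ 3 + 12 * \<bar>\<mu>\<bar> ^ 4" by algebra
          thus ?thesis by simp
        qed
        also have "(1 + \<bar>\<mu>\<bar>) ^ 4 \<le> (1 + \<bar>\<mu>\<bar>) ^ 5" by (intro power_increasing) auto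
        finally have "B \<le> (1 + \<bar>\<mu>\<bar>) ^ 5" by simp
        moreover have "1 * N\<^sup>2 \<le> (12 * b) * N\<^sup>2" using b by (intro mult_right_mono) auto
        ultimately show "B / (12 * N\<^sup>2 * b) \<le> (1 + \<bar>\<mu>\<bar>) ^ 5 / N\<^sup>2"
          using N0 B by (intro frac_le) (auto simp: mult_ac)
      qed (use B b K2 in auto)
      also have "\<dots> = K2 * (1 + \<bar>\<mu>\<bar>) ^ 8 / N\<^sup>2" by (simp flip: power_add)
      finally show ?thesis .
    qed
    have "e \<le> K1 * (1 + \<bar>\<mu>\<bar>) ^ 8 / N\<^sup>2"
      unfolding e_def using one_plus_power8_le[of \<mu>] K1 by (intro divide_right_mono mult_left_mono) auto
    hence "16 * e + K2 * (1 + \<bar>\<mu>\<bar>) ^ 8 / N\<^sup>2 \<le> 16 * (K1 * (1 + \<bar>\<mu>\<bar>) ^ 8 / N\<^sup>2) + K2 * (1 + \<bar>\<mu>\<bar>) ^ 8 / N\<^sup>2"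
      by simp
    also have "\<dots> = K * (1 + \<bar>\<mu>\<bar>) ^ 8 / N\<^sup>2" by (simp add: K_def add_divide_distrib algebra_simps)
    finally show "\<bar>T w - (Phi w - std_normal_density w * edge_poly \<mu> w / (12 * N))\<bar> \<le> K * (1 + \<bar>\<mu>\<bar>) ^ 8 / N\<^sup>2"
      using Tb E by linarith
  qed
qed

section \<open>Binomial tails as Laplace integrals\<close>

definition binom_tail :: "nat \<Rightarrow> nat \<Rightarrow> real \<Rightarrow> real" where
  "binom_tail n j p = (\<Sum>i=j..n. real (n choose i) * p ^ i * (1 - p) ^ (n - i))"

text \<open>The derivative telescopes: the negative half of each summand cancels the positive half
  of the next, by the two absorption identities for binomial coefficients, and only the lower
  boundary term survives. Hence the downward induction from j = n.\<close>

lemma binom_tail_has_real_derivative: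
  assumes "1 \<le> j" "j \<le> n"
  shows "(binom_tail n j has_real_derivative
     real n * real ((n - 1) choose (j - 1)) * p ^ (j - 1) * (1 - p) ^ (n - j)) (at p)"
  using assms(2,1)
proof (induction j rule: inc_induct)
  case base
  have "binom_tail n n = (\<lambda>p. p ^ n)" by (simp add: binom_tail_def fun_eq_iff)
  thus ?case using DERIV_pow[of n p] by simp
next
  case (step j)
  have "binom_tail n j = (\<lambda>p. real (n choose j) * p ^ j * (1 - p) ^ (n - j) + binom_tail n (Suc j) p)"
    using step.hyps by (intro ext) (simp add: binom_tail_def sum.atLeast_Suc_atMost)
  note eq = this
  have D: "((\<lambda>p. real (n choose j) * p ^ j * (1 - p) ^ (n - j) + binom_tail n (Suc j) p) has_real_derivative
     real (n choose j) * (real j * p ^ (j - 1)) * (1 - p) ^ (n - j)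
     - real (n choose j) * p ^ j * (real (n - j) * (1 - p) ^ (n - j - 1))
     + real n * real ((n - 1) choose j) * p ^ j * (1 - p) ^ (n - Suc j)) (at p)"
  proof (rule DERIV_add)
    show "((\<lambda>p. real (n choose j) * p ^ j * (1 - p) ^ (n - j)) has_real_derivative
       real (n choose j) * (real j * p ^ (j - 1)) * (1 - p) ^ (n - j)
       - real (n choose j) * p ^ j * (real (n - j) * (1 - p) ^ (n - j - 1))) (at p)"
    proof -
      have 1: "((\<lambda>p. p ^ j) has_real_derivative real j * p ^ (j - 1)) (at p)"
        using DERIV_pow[of j p] by simp
      have 2: "((\<lambda>p. (1 - p) ^ (n - j)) has_real_derivative real (n - j) * (1 - p) ^ (n - j - 1) * (0 - 1)) (at p)"
        by (rule DERIV_cong[OF DERIV_chain2[OF DERIV_pow[of "n - j" "1 - p"] DERIV_diff[OF DERIV_const DERIV_ident]]])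
           simp
      show ?thesis
        by (rule DERIV_cong[OF DERIV_mult[OF DERIV_cmult[OF 1] 2]]) (simp add: mult_ac)
    qed
    show "(binom_tail n (Suc j) has_real_derivative
        real n * real ((n - 1) choose j) * p ^ j * (1 - p) ^ (n - Suc j)) (at p)"
      using step.IH by simp
  qed
  have "real (n choose j) * real j = real n * real ((n - 1) choose (j - 1))"
    using binomial_absorption[of "j - 1" n] step by (simp flip: of_nat_mult add: mult.commute)
  hence E1: "real (n choose j) * (real j * p ^ (j - 1)) * (1 - p) ^ (n - j)
      = real n * real ((n - 1) choose (j - 1)) * p ^ (j - 1) * (1 - p) ^ (n - j)"
    unfolding mult.assoc[symmetric] by (simp only:)
  have "real (n choose j) * real (n - j) = real n * real ((n - 1) choose j)"
    using binomial_absorb_comp[of n j] by (simp flip: of_nat_mult add: mult.commute)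
  hence E2: "real (n choose j) * p ^ j * (real (n - j) * (1 - p) ^ (n - j - 1))
      = real n * real ((n - 1) choose j) * p ^ j * (1 - p) ^ (n - Suc j)"
  proof -
    assume *: "real (n choose j) * real (n - j) = real n * real ((n - 1) choose j)"
    have "real (n choose j) * p ^ j * (real (n - j) * (1 - p) ^ (n - j - 1))
        = (real (n choose j) * real (n - j)) * p ^ j * (1 - p) ^ (n - Suc j)" by simp
    thus ?thesis unfolding * .
  qed
  show ?case unfolding eq by (rule DERIV_cong[OF D], unfold E1 E2, rule diff_add_cancel)
qed

definition logistic :: "real \<Rightarrow> real" where "logistic v = 1 / (1 + exp (- 2 * v))"

lemma logistic_eq: "logistic v = exp v / (2 * cosh v)" "1 - logistic v = exp (- v) / (2 * cosh v)"
proof -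
  have "2 * cosh v = exp v * (1 + exp (- 2 * v))"
    by (simp add: cosh_def distrib_left flip: exp_add)
  moreover have "1 + exp (- 2 * v) > 0" by (simp add: add_pos_pos)
  ultimately show 1: "logistic v = exp v / (2 * cosh v)" by (simp add: logistic_def)
  have "cosh v > 0" by (simp add: cosh_real_pos)
  thus "1 - logistic v = exp (- v) / (2 * cosh v)" unfolding 1 by (simp add: cosh_def field_simps)
qed

lemma logistic_has_real_derivative:
  "(logistic has_real_derivative 2 * logistic v * (1 - logistic v)) (at v)"
proof -
  define a where "a = 1 + exp (- 2 * v)"
  have a: "a \<noteq> 0" unfolding a_def using exp_gt_zero[of "- 2 * v"] by linarith
  have D: "((\<lambda>v. 1 + exp (- 2 * v)) has_real_derivative - 2 * exp (- 2 * v)) (at v)"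
    by (auto intro!: derivative_eq_intros)
  have "logistic v = 1 / a" "exp (- 2 * v) = a - 1" by (simp_all add: logistic_def a_def)
  hence "(0 * (1 + exp (- 2 * v)) - 1 * (- 2 * exp (- 2 * v))) / ((1 + exp (- 2 * v)) * (1 + exp (- 2 * v)))
      = 2 * logistic v * (1 - logistic v)"
    unfolding \<open>logistic v = 1 / a\<close> a_def[symmetric] \<open>exp (- 2 * v) = a - 1\<close>
    using a by (simp add: field_simps)
  with DERIV_divide[OF DERIV_const[of 1] D] a show ?thesis
    unfolding logistic_def[abs_def] by (simp add: a_def)
qed

text \<open>The factor 2 p (1 - p) of the substitution raises both exponents by one. This produces
  the power n + 1 of cosh and the slope 2 j - 1 - n, the midpoint of the values 2 i - n at i = j - 1
  and i = j, which is where the center model places the strike.\<close>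

lemma binom_tail_logistic_has_real_derivative:
  assumes "1 \<le> j" "j \<le> n"
  shows "((\<lambda>v. binom_tail n j (logistic v)) has_real_derivative
     2 * real n * real ((n - 1) choose (j - 1)) / 2 ^ (n + 1) *
       (exp ((2 * real j - 1 - real n) * v) / cosh v ^ (n + 1))) (at v)"
proof -
  have "((\<lambda>v. binom_tail n j (logistic v)) has_real_derivative
     real n * real ((n - 1) choose (j - 1)) * logistic v ^ (j - 1) * (1 - logistic v) ^ (n - j)
      * (2 * logistic v * (1 - logistic v))) (at v)"
    by (rule DERIV_chain2[OF binom_tail_has_real_derivative[OF assms] logistic_has_real_derivative])
  also have "real n * real ((n - 1) choose (j - 1)) * logistic v ^ (j - 1) * (1 - logistic v) ^ (n - j)
      * (2 * logistic v * (1 - logistic v))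
      = 2 * real n * real ((n - 1) choose (j - 1)) * (logistic v ^ Suc (j - 1) * (1 - logistic v) ^ Suc (n - j))"
    by simp
  also have "logistic v ^ Suc (j - 1) * (1 - logistic v) ^ Suc (n - j)
      = exp ((2 * real j - 1 - real n) * v) / (2 * cosh v) ^ (n + 1)"
  proof -
    have "Suc (j - 1) = j" using assms by simp
    moreover have "exp v ^ j * exp (- v) ^ Suc (n - j) = exp ((2 * real j - 1 - real n) * v)"
    proof -
      have "exp v ^ j * exp (- v) ^ Suc (n - j) = exp (real j * v + real (Suc (n - j)) * (- v))"
        unfolding exp_add exp_of_nat_mult ..
      also have "real j * v + real (Suc (n - j)) * (- v) = (2 * real j - 1 - real n) * v"
        using assms by (simp add: of_nat_diff algebra_simps)
      finally show ?thesis .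
    qed
    moreover have "(2 * cosh v) ^ j * (2 * cosh v) ^ Suc (n - j) = (2 * cosh v) ^ (n + 1)"
    proof -
      have "j + Suc (n - j) = n + 1" using assms by simp
      thus ?thesis by (metis power_add)
    qed
    ultimately show ?thesis unfolding logistic_eq(2) unfolding logistic_eq(1) power_divide times_divide_times_eq by simp
  qed
  finally show ?thesis by (rule DERIV_cong) (simp add: power_mult_distrib mult_ac)
qed

lemma binom_tail_at_0: "1 \<le> j \<Longrightarrow> binom_tail n j 0 = 0"
  unfolding binom_tail_def by (intro sum.neutral) auto

lemma binom_tail_at_1: "j \<le> n \<Longrightarrow> binom_tail n j 1 = 1"
proof -
  assume "j \<le> n"
  have "binom_tail n j 1 = (\<Sum>i=j..n. if i = n then 1 else 0)"
    unfolding binom_tail_def by (intro sum.cong) auto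
  thus ?thesis using \<open>j \<le> n\<close> by simp
qed

lemma binom_tail_logistic_tendsto:
  assumes "1 \<le> j" "j \<le> n"
  shows "((\<lambda>v. binom_tail n j (logistic v)) \<longlongrightarrow> 0) at_bot"
    and "((\<lambda>v. binom_tail n j (logistic v)) \<longlongrightarrow> 1) at_top"
proof -
  have c: "isCont (binom_tail n j) p" for p
    using binom_tail_has_real_derivative[OF assms] by (rule DERIV_isCont)
  have "(logistic \<longlongrightarrow> 0) at_bot" "(logistic \<longlongrightarrow> 1) at_top"
    unfolding logistic_def[abs_def] by real_asymp+
  from this[THEN isCont_tendsto_compose[OF c]] assms
  show "((\<lambda>v. binom_tail n j (logistic v)) \<longlongrightarrow> 0) at_bot"
    "((\<lambda>v. binom_tail n j (logistic v)) \<longlongrightarrow> 1) at_top"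
    by (simp_all add: binom_tail_at_0 binom_tail_at_1)
qed

text \<open>In the variable \<open>w = \<surd>N v - \<mu>\<close> with \<open>N = n + 1\<close> and \<open>\<mu> = (2j - 1 - n) / \<surd>N\<close>
  the incomplete beta integrand \<open>e\<^bsup>(2j-1-n)v\<^esup> / cosh\<^bsup>n+1\<^esup> v\<close> is a perturbed Gaussian.\<close>

lemma binom_tail_gaussian_derivative:
  assumes "1 \<le> j" "j \<le> n"
  defines "N \<equiv> real n + 1"
  defines "\<mu> \<equiv> (2 * real j - 1 - real n) / sqrt N"
  shows "\<exists>c\<ge>0. \<forall>w. ((\<lambda>w. binom_tail n j (logistic ((\<mu> + w) / sqrt N))) has_real_derivative
           c * exp (- w\<^sup>2 / 2 + gauss_remainder N (\<mu> + w))) (at w)"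
proof -
  define c0 where "c0 = 2 * real n * real ((n - 1) choose (j - 1)) / 2 ^ (n + 1)"
  have N: "N > 0" by (simp add: N_def)
  have "((\<lambda>w. binom_tail n j (logistic ((\<mu> + w) / sqrt N))) has_real_derivative
           (c0 / sqrt N * exp (\<mu>\<^sup>2 / 2)) * exp (- w\<^sup>2 / 2 + gauss_remainder N (\<mu> + w))) (at w)" for w
  proof -
    define v where "v = (\<mu> + w) / sqrt N"
    have D: "((\<lambda>w. binom_tail n j (logistic ((\<mu> + w) / sqrt N))) has_real_derivative
       c0 * (exp ((2 * real j - 1 - real n) * v) / cosh v ^ (n + 1)) * ((0 + 1) / sqrt N)) (at w)"
      unfolding c0_def v_def
      by (intro DERIV_chain2[OF binom_tail_logistic_has_real_derivative[OF assms(1,2)]]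
            DERIV_cdivide DERIV_add DERIV_const DERIV_ident)
    have E: "exp ((2 * real j - 1 - real n) * v) / cosh v ^ (n + 1)
        = exp (\<mu>\<^sup>2 / 2) * exp (- w\<^sup>2 / 2 + gauss_remainder N (\<mu> + w))"
    proof -
      have cp: "cosh v > 0" by (simp add: cosh_real_pos)
      have "cosh v ^ (n + 1) = exp (ln (cosh v)) ^ (n + 1)" using cp by simp
      also have "\<dots> = exp (real (n + 1) * ln (cosh v))" unfolding exp_of_nat_mult ..
      also have "real (n + 1) = N" by (simp add: N_def)
      finally have c: "cosh v ^ (n + 1) = exp (N * ln (cosh v))" .
      have "(2 * real j - 1 - real n) * v = \<mu> * (\<mu> + w)"
        using N by (simp add: \<mu>_def v_def)
      also have "\<dots> = \<mu>\<^sup>2 / 2 - w\<^sup>2 / 2 + (\<mu> + w)\<^sup>2 / 2" by (simp add: power2_eq_square field_simps)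
      finally have "(2 * real j - 1 - real n) * v - N * ln (cosh v)
          = \<mu>\<^sup>2 / 2 + (- w\<^sup>2 / 2 + gauss_remainder N (\<mu> + w))"
        by (simp add: gauss_remainder_def v_def)
      thus ?thesis unfolding c by (simp flip: exp_diff exp_add)
    qed
    show ?thesis by (rule DERIV_cong[OF D[unfolded E]]) simp
  qed
  moreover have "c0 / sqrt N * exp (\<mu>\<^sup>2 / 2) \<ge> 0" by (simp add: c0_def N_def)
  ultimately show ?thesis by blast
qed

section \<open>Expansion at moderate log-moneyness\<close>

lemma abs_mult_le_mult: "\<bar>a\<bar> \<le> A \<Longrightarrow> \<bar>b\<bar> \<le> B \<Longrightarrow> \<bar>a * b\<bar> \<le> A * B" for a b A B :: real
  unfolding abs_mult by (intro mult_mono) auto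

lemma divide_le_self: "0 \<le> d \<Longrightarrow> 1 \<le> c \<Longrightarrow> d / c \<le> d" for c d :: real
  using frac_le[of d d 1 c] by simp

text \<open>Makes an expansion found by \<open>real_asymp\<close> an inequality with fixed
  constants, so that it can be applied uniformly to arguments depending on \<theta>.\<close>

lemma bigo_at_right_0_bound:
  fixes f :: "real \<Rightarrow> real"
  assumes "f \<in> O[at_right 0](\<lambda>x::real. x ^ k)"
  shows "\<exists>K>0. \<exists>\<delta>>0. \<forall>x. 0 < x \<longrightarrow> x \<le> \<delta> \<longrightarrow> \<bar>f x\<bar> \<le> K * x ^ k"
proof -
  obtain K where K: "K > 0" "\<forall>\<^sub>F x in at_right 0. norm (f x) \<le> K * norm (x ^ k)"
    using assms by (auto elim: landau_o.bigE)
  then obtain b where b: "b > 0" "\<And>x. x > 0 \<Longrightarrow> x < b \<Longrightarrow> norm (f x) \<le> K * norm (x ^ k)"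
    unfolding eventually_at_right_field by auto
  have "\<bar>f x\<bar> \<le> K * x ^ k" if "0 < x" "x \<le> b / 2" for x
    using b(2)[of x] that b(1) by simp
  thus ?thesis using K b by (intro exI[of _ K] conjI exI[of _ "b / 2"]) auto
qed

lemma ln_sinh_quotient_bound:
  "\<exists>K>0. \<exists>\<delta>>0. \<forall>z::real. 0 < z \<longrightarrow> z \<le> \<delta> \<longrightarrow> \<bar>ln (sinh z / z) - z\<^sup>2 / 6\<bar> \<le> K * z ^ 4"
  by (rule bigo_at_right_0_bound) (unfold sinh_def real_scaleR_def, real_asymp)

lemma artanh_cubic_bound:
  "\<exists>K>0. \<exists>\<delta>>0. \<forall>y::real. \<bar>y\<bar> \<le> \<delta> \<longrightarrow> \<bar>ln ((1 + y) / (1 - y)) / 2 - y - y ^ 3 / 3\<bar> \<le> K * y ^ 4"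
proof -
  have "\<exists>K>0. \<exists>\<delta>>0. \<forall>y::real. 0 < y \<longrightarrow> y \<le> \<delta> \<longrightarrow> \<bar>ln ((1 + y) / (1 - y)) / 2 - y - y ^ 3 / 3\<bar> \<le> K * y ^ 4"
    by (rule bigo_at_right_0_bound) real_asymp
  then obtain K \<delta> where K: "K > 0" "\<delta> > 0"
    "\<And>y::real. 0 < y \<Longrightarrow> y \<le> \<delta> \<Longrightarrow> \<bar>ln ((1 + y) / (1 - y)) / 2 - y - y ^ 3 / 3\<bar> \<le> K * y ^ 4" by blast
  have "\<bar>ln ((1 + y) / (1 - y)) / 2 - y - y ^ 3 / 3\<bar> \<le> K * y ^ 4" if y: "\<bar>y\<bar> \<le> min \<delta> (1/2)" for y :: real
  proof (cases y "0::real" rule: linorder_cases)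
    case less
    \<comment> \<open>The function is odd and the bound even in y, so negative y reduces to
      -y.\<close>
    have "ln ((1 + y) / (1 - y)) = - ln ((1 + (-y)) / (1 - (-y)))"
      using y less by (simp add: ln_div)
    thus ?thesis using K(3)[of "-y"] less y by (simp add: abs_if split: if_splits)
  qed (use K y in auto)
  thus ?thesis using K by (intro exI[of _ K] conjI exI[of _ "min \<delta> (1/2)"]) auto
qed

text \<open>Half the logarithm of p/(1 - p) for p = (e^g - e^(-\<tau>)) / (e^\<tau> - e^(-\<tau>)).
  Each of e^g - e^(-\<tau>) and e^\<tau> - e^g is an exponential times a sinh; the exponentials
  combine to -\<tau>/2, and the quotient of the sinh is regular in g/\<tau>.\<close>

definition log_odds :: "real \<Rightarrow> real \<Rightarrow> real" where
  "log_odds \<tau> g = - \<tau> / 2 + ln (sinh ((\<tau> + g) / 2) / sinh ((\<tau> - g) / 2)) / 2"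

lemma logistic_log_odds:
  assumes "0 < \<tau>" "\<bar>g\<bar> < \<tau>"
  shows "logistic (log_odds \<tau> g) = (exp g - exp (- \<tau>)) / (exp \<tau> - exp (- \<tau>))"
proof -
  define A where "A = sinh ((\<tau> + g) / 2)"
  define B where "B = sinh ((\<tau> - g) / 2)"
  have A: "A > 0" and B: "B > 0" using assms by (auto simp: A_def B_def)
  have "exp (- 2 * log_odds \<tau> g) = exp \<tau> * exp (- ln (A / B))"
    by (simp add: log_odds_def A_def B_def flip: exp_add)
  also have "exp (- ln (A / B)) = B / A" using A B by (simp add: exp_minus field_simps)
  finally have 1: "exp (- 2 * log_odds \<tau> g) = exp \<tau> * (B / A)" .
  have sh: "exp a - exp b = exp ((a + b) / 2) * (2 * sinh ((a - b) / 2))" for a b :: real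
    by (simp add: sinh_def right_diff_distrib field_simps flip: exp_add)
  have 2: "exp g - exp (- \<tau>) = exp ((g - \<tau>) / 2) * (2 * A)"
    using sh[of g "- \<tau>"] by (simp add: A_def add.commute)
  have 3: "exp \<tau> - exp g = exp ((\<tau> + g) / 2) * (2 * B)"
    using sh[of \<tau> g] by (simp add: B_def)
  have "exp ((\<tau> + g) / 2) = exp \<tau> * exp ((g - \<tau>) / 2)" by (simp add: field_simps flip: exp_add)
  hence "exp \<tau> - exp g = exp \<tau> * (B / A) * (exp g - exp (- \<tau>))"
    unfolding 2 3 using A by (simp add: field_simps)
  hence 4: "exp \<tau> - exp (- \<tau>) = (1 + exp \<tau> * (B / A)) * (exp g - exp (- \<tau>))" by (simp add: algebra_simps)
  have "exp g - exp (- \<tau>) > 0" using assms by simp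
  thus ?thesis unfolding logistic_def 1 4 by simp
qed

text \<open>With y = g/\<tau>, half the logarithm of the sinh quotient is artanh y = y + y^3/3 +
  ..., plus the correction \<tau> g/12 from ln (sinh z / z), which is z^2/6 to leading order. The
  tilt \<theta> survives only in the linear term; its effect on the two cubic terms is
  O(\<tau>^4).\<close>

lemma log_odds_expansion:
  fixes s \<rho> :: real
  assumes s: "s > 0"
  defines "\<kappa> \<equiv> \<rho> / s\<^sup>2"
  shows "\<exists>K>0. \<exists>\<delta>>0. \<forall>\<tau> \<theta>. 0 < \<tau> \<longrightarrow> \<tau> \<le> \<delta> \<longrightarrow> \<bar>\<theta>\<bar> \<le> 1 \<longrightarrow>
     \<bar>(\<rho> - \<theta> * \<tau>) * \<tau>\<^sup>2 / s\<^sup>2\<bar> \<le> \<tau> / 2 \<and>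
     \<bar>log_odds \<tau> ((\<rho> - \<theta> * \<tau>) * \<tau>\<^sup>2 / s\<^sup>2)
       - ((\<kappa> - 1 / 2) * \<tau> - \<theta> * \<tau>\<^sup>2 / s\<^sup>2 + (\<kappa> ^ 3 / 3 + \<kappa> / 12) * \<tau> ^ 3)\<bar> \<le> K * \<tau> ^ 4"
proof -
  obtain K1 \<delta>1 where K1: "K1 > 0" "\<delta>1 > 0"
    "\<And>z::real. 0 < z \<Longrightarrow> z \<le> \<delta>1 \<Longrightarrow> \<bar>ln (sinh z / z) - z\<^sup>2 / 6\<bar> \<le> K1 * z ^ 4"
    using ln_sinh_quotient_bound by blast
  obtain K2 \<delta>2 where K2: "K2 > 0" "\<delta>2 > 0"
    "\<And>y::real. \<bar>y\<bar> \<le> \<delta>2 \<Longrightarrow> \<bar>ln ((1 + y) / (1 - y)) / 2 - y - y ^ 3 / 3\<bar> \<le> K2 * y ^ 4"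
    using artanh_cubic_bound by blast
  define G where "G = (\<bar>\<rho>\<bar> + 1) / s\<^sup>2"
  have G: "G > 0" using s by (auto simp: G_def intro!: divide_pos_pos)
  \<comment> \<open>The bound 1/(2 G) forces |y| <= 1/2, equivalently |g| <= \<tau>/2, and keeps
    both sinh arguments positive; \<open>\<delta>2 / G\<close> brings y into the range of the artanh
    expansion.\<close>
  define \<delta> where "\<delta> = min (min 1 \<delta>1) (min (1 / (2 * G)) (\<delta>2 / G))"
  define K where "K = K1 + K2 * G ^ 4 + G\<^sup>2 / s\<^sup>2 + 1 / s\<^sup>2"
  have main: "\<bar>(\<rho> - \<theta> * \<tau>) * \<tau>\<^sup>2 / s\<^sup>2\<bar> \<le> \<tau> / 2 \<and>
     \<bar>log_odds \<tau> ((\<rho> - \<theta> * \<tau>) * \<tau>\<^sup>2 / s\<^sup>2)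
       - ((\<kappa> - 1 / 2) * \<tau> - \<theta> * \<tau>\<^sup>2 / s\<^sup>2 + (\<kappa> ^ 3 / 3 + \<kappa> / 12) * \<tau> ^ 3)\<bar> \<le> K * \<tau> ^ 4"
    if \<tau>: "0 < \<tau>" "\<tau> \<le> \<delta>" and \<theta>: "\<bar>\<theta>\<bar> \<le> 1" for \<tau> \<theta>
  proof -
    have d: "\<tau> \<le> 1" "\<tau> \<le> \<delta>1" "G * \<tau> \<le> 1 / 2" "G * \<tau> \<le> \<delta>2"
      using \<tau> G by (auto simp: \<delta>_def field_simps)
    define y where "y = (\<rho> - \<theta> * \<tau>) * \<tau> / s\<^sup>2"
    define g where "g = (\<rho> - \<theta> * \<tau>) * \<tau>\<^sup>2 / s\<^sup>2"
    have gy: "g = \<tau> * y" by (simp add: g_def y_def power2_eq_square)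
    have yk: "y = \<kappa> * \<tau> - \<theta> * \<tau>\<^sup>2 / s\<^sup>2" by (simp add: y_def \<kappa>_def power2_eq_square diff_divide_distrib left_diff_distrib)
    have t1: "\<bar>\<theta> * \<tau>\<bar> \<le> 1" unfolding abs_mult using \<theta> \<tau> d by (intro mult_le_one) auto
    have yG: "\<bar>y\<bar> \<le> G * \<tau>"
    proof -
      have "\<bar>\<rho> - \<theta> * \<tau>\<bar> \<le> \<bar>\<rho>\<bar> + 1" using t1 by linarith
      hence "\<bar>\<rho> - \<theta> * \<tau>\<bar> * \<tau> / s\<^sup>2 \<le> (\<bar>\<rho>\<bar> + 1) * \<tau> / s\<^sup>2" using \<tau> by (intro divide_right_mono mult_right_mono) auto
      thus ?thesis using \<tau> by (simp add: y_def G_def abs_mult)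
    qed
    have \<kappa>G: "\<bar>\<kappa> * \<tau>\<bar> \<le> G * \<tau>"
      using \<tau> s by (simp add: \<kappa>_def G_def abs_mult divide_right_mono)
    have g: "\<bar>g\<bar> \<le> \<tau> / 2"
    proof -
      have "\<tau> * \<bar>y\<bar> \<le> \<tau> * (1 / 2)" using yG d \<tau> by (intro mult_left_mono) auto
      thus ?thesis using \<tau> by (simp add: gy abs_mult)
    qed
    define z1 where "z1 = (\<tau> + g) / 2"
    define z2 where "z2 = (\<tau> - g) / 2"
    have z: "0 < z1" "z1 \<le> \<tau>" "0 < z2" "z2 \<le> \<tau>" using g \<tau> by (auto simp: z1_def z2_def abs_le_iff)
    have y12: "\<bar>y\<bar> \<le> 1 / 2" using yG d by linarith
    have zz: "z1 / z2 = (1 + y) / (1 - y)"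
    proof -
      have 1: "z1 = (\<tau> / 2) * (1 + y)" "z2 = (\<tau> / 2) * (1 - y)" by (simp_all add: z1_def z2_def gy algebra_simps)
      show ?thesis unfolding 1 by (rule nonzero_mult_divide_mult_cancel_left) (use \<tau> in simp)
    qed
    have L: "ln (sinh z1 / sinh z2) = ln (sinh z1 / z1) - ln (sinh z2 / z2) + ln ((1 + y) / (1 - y))"
      unfolding zz[symmetric] using z by (simp add: ln_div)
    have e1: "\<bar>ln (sinh z1 / z1) - z1\<^sup>2 / 6\<bar> \<le> K1 * \<tau> ^ 4" "\<bar>ln (sinh z2 / z2) - z2\<^sup>2 / 6\<bar> \<le> K1 * \<tau> ^ 4"
      by (rule order_trans[OF K1(3)]; use z d K1(1) in \<open>auto intro!: power_mono\<close>)+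
    have e2: "\<bar>ln ((1 + y) / (1 - y)) / 2 - y - y ^ 3 / 3\<bar> \<le> K2 * G ^ 4 * \<tau> ^ 4"
    proof -
      have "\<bar>y\<bar> ^ 4 \<le> (G * \<tau>) ^ 4" using yG by (intro power_mono) auto
      hence "K2 * y ^ 4 \<le> K2 * (G ^ 4 * \<tau> ^ 4)" using K2(1) by (intro mult_left_mono) (auto simp: power_even_abs power_mult_distrib)
      thus ?thesis using K2(3)[of y] yG d by (simp add: mult.assoc)
    qed
    have e3: "\<bar>y ^ 3 - (\<kappa> * \<tau>) ^ 3\<bar> \<le> 3 * G\<^sup>2 / s\<^sup>2 * \<tau> ^ 4"
    proof -
      have "y ^ 3 - (\<kappa> * \<tau>) ^ 3 = (y - \<kappa> * \<tau>) * (y * y + y * (\<kappa> * \<tau>) + (\<kappa> * \<tau>) * (\<kappa> * \<tau>))" by algebra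
      moreover have "\<bar>y - \<kappa> * \<tau>\<bar> \<le> \<tau>\<^sup>2 / s\<^sup>2"
      proof -
        have "\<bar>\<theta>\<bar> * \<tau>\<^sup>2 \<le> 1 * \<tau>\<^sup>2" using \<theta> by (intro mult_right_mono) auto
        thus ?thesis using s by (simp add: yk abs_mult divide_right_mono)
      qed
      moreover have "\<bar>y * y + y * (\<kappa> * \<tau>) + (\<kappa> * \<tau>) * (\<kappa> * \<tau>)\<bar> \<le> 3 * (G * \<tau>)\<^sup>2"
      proof -
        have "\<bar>y * y\<bar> \<le> (G * \<tau>) * (G * \<tau>)" "\<bar>y * (\<kappa> * \<tau>)\<bar> \<le> (G * \<tau>) * (G * \<tau>)"
          "\<bar>(\<kappa> * \<tau>) * (\<kappa> * \<tau>)\<bar> \<le> (G * \<tau>) * (G * \<tau>)"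
          by (rule abs_mult_le_mult[OF yG yG] abs_mult_le_mult[OF yG \<kappa>G] abs_mult_le_mult[OF \<kappa>G \<kappa>G])+
        thus ?thesis unfolding power2_eq_square by linarith
      qed
      ultimately have "\<bar>y ^ 3 - (\<kappa> * \<tau>) ^ 3\<bar> \<le> \<tau>\<^sup>2 / s\<^sup>2 * (3 * (G * \<tau>)\<^sup>2)"
        by (simp only: abs_mult_le_mult)
      also have "\<dots> = 3 * G\<^sup>2 / s\<^sup>2 * \<tau> ^ 4" by (simp add: power_mult_distrib eval_nat_numeral)
      finally show ?thesis .
    qed
    have e4: "\<bar>\<tau> * g / 12 - \<kappa> * \<tau> ^ 3 / 12\<bar> \<le> 1 / s\<^sup>2 * \<tau> ^ 4"
    proof -
      have "\<tau> * g / 12 - \<kappa> * \<tau> ^ 3 / 12 = - (\<theta> * (\<tau> ^ 4 / s\<^sup>2)) / 12"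
        unfolding gy yk by (simp add: field_simps eval_nat_numeral)
      hence "\<bar>\<tau> * g / 12 - \<kappa> * \<tau> ^ 3 / 12\<bar> = \<bar>\<theta>\<bar> * (\<tau> ^ 4 / s\<^sup>2) / 12" by (simp add: abs_mult)
      also have "\<dots> \<le> 1 * (\<tau> ^ 4 / s\<^sup>2) / 1" using \<theta> by (intro frac_le mult_right_mono) auto
      finally show ?thesis by simp
    qed
    have zd: "z1\<^sup>2 / 6 - z2\<^sup>2 / 6 = 2 * (\<tau> * g / 12)" by (simp add: z1_def z2_def power2_eq_square field_simps)
    have ex: "log_odds \<tau> g = - \<tau> / 2 + (ln (sinh z1 / z1) / 2 - ln (sinh z2 / z2) / 2 + ln ((1 + y) / (1 - y)) / 2)"
      unfolding log_odds_def z1_def[symmetric] z2_def[symmetric] L by (simp add: add_divide_distrib diff_divide_distrib)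
    have tgt: "(\<kappa> - 1 / 2) * \<tau> - \<theta> * \<tau>\<^sup>2 / s\<^sup>2 + (\<kappa> ^ 3 / 3 + \<kappa> / 12) * \<tau> ^ 3
        = - \<tau> / 2 + y + (\<kappa> * \<tau>) ^ 3 / 3 + \<kappa> * \<tau> ^ 3 / 12"
      unfolding yk by (simp add: power_mult_distrib algebra_simps)
    have "\<bar>log_odds \<tau> g - ((\<kappa> - 1 / 2) * \<tau> - \<theta> * \<tau>\<^sup>2 / s\<^sup>2 + (\<kappa> ^ 3 / 3 + \<kappa> / 12) * \<tau> ^ 3)\<bar>
        \<le> K1 * \<tau> ^ 4 + K2 * G ^ 4 * \<tau> ^ 4 + (3 * G\<^sup>2 / s\<^sup>2 * \<tau> ^ 4) / 3 + 1 / s\<^sup>2 * \<tau> ^ 4"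
    proof -
      have tri: "\<bar>A / 2 - B / 2 + C + D / 3 + E\<bar> \<le> b1 + b2 + b3 / 3 + b4"
        if "\<bar>A\<bar> \<le> b1" "\<bar>B\<bar> \<le> b1" "\<bar>C\<bar> \<le> b2" "\<bar>D\<bar> \<le> b3" "\<bar>E\<bar> \<le> b4" for A B C D E b1 b2 b3 b4 :: real
        using that by linarith
      have "log_odds \<tau> g - (- \<tau> / 2 + y + (\<kappa> * \<tau>) ^ 3 / 3 + \<kappa> * \<tau> ^ 3 / 12)
        = (ln (sinh z1 / z1) - z1\<^sup>2 / 6) / 2 - (ln (sinh z2 / z2) - z2\<^sup>2 / 6) / 2
          + (ln ((1 + y) / (1 - y)) / 2 - y - y ^ 3 / 3) + (y ^ 3 - (\<kappa> * \<tau>) ^ 3) / 3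
          + (\<tau> * g / 12 - \<kappa> * \<tau> ^ 3 / 12)"
        using zd unfolding ex diff_divide_distrib by linarith
      thus ?thesis unfolding tgt using tri[OF e1 e2 e3 e4] by simp
    qed
    also have "\<dots> = K * \<tau> ^ 4" by (simp add: K_def algebra_simps)
    finally show ?thesis using g unfolding g_def by blast
  qed
  moreover have "K > 0" using K1 K2 G s by (auto simp: K_def intro!: add_pos_nonneg)
  moreover have "\<delta> > 0" using K1 K2 G by (simp add: \<delta>_def)
  ultimately show ?thesis by blast
qed

text \<open>For \<epsilon> = 1/sqrt n the number \<nu> is sqrt ((n+1)/n), the ratio of the scale
  sqrt (n+1) of the beta integral to the scale sqrt n of the tree.\<close>

lemma sqrt_one_plus_bounds:
  fixes \<epsilon> :: real assumes "0 < \<epsilon>" "\<epsilon> \<le> 1"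
  defines "\<nu> \<equiv> sqrt (1 + \<epsilon>\<^sup>2)"
  shows "1 \<le> \<nu>" "\<nu> \<le> 2" "\<bar>\<nu> - 1\<bar> \<le> \<epsilon>\<^sup>2" "\<bar>\<nu> - 1 - \<epsilon>\<^sup>2 / 2\<bar> \<le> \<epsilon> ^ 4" "\<bar>1 / \<nu> - 1\<bar> \<le> \<epsilon>\<^sup>2"
    "\<bar>1 / \<nu> - 1 + \<epsilon>\<^sup>2 / 2\<bar> \<le> \<epsilon> ^ 4"
proof -
  have e: "0 < \<epsilon>\<^sup>2" "\<epsilon>\<^sup>2 \<le> 1" "\<epsilon> ^ 4 = (\<epsilon>\<^sup>2)\<^sup>2" using assms by (auto simp: power_le_one)
  show n1: "1 \<le> \<nu>" by (simp add: \<nu>_def)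
  have sq: "\<nu>\<^sup>2 = 1 + \<epsilon>\<^sup>2" by (simp add: \<nu>_def)
  define d where "d = \<nu> - 1"
  have d0: "d \<ge> 0" using n1 by (simp add: d_def)
  have d: "2 * d + d\<^sup>2 = \<epsilon>\<^sup>2" using sq by (simp add: d_def power2_eq_square algebra_simps)
  have d1: "d \<le> \<epsilon>\<^sup>2 / 2" using d zero_le_power2[of d] by linarith
  have "d\<^sup>2 \<le> (\<epsilon>\<^sup>2 / 2)\<^sup>2" using d0 d1 by (intro power_mono)
  hence d2: "d\<^sup>2 \<le> \<epsilon> ^ 4 / 4" unfolding e(3) power_divide by simp
  show "\<nu> \<le> 2" using d1 e by (simp add: d_def)
  show "\<bar>\<nu> - 1\<bar> \<le> \<epsilon>\<^sup>2" using d0 d1 e(1) unfolding d_def by linarith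
  have "d = \<epsilon>\<^sup>2 / 2 - d\<^sup>2 / 2" using d by simp
  hence "\<nu> - 1 - \<epsilon>\<^sup>2 / 2 = - (d\<^sup>2 / 2)" by (simp add: d_def)
  thus "\<bar>\<nu> - 1 - \<epsilon>\<^sup>2 / 2\<bar> \<le> \<epsilon> ^ 4"
    using d2 zero_le_power2[of d] unfolding abs_le_iff by linarith
  have "1 / \<nu> - 1 = - (d / \<nu>)" using n1 by (simp add: d_def field_simps)
  moreover have "0 \<le> d / \<nu>" "d / \<nu> \<le> d" using d0 n1 by (simp_all add: divide_le_self)
  ultimately show "\<bar>1 / \<nu> - 1\<bar> \<le> \<epsilon>\<^sup>2" using d1 e(1) by linarith
  have "1 / \<nu> - 1 + \<epsilon>\<^sup>2 / 2 = d\<^sup>2 / 2 + d\<^sup>2 / \<nu>"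
  proof -
    have "1 / \<nu> = 1 - d + d\<^sup>2 / \<nu>" using n1 by (simp add: d_def power2_eq_square field_simps)
    thus ?thesis using d by simp
  qed
  moreover have "0 \<le> d\<^sup>2 / \<nu>" "d\<^sup>2 / \<nu> \<le> d\<^sup>2" using n1 by (simp_all add: divide_le_self)
  ultimately show "\<bar>1 / \<nu> - 1 + \<epsilon>\<^sup>2 / 2\<bar> \<le> \<epsilon> ^ 4" 
    using d2 zero_le_power2[of d] unfolding abs_le_iff by linarith
qed

text \<open>This is where \<theta> cancels: it contributes -\<theta> \<epsilon> \<nu> through the
  log-odds and \<theta> \<epsilon> / \<nu> through the node, together -\<theta> \<epsilon>^3 / \<nu>
  because \<nu>^2 - 1 = \<epsilon>^2. The mismatch of the scales leaves a/2 + x/2 in the term of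
  order 1/n.\<close>

lemma standardized_point_expansion:
  fixes a c E K \<epsilon> x \<theta> :: real
  assumes \<epsilon>: "0 < \<epsilon>" "\<epsilon> \<le> 1" and \<theta>: "\<bar>\<theta>\<bar> \<le> 1" and E: "\<bar>E\<bar> \<le> K * \<epsilon> ^ 3"
  defines "\<nu> \<equiv> sqrt (1 + \<epsilon>\<^sup>2)"
  shows "\<bar>\<nu> * (a - \<theta> * \<epsilon> + c * \<epsilon>\<^sup>2 + E) - (x - \<theta> * \<epsilon>) / \<nu>
            - ((a - x) + \<epsilon>\<^sup>2 * (c + a / 2 + x / 2))\<bar>
          \<le> (3 + \<bar>a\<bar> + \<bar>c\<bar> + 2 * K) * (1 + \<bar>x\<bar>) * \<epsilon> ^ 3"
proof -
  note \<nu> = sqrt_one_plus_bounds[OF \<epsilon>, folded \<nu>_def]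
  have e3: "\<epsilon> ^ 3 \<ge> 0" "\<epsilon> ^ 4 \<le> \<epsilon> ^ 3" using \<epsilon> by (auto intro!: power_decreasing)
  have te: "\<bar>\<theta> * \<epsilon>\<bar> \<le> 1" unfolding abs_mult using \<theta> \<epsilon> by (intro mult_le_one) auto
  have id: "\<nu> * (a - \<theta> * \<epsilon> + c * \<epsilon>\<^sup>2 + E) - (x - \<theta> * \<epsilon>) / \<nu> - ((a - x) + \<epsilon>\<^sup>2 * (c + a / 2 + x / 2))
     = (\<nu> - 1 - \<epsilon>\<^sup>2 / 2) * (a - \<theta> * \<epsilon>) + (\<nu> - 1) * (c * \<epsilon>\<^sup>2) + \<nu> * E
       - (x - \<theta> * \<epsilon>) * (1 / \<nu> - 1 + \<epsilon>\<^sup>2 / 2) - \<theta> * \<epsilon> ^ 3"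
    by (simp add: field_simps eval_nat_numeral)
  have b1: "\<bar>(\<nu> - 1 - \<epsilon>\<^sup>2 / 2) * (a - \<theta> * \<epsilon>)\<bar> \<le> \<epsilon> ^ 3 * (\<bar>a\<bar> + 1)"
    unfolding abs_mult using \<nu>(4) e3 te by (intro mult_mono) auto
  have b2: "\<bar>(\<nu> - 1) * (c * \<epsilon>\<^sup>2)\<bar> \<le> \<epsilon> ^ 3 * \<bar>c\<bar>"
  proof -
    have "\<bar>\<nu> - 1\<bar> * (\<bar>c\<bar> * \<epsilon>\<^sup>2) \<le> \<epsilon>\<^sup>2 * (\<bar>c\<bar> * \<epsilon>\<^sup>2)" using \<nu>(3) by (intro mult_right_mono) auto
    also have "\<dots> = \<epsilon> ^ 4 * \<bar>c\<bar>" by (simp add: eval_nat_numeral)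
    also have "\<dots> \<le> \<epsilon> ^ 3 * \<bar>c\<bar>" using e3 by (intro mult_right_mono) auto
    finally show ?thesis by (simp add: abs_mult)
  qed
  have b3: "\<bar>\<nu> * E\<bar> \<le> 2 * (K * \<epsilon> ^ 3)"
    unfolding abs_mult using \<nu>(1,2) E by (intro mult_mono) auto
  have b4: "\<bar>(x - \<theta> * \<epsilon>) * (1 / \<nu> - 1 + \<epsilon>\<^sup>2 / 2)\<bar> \<le> (\<bar>x\<bar> + 1) * \<epsilon> ^ 3"
    unfolding abs_mult using \<nu>(6) e3 te by (intro mult_mono) auto
  have b5: "\<bar>\<theta> * \<epsilon> ^ 3\<bar> \<le> \<epsilon> ^ 3"
    unfolding abs_mult using \<theta> e3 mult_right_mono[of "\<bar>\<theta>\<bar>" 1 "\<epsilon> ^ 3"] by simp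
  have K: "K \<ge> 0"
  proof (rule ccontr)
    assume "\<not> K \<ge> 0"
    hence "K * \<epsilon> ^ 3 < 0" using \<epsilon> by (simp add: mult_neg_pos)
    thus False using E by linarith
  qed
  have "\<bar>\<nu> * (a - \<theta> * \<epsilon> + c * \<epsilon>\<^sup>2 + E) - (x - \<theta> * \<epsilon>) / \<nu> - ((a - x) + \<epsilon>\<^sup>2 * (c + a / 2 + x / 2))\<bar>
     \<le> \<epsilon> ^ 3 * (\<bar>a\<bar> + 1) + \<epsilon> ^ 3 * \<bar>c\<bar> + 2 * (K * \<epsilon> ^ 3) + (\<bar>x\<bar> + 1) * \<epsilon> ^ 3 + \<epsilon> ^ 3"
    unfolding id using b1 b2 b3 b4 b5 unfolding abs_le_iff by linarith
  also have "\<dots> = ((3 + \<bar>a\<bar> + \<bar>c\<bar> + 2 * K) + \<bar>x\<bar>) * \<epsilon> ^ 3" by (simp add: algebra_simps)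
  also have "\<dots> \<le> ((3 + \<bar>a\<bar> + \<bar>c\<bar> + 2 * K) * (1 + \<bar>x\<bar>)) * \<epsilon> ^ 3"
  proof (rule mult_right_mono[OF _ e3(1)])
    have "1 * \<bar>x\<bar> \<le> (3 + \<bar>a\<bar> + \<bar>c\<bar> + 2 * K) * \<bar>x\<bar>" using K by (intro mult_right_mono) auto
    thus "(3 + \<bar>a\<bar> + \<bar>c\<bar> + 2 * K) + \<bar>x\<bar> \<le> (3 + \<bar>a\<bar> + \<bar>c\<bar> + 2 * K) * (1 + \<bar>x\<bar>)" by (simp add: distrib_left)
  qed
  finally show ?thesis .
qed

section \<open>Stability of the Gaussian terms under moving the evaluation point\<close>

lemma abs_diff_le_deriv_bound:
  fixes F F' :: "real \<Rightarrow> real"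
  assumes "\<And>x. (F has_real_derivative F' x) (at x)" "\<And>x. \<bar>F' x\<bar> \<le> B"
  shows "\<bar>F b - F a\<bar> \<le> B * \<bar>b - a\<bar>"
  using field_differentiable_bound[of UNIV F F' B b a] assms by (simp add: DERIV_subset abs_minus_commute)

lemma abs_density_diff_le: "\<bar>std_normal_density b - std_normal_density a\<bar> \<le> \<bar>b - a\<bar>"
proof -
  have "\<bar>- x * std_normal_density x\<bar> \<le> 1" for x :: real
  proof -
    have "\<bar>x\<bar> \<le> 1 + x\<^sup>2 / 2" using zero_le_power2[of "\<bar>x\<bar> - 1"] by (simp add: power2_diff)
    also have "\<dots> \<le> exp (x\<^sup>2 / 2)" by (rule exp_ge_add_one_self)
    finally have "\<bar>x\<bar> * exp (- x\<^sup>2 / 2) \<le> exp (x\<^sup>2 / 2) * exp (- x\<^sup>2 / 2)" by (intro mult_right_mono) auto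
    hence 1: "\<bar>x\<bar> * exp (- x\<^sup>2 / 2) \<le> 1" by (simp flip: exp_add)
    have "1 / sqrt (2 * pi) \<le> 1" using pi_gt3 by simp
    hence "1 / sqrt (2 * pi) * (\<bar>x\<bar> * exp (- x\<^sup>2 / 2)) \<le> 1 * 1" using 1 by (intro mult_mono) auto
    thus ?thesis by (simp add: std_normal_density_def abs_mult mult_ac)
  qed
  thus ?thesis using abs_diff_le_deriv_bound[OF has_real_derivative_std_normal_density, of 1] by simp
qed

lemma Phi_taylor: "\<bar>Phi b - Phi a - std_normal_density a * (b - a)\<bar> \<le> (b - a)\<^sup>2"
proof (cases "a = b")
  case False
  have "\<exists>z. \<bar>z - a\<bar> \<le> \<bar>b - a\<bar> \<and> Phi b - Phi a = (b - a) * std_normal_density z"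
  proof (cases "a < b")
    case True
    from MVT2[OF this, of Phi std_normal_density] Phi_has_real_derivative
    obtain z where "a < z" "z < b" "Phi b - Phi a = (b - a) * std_normal_density z" by blast
    thus ?thesis by (intro exI[of _ z]) auto
  next
    case ba: False
    hence "b < a" using False by simp
    from MVT2[OF this, of Phi std_normal_density] Phi_has_real_derivative
    obtain z where "b < z" "z < a" "Phi a - Phi b = (a - b) * std_normal_density z" by blast
    thus ?thesis by (intro exI[of _ z]) (auto simp: algebra_simps)
  qed
  then obtain z where z: "\<bar>z - a\<bar> \<le> \<bar>b - a\<bar>" "Phi b - Phi a = (b - a) * std_normal_density z" by blast
  have "Phi b - Phi a - std_normal_density a * (b - a) = (b - a) * (std_normal_density z - std_normal_density a)"
    unfolding z(2) by (simp add: algebra_simps)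
  also have "\<bar>\<dots>\<bar> \<le> \<bar>b - a\<bar> * \<bar>b - a\<bar>"
    unfolding abs_mult using abs_density_diff_le[of z a] z(1) by (intro mult_left_mono) auto
  finally show ?thesis by (simp add: power2_eq_square)
qed simp

lemma one_plus_abs_add_power4_le: "(\<mu> + w) ^ 4 \<le> (1 + \<bar>\<mu>\<bar>) ^ 4 * (1 + \<bar>w\<bar>) ^ 4" for \<mu> w :: real
proof -
  have "\<bar>\<mu> + w\<bar> \<le> (1 + \<bar>\<mu>\<bar>) * (1 + \<bar>w\<bar>)"
  proof -
    have "0 \<le> \<bar>\<mu>\<bar> * \<bar>w\<bar>" by simp
    moreover have "(1 + \<bar>\<mu>\<bar>) * (1 + \<bar>w\<bar>) = 1 + \<bar>\<mu>\<bar> + \<bar>w\<bar> + \<bar>\<mu>\<bar> * \<bar>w\<bar>" by (simp add: algebra_simps)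
    ultimately show ?thesis using abs_triangle_ineq[of \<mu> w] by linarith
  qed
  hence "\<bar>\<mu> + w\<bar> ^ 4 \<le> ((1 + \<bar>\<mu>\<bar>) * (1 + \<bar>w\<bar>)) ^ 4" by (intro power_mono) auto
  thus ?thesis by (simp add: power_even_abs power_mult_distrib)
qed

text \<open>Serves to replace the exact point by its limit in a term that already carries 1/n. The
  right-hand side is symmetric in the two pairs, so two uses bound the absolute value. The variable
  w is handled by the derivative, \<mu> by factoring the difference of the polynomials.\<close>

lemma density_edge_poly_lipschitz:
  "\<exists>K>0. \<forall>\<mu> \<mu>' w w'. std_normal_density w * edge_poly \<mu> w - std_normal_density w' * edge_poly \<mu>' w'
      \<le> K * (1 + \<bar>\<mu>\<bar> + \<bar>\<mu>'\<bar>) ^ 4 * (\<bar>\<mu> - \<mu>'\<bar> + \<bar>w - w'\<bar>)"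
proof -
  obtain K4 where K4: "K4 > 0" "\<And>w. (1 + \<bar>w\<bar>) ^ 4 * exp (0 * w) * std_normal_density w \<le> K4"
    using std_normal_poly_bounded[of 4 0] by blast
  obtain K2 where K2: "K2 > 0" "\<And>w. (1 + \<bar>w\<bar>) ^ 2 * exp (0 * w) * std_normal_density w \<le> K2"
    using std_normal_poly_bounded[of 2 0] by blast
  define K where "K = 11 * K4 + 26 * K2"
  have "std_normal_density w * edge_poly \<mu> w - std_normal_density w' * edge_poly \<mu>' w'
      \<le> K * (1 + \<bar>\<mu>\<bar> + \<bar>\<mu>'\<bar>) ^ 4 * (\<bar>\<mu> - \<mu>'\<bar> + \<bar>w - w'\<bar>)" for \<mu> \<mu>' w w'
  proof -
    define M where "M = 1 + \<bar>\<mu>\<bar> + \<bar>\<mu>'\<bar>"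
    have M: "M \<ge> 1" "1 + \<bar>\<mu>\<bar> \<le> M" "\<bar>\<mu>\<bar> \<le> M" "\<bar>\<mu>'\<bar> \<le> M" by (auto simp: M_def)
    have d: "\<bar>- (std_normal_density x * ((\<mu> + x) ^ 4 - (\<mu> ^ 4 + 6 * \<mu>\<^sup>2 + 3)))\<bar> \<le> 11 * K4 * M ^ 4" for x
    proof -
      have M24: "M\<^sup>2 \<le> M ^ 4" "1 \<le> M ^ 4" using M by (auto intro: power_increasing)
      have "\<mu>\<^sup>2 \<le> M\<^sup>2" "\<mu> ^ 4 \<le> M ^ 4"
        using power_mono[OF M(3), of 2] power_mono[OF M(3), of 4] by (auto simp: power_even_abs)
      hence a: "\<mu> ^ 4 + 6 * \<mu>\<^sup>2 + 3 \<le> 10 * M ^ 4" using M24 by linarith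
      have "(\<mu> + x) ^ 4 \<le> (1 + \<bar>\<mu>\<bar>) ^ 4 * (1 + \<bar>x\<bar>) ^ 4" by (rule one_plus_abs_add_power4_le)
      also have "\<dots> \<le> M ^ 4 * (1 + \<bar>x\<bar>) ^ 4" using M by (intro mult_right_mono power_mono) auto
      finally have b: "(\<mu> + x) ^ 4 \<le> M ^ 4 * (1 + \<bar>x\<bar>) ^ 4" .
      have "1 \<le> (1 + \<bar>x\<bar>) ^ 4" by (rule one_le_power) auto
      hence c: "10 * M ^ 4 * 1 \<le> 10 * M ^ 4 * (1 + \<bar>x\<bar>) ^ 4" using M24 by (intro mult_left_mono) auto
      have "\<bar>(\<mu> + x) ^ 4 - (\<mu> ^ 4 + 6 * \<mu>\<^sup>2 + 3)\<bar> \<le> (\<mu> + x) ^ 4 + (\<mu> ^ 4 + 6 * \<mu>\<^sup>2 + 3)"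
        by (rule order_trans[OF abs_triangle_ineq4]) simp
      also have "\<dots> \<le> 11 * M ^ 4 * (1 + \<bar>x\<bar>) ^ 4" using a b c by linarith
      finally have "std_normal_density x * \<bar>(\<mu> + x) ^ 4 - (\<mu> ^ 4 + 6 * \<mu>\<^sup>2 + 3)\<bar>
          \<le> std_normal_density x * (11 * M ^ 4 * (1 + \<bar>x\<bar>) ^ 4)" by (intro mult_left_mono) auto
      also have "\<dots> = 11 * M ^ 4 * ((1 + \<bar>x\<bar>) ^ 4 * exp (0 * x) * std_normal_density x)" by simp
      also have "\<dots> \<le> 11 * M ^ 4 * K4" using M24 by (intro mult_left_mono K4) auto
      finally show ?thesis by (simp add: abs_mult mult_ac)
    qed
    have 1: "\<bar>std_normal_density w * edge_poly \<mu> w - std_normal_density w' * edge_poly \<mu> w'\<bar> \<le> 11 * K4 * M ^ 4 * \<bar>w - w'\<bar>"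
      by (rule abs_diff_le_deriv_bound[OF has_real_derivative_density_edge_poly d])
    have 2: "\<bar>std_normal_density w' * edge_poly \<mu> w' - std_normal_density w' * edge_poly \<mu>' w'\<bar> \<le> 26 * K2 * M ^ 4 * \<bar>\<mu> - \<mu>'\<bar>"
    proof -
      define u where "u = \<bar>w'\<bar>"
      have "edge_poly \<mu> w' - edge_poly \<mu>' w'
          = (\<mu> - \<mu>') * (4 * (w'\<^sup>2 + 2) + 6 * w' * (\<mu> + \<mu>') + 4 * (\<mu>\<^sup>2 + \<mu> * \<mu>' + \<mu>'\<^sup>2))"
        unfolding edge_poly_def by algebra
      hence "\<bar>edge_poly \<mu> w' - edge_poly \<mu>' w'\<bar>
          = \<bar>\<mu> - \<mu>'\<bar> * \<bar>4 * (w'\<^sup>2 + 2) + 6 * w' * (\<mu> + \<mu>') + 4 * (\<mu>\<^sup>2 + \<mu> * \<mu>' + \<mu>'\<^sup>2)\<bar>" by (simp add: abs_mult)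
      also have "\<bar>4 * (w'\<^sup>2 + 2) + 6 * w' * (\<mu> + \<mu>') + 4 * (\<mu>\<^sup>2 + \<mu> * \<mu>' + \<mu>'\<^sup>2)\<bar> \<le> 26 * (M\<^sup>2 * (1 + u)\<^sup>2)"
      proof -
        have "w'\<^sup>2 = u\<^sup>2" by (simp add: u_def)
        have M1: "1 * 1 \<le> M * M" using M by (intro mult_mono) auto
        hence "u\<^sup>2 * 1 \<le> u\<^sup>2 * M\<^sup>2" unfolding power2_eq_square[of M] by (intro mult_left_mono) auto
        have w6: "\<bar>6 * w' * (\<mu> + \<mu>')\<bar> \<le> 6 * (u * M\<^sup>2)"
        proof -
          have "\<bar>\<mu> + \<mu>'\<bar> \<le> M" by (simp add: M_def)
          also have "M \<le> M\<^sup>2" using M(1) mult_left_mono[of 1 M M] by (simp add: power2_eq_square)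
          finally have "u * \<bar>\<mu> + \<mu>'\<bar> \<le> u * M\<^sup>2" by (intro mult_left_mono) (auto simp: u_def)
          thus ?thesis by (simp add: abs_mult u_def)
        qed
        have m: "\<bar>\<mu>\<^sup>2\<bar> \<le> M\<^sup>2" "\<bar>\<mu> * \<mu>'\<bar> \<le> M\<^sup>2" "\<bar>\<mu>'\<^sup>2\<bar> \<le> M\<^sup>2"
          unfolding power2_eq_square using M by (intro abs_mult_le_mult; simp)+
        have "\<bar>\<mu>\<^sup>2 + \<mu> * \<mu>' + \<mu>'\<^sup>2\<bar> \<le> M\<^sup>2 + M\<^sup>2 + M\<^sup>2"
          by (intro order_trans[OF abs_triangle_ineq] add_mono m)
        hence m3: "\<bar>4 * (\<mu>\<^sup>2 + \<mu> * \<mu>' + \<mu>'\<^sup>2)\<bar> \<le> 12 * M\<^sup>2"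
          unfolding abs_mult[of 4] by simp
        have u4: "\<bar>4 * (u\<^sup>2 + 2)\<bar> \<le> 4 * u\<^sup>2 + 8" by simp
        have "\<bar>4 * (u\<^sup>2 + 2) + 6 * w' * (\<mu> + \<mu>') + 4 * (\<mu>\<^sup>2 + \<mu> * \<mu>' + \<mu>'\<^sup>2)\<bar>
            \<le> (4 * u\<^sup>2 + 8) + 6 * (u * M\<^sup>2) + 12 * M\<^sup>2"
          by (intro order_trans[OF abs_triangle_ineq] add_mono u4 w6 m3)
        also have "\<dots> \<le> 26 * M\<^sup>2 + 52 * (u * M\<^sup>2) + 26 * (u\<^sup>2 * M\<^sup>2)"
        proof -
          have "u * M\<^sup>2 \<ge> 0" "u\<^sup>2 * M\<^sup>2 \<ge> 0" "1 \<le> M\<^sup>2" "u\<^sup>2 \<le> u\<^sup>2 * M\<^sup>2"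
            using M1 \<open>u\<^sup>2 * 1 \<le> u\<^sup>2 * M\<^sup>2\<close> by (auto simp: u_def power2_eq_square)
          thus ?thesis by linarith
        qed
        also have "\<dots> = 26 * (M\<^sup>2 * (1 + u)\<^sup>2)" by (simp add: power2_eq_square algebra_simps)
        finally show ?thesis unfolding \<open>w'\<^sup>2 = u\<^sup>2\<close> .
      qed
      finally have "\<bar>edge_poly \<mu> w' - edge_poly \<mu>' w'\<bar> \<le> \<bar>\<mu> - \<mu>'\<bar> * (26 * (M\<^sup>2 * (1 + u)\<^sup>2))"
        by (simp add: mult_left_mono)
      hence "std_normal_density w' * \<bar>edge_poly \<mu> w' - edge_poly \<mu>' w'\<bar>
          \<le> std_normal_density w' * (\<bar>\<mu> - \<mu>'\<bar> * (26 * (M\<^sup>2 * (1 + u)\<^sup>2)))" by (intro mult_left_mono) auto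
      also have "\<dots> = 26 * M\<^sup>2 * \<bar>\<mu> - \<mu>'\<bar> * ((1 + \<bar>w'\<bar>) ^ 2 * exp (0 * w') * std_normal_density w')" by (simp add: u_def)
      also have "\<dots> \<le> 26 * M\<^sup>2 * \<bar>\<mu> - \<mu>'\<bar> * K2" by (intro mult_left_mono K2) auto
      also have "\<dots> \<le> 26 * M ^ 4 * \<bar>\<mu> - \<mu>'\<bar> * K2"
        using M K2(1) by (intro mult_right_mono mult_left_mono power_increasing) auto
      finally show ?thesis unfolding right_diff_distrib[symmetric] abs_mult by (simp add: mult_ac)
    qed
    have "0 \<le> 11 * K4 * M ^ 4 * \<bar>\<mu> - \<mu>'\<bar> + 26 * K2 * M ^ 4 * \<bar>w - w'\<bar>" using K2(1) K4(1) M by simp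
    hence "11 * K4 * M ^ 4 * \<bar>w - w'\<bar> + 26 * K2 * M ^ 4 * \<bar>\<mu> - \<mu>'\<bar> \<le> K * M ^ 4 * (\<bar>\<mu> - \<mu>'\<bar> + \<bar>w - w'\<bar>)"
      by (simp add: K_def algebra_simps)
    thus ?thesis using 1 2 unfolding M_def abs_le_iff by linarith
  qed
  moreover have "K > 0" using K2(1) K4(1) by (simp add: K_def)
  ultimately show ?thesis by blast
qed

text \<open>Here \<open>s = \<sigma> \<surd>T\<close>, \<open>\<rho> = r T\<close>, and \<open>\<theta> \<tau>\<close> is the tilt \<open>\<lambda>\<^sub>n \<sigma>\<^sup>2 T\<close>; the denominator is the one of
  \<open>rn_prob\<close> after cancelling the common tilt factor.\<close>

definition center_prob :: "real \<Rightarrow> real \<Rightarrow> nat \<Rightarrow> real \<Rightarrow> real" where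
  "center_prob s \<rho> n \<theta> =
     (let \<tau> = s / sqrt n in (exp ((\<rho> - \<theta> * \<tau>) / n) - exp (- \<tau>)) / (exp \<tau> - exp (- \<tau>)))"

text \<open>The cubic term of the log-odds plus a/2 + x/2 is the shift of order 1/n of the
  standardized point; the \<open>edge_poly\<close> term is the quartic correction of the integrand.
  Both are multiplied by the density at the limit point a - x.\<close>

definition tail_coeff :: "real \<Rightarrow> real \<Rightarrow> real \<Rightarrow> real" where
  "tail_coeff s \<rho> x = (let a = \<rho> / s - s / 2 in
     std_normal_density (a - x) *
       ((\<rho> ^ 3 / (3 * s ^ 3) + \<rho> * s / 12) + a / 2 + x / 2 - edge_poly x (a - x) / 12))"

lemma std_normal_density_le_1: "std_normal_density w \<le> 1"
proof -
  have "1 / sqrt (2 * pi) * exp (- w\<^sup>2 / 2) \<le> 1 * 1" using pi_gt3 by (intro mult_mono) auto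
  thus ?thesis by (simp add: std_normal_density_def)
qed

text \<open>The expansion of the beta integral is evaluated at the exact standardized point
  \<open>W\<close> and then moved to a - x. The errors are: the expansion itself
  (\<open>R1\<close>), second order Taylor for \<open>Phi\<close> (\<open>R2\<close>), the point
  expansion (\<open>R3\<close>), the edge term at the wrong point (\<open>R4\<close>), and 1/(n+1)
  against 1/n (\<open>R5\<close>). The condition on (2 + |x|)^8 yields 1 + \<mu>^8 <= n + 1, because
  |\<mu>| <= 1 + |x|.\<close>

lemma binom_tail_local_expansion:
  fixes s \<rho> :: real
  assumes s: "s > 0"
  defines "a \<equiv> \<rho> / s - s / 2"
  shows "\<exists>K>0. \<exists>n0\<ge>1. \<forall>n j x \<theta>. n \<ge> n0 \<longrightarrow> 1 \<le> j \<longrightarrow> j \<le> n \<longrightarrow> \<bar>\<theta>\<bar> \<le> 1 \<longrightarrow>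
     2 * real j - 1 - real n = sqrt n * x - \<theta> \<longrightarrow> (2 + \<bar>x\<bar>) ^ 8 \<le> real n \<longrightarrow>
     \<bar>binom_tail n j (center_prob s \<rho> n \<theta>) - (Phi (a - x) + tail_coeff s \<rho> x / n)\<bar>
       \<le> K * (1 + \<bar>x\<bar>) ^ 8 * (1 / sqrt n) ^ 3"
proof -
  define \<kappa> where "\<kappa> = \<rho> / s\<^sup>2"
  define c where "c = \<rho> ^ 3 / (3 * s ^ 3) + \<rho> * s / 12"
  obtain K1 \<delta> where K1: "K1 > 0" "\<delta> > 0"
    "\<And>\<tau> \<theta>. 0 < \<tau> \<Longrightarrow> \<tau> \<le> \<delta> \<Longrightarrow> \<bar>\<theta>\<bar> \<le> 1 \<Longrightarrow>
     \<bar>(\<rho> - \<theta> * \<tau>) * \<tau>\<^sup>2 / s\<^sup>2\<bar> \<le> \<tau> / 2 \<and>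
     \<bar>log_odds \<tau> ((\<rho> - \<theta> * \<tau>) * \<tau>\<^sup>2 / s\<^sup>2)
       - ((\<kappa> - 1 / 2) * \<tau> - \<theta> * \<tau>\<^sup>2 / s\<^sup>2 + (\<kappa> ^ 3 / 3 + \<kappa> / 12) * \<tau> ^ 3)\<bar> \<le> K1 * \<tau> ^ 4"
    using log_odds_expansion[OF s, of \<rho>] unfolding \<kappa>_def by blast
  obtain K4 N0 where K4: "K4 > 0" "N0 \<ge> 1"
    "\<And>N \<mu> c T w. N \<ge> N0 \<Longrightarrow> 1 + \<mu> ^ 8 \<le> N \<Longrightarrow> 0 \<le> c \<Longrightarrow>
     (\<forall>w. (T has_real_derivative c * exp (- w\<^sup>2 / 2 + gauss_remainder N (\<mu> + w))) (at w)) \<Longrightarrow>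
     (T \<longlongrightarrow> 0) at_bot \<Longrightarrow> (T \<longlongrightarrow> 1) at_top \<Longrightarrow>
      \<bar>T w - (Phi w - std_normal_density w * edge_poly \<mu> w / (12 * N))\<bar> \<le> K4 * (1 + \<bar>\<mu>\<bar>) ^ 8 / N\<^sup>2"
    using laplace_expansion by blast
  obtain K5 where K5: "K5 > 0" "\<And>\<mu> \<mu>' w w'. std_normal_density w * edge_poly \<mu> w - std_normal_density w' * edge_poly \<mu>' w'
      \<le> K5 * (1 + \<bar>\<mu>\<bar> + \<bar>\<mu>'\<bar>) ^ 4 * (\<bar>\<mu> - \<mu>'\<bar> + \<bar>w - w'\<bar>)"
    using density_edge_poly_lipschitz by blast
  obtain K6 where K6: "K6 > 0" "\<And>\<mu> w. std_normal_density w * \<bar>edge_poly \<mu> w\<bar> \<le> K6 * (1 + \<bar>\<mu>\<bar>) ^ 3"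
    using density_edge_poly_bound by blast
  define K2 where "K2 = 3 + \<bar>a\<bar> + \<bar>c\<bar> + 2 * (K1 * s ^ 4)"
  define K3 where "K3 = \<bar>c\<bar> + \<bar>a\<bar> + 1 + K2"
  define K where "K = 256 * K4 + K3\<^sup>2 + K2 + 16 * K5 * (1 + K3) + 8 * K6"
  \<comment> \<open>The term with \<delta> ensures that the log step s / sqrt n is at most
    \<delta>.\<close>
  define n0 where "n0 = nat \<lceil>max (max 1 N0) (s\<^sup>2 / \<delta>\<^sup>2)\<rceil>"
  have K2: "K2 > 0" using K1 s by (auto simp: K2_def intro!: add_pos_nonneg)
  have K3: "K3 > 0" using K2 by (simp add: K3_def)
  have "\<bar>binom_tail n j (center_prob s \<rho> n \<theta>) - (Phi (a - x) + tail_coeff s \<rho> x / n)\<bar>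
       \<le> K * (1 + \<bar>x\<bar>) ^ 8 * (1 / sqrt n) ^ 3"
    if n: "n \<ge> n0" and j: "1 \<le> j" "j \<le> n" and \<theta>: "\<bar>\<theta>\<bar> \<le> 1"
      and jx: "2 * real j - 1 - real n = sqrt n * x - \<theta>" and xn: "(2 + \<bar>x\<bar>) ^ 8 \<le> real n"
    for n j x \<theta>
  proof -
    have "max (max 1 N0) (s\<^sup>2 / \<delta>\<^sup>2) \<le> real n" using n unfolding n0_def by linarith
    hence n1: "real n \<ge> 1" "real n \<ge> N0" "s\<^sup>2 / \<delta>\<^sup>2 \<le> real n" by auto
    define \<epsilon> where "\<epsilon> = 1 / sqrt n"
    define \<nu> where "\<nu> = sqrt (1 + \<epsilon>\<^sup>2)"
    define N where "N = real n + 1"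
    define X where "X = 1 + \<bar>x\<bar>"
    have X: "X \<ge> 1" by (simp add: X_def)
    have \<epsilon>: "0 < \<epsilon>" "\<epsilon> \<le> 1" using n1 by (auto simp: \<epsilon>_def)
    have sn: "sqrt n = 1 / \<epsilon>" by (simp add: \<epsilon>_def)
    have en: "\<epsilon>\<^sup>2 = 1 / real n" using n1 by (simp add: \<epsilon>_def power_divide)
    have nn: "real n = 1 / \<epsilon>\<^sup>2" using en n1 by simp
    note \<nu> = sqrt_one_plus_bounds[OF \<epsilon>, folded \<nu>_def]
    have sN: "sqrt N = \<nu> / \<epsilon>"
    proof -
      have "N = (1 + \<epsilon>\<^sup>2) / \<epsilon>\<^sup>2" using \<epsilon> by (simp add: N_def nn field_simps)
      thus ?thesis using \<epsilon> by (simp add: \<nu>_def real_sqrt_divide)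
    qed
    have N: "N > 0" "N \<ge> N0" using n1 by (auto simp: N_def)
    define \<tau> where "\<tau> = s * \<epsilon>"
    have \<tau>0: "\<tau> > 0" using s \<epsilon> by (simp add: \<tau>_def)
    have \<tau>\<delta>: "\<tau> \<le> \<delta>"
    proof -
      have "s\<^sup>2 \<le> \<delta>\<^sup>2 * real n" using n1(3) K1(2) by (simp add: field_simps)
      hence "s \<le> sqrt (\<delta>\<^sup>2 * real n)" by (rule real_le_rsqrt)
      also have "\<dots> = \<delta> * sqrt n" using K1(2) by (simp add: real_sqrt_mult)
      finally show ?thesis using \<epsilon> by (simp add: \<tau>_def sn field_simps)
    qed
    define g where "g = (\<rho> - \<theta> * \<tau>) * \<tau>\<^sup>2 / s\<^sup>2"
    have ts: "\<tau>\<^sup>2 / s\<^sup>2 = \<epsilon>\<^sup>2" using s by (simp add: \<tau>_def power_mult_distrib)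
    have g: "g = (\<rho> - \<theta> * \<tau>) / n" unfolding g_def times_divide_eq_right[symmetric] ts en by simp
    define v where "v = log_odds \<tau> g"
    have gt: "\<bar>g\<bar> \<le> \<tau> / 2" and vb: "\<bar>v - ((\<kappa> - 1 / 2) * \<tau> - \<theta> * \<epsilon>\<^sup>2 + (\<kappa> ^ 3 / 3 + \<kappa> / 12) * \<tau> ^ 3)\<bar> \<le> K1 * \<tau> ^ 4"
      using K1(3)[OF \<tau>0 \<tau>\<delta> \<theta>] unfolding g_def[symmetric] v_def[symmetric] times_divide_eq_right[symmetric, of \<theta>] ts by auto
    have cp: "center_prob s \<rho> n \<theta> = logistic v"
    proof -
      have 1: "s / sqrt n = \<tau>" by (simp add: \<tau>_def \<epsilon>_def)
      have "\<bar>g\<bar> < \<tau>" using gt \<tau>0 by linarith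
      hence "logistic v = (exp g - exp (- \<tau>)) / (exp \<tau> - exp (- \<tau>))"
        unfolding v_def by (rule logistic_log_odds[OF \<tau>0])
      thus ?thesis unfolding center_prob_def Let_def 1 g[symmetric] by simp
    qed
    define E where "E = v / \<epsilon> - (a - \<theta> * \<epsilon> + c * \<epsilon>\<^sup>2)"
    have E: "\<bar>E\<bar> \<le> (K1 * s ^ 4) * \<epsilon> ^ 3"
    proof -
      have "(\<kappa> - 1 / 2) * \<tau> - \<theta> * \<epsilon>\<^sup>2 + (\<kappa> ^ 3 / 3 + \<kappa> / 12) * \<tau> ^ 3 = \<epsilon> * (a - \<theta> * \<epsilon> + c * \<epsilon>\<^sup>2)"
      proof -
        have 1: "(\<kappa> - 1 / 2) * s = a" using s by (simp add: \<kappa>_def a_def power2_eq_square field_simps)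
        have 2: "(\<kappa> ^ 3 / 3 + \<kappa> / 12) * s ^ 3 = c" using s by (simp add: \<kappa>_def c_def field_simps eval_nat_numeral)
        have "(\<kappa> - 1 / 2) * \<tau> - \<theta> * \<epsilon>\<^sup>2 + (\<kappa> ^ 3 / 3 + \<kappa> / 12) * \<tau> ^ 3
            = \<epsilon> * ((\<kappa> - 1 / 2) * s - \<theta> * \<epsilon> + (\<kappa> ^ 3 / 3 + \<kappa> / 12) * s ^ 3 * \<epsilon>\<^sup>2)"
          unfolding \<tau>_def by algebra
        thus ?thesis unfolding 1 2 .
      qed
      hence "E = (v - ((\<kappa> - 1 / 2) * \<tau> - \<theta> * \<epsilon>\<^sup>2 + (\<kappa> ^ 3 / 3 + \<kappa> / 12) * \<tau> ^ 3)) / \<epsilon>"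
        using \<epsilon> by (simp add: E_def diff_divide_distrib)
      hence "\<bar>E\<bar> \<le> K1 * \<tau> ^ 4 / \<epsilon>" using vb \<epsilon> by (simp add: abs_divide divide_right_mono)
      also have "\<dots> = (K1 * s ^ 4) * \<epsilon> ^ 3" using \<epsilon> by (simp add: \<tau>_def field_simps eval_nat_numeral)
      finally show ?thesis .
    qed
    define \<mu> where "\<mu> = (2 * real j - 1 - real n) / sqrt N"
    have \<mu>: "\<mu> = (x - \<theta> * \<epsilon>) / \<nu>"
      unfolding \<mu>_def jx sN using \<epsilon> \<nu>(1) by (simp add: sn field_simps)
    define W where "W = sqrt N * v - \<mu>"
    have W: "W = \<nu> * (a - \<theta> * \<epsilon> + c * \<epsilon>\<^sup>2 + E) - (x - \<theta> * \<epsilon>) / \<nu>"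
      unfolding W_def \<mu> sN by (simp add: E_def)
    define w0 where "w0 = a - x"
    define k where "k = c + a / 2 + x / 2"
    have W1: "\<bar>W - (w0 + \<epsilon>\<^sup>2 * k)\<bar> \<le> K2 * X * \<epsilon> ^ 3"
      using standardized_point_expansion[OF \<epsilon> \<theta> E, of a c x]
      unfolding W \<nu>_def w0_def k_def K2_def X_def by simp
    have e32: "\<epsilon> ^ 3 \<le> \<epsilon>\<^sup>2" "\<epsilon> ^ 4 \<le> \<epsilon> ^ 3" "\<epsilon> ^ 3 \<ge> 0" "\<epsilon>\<^sup>2 \<le> \<epsilon>"
      using \<epsilon> power_decreasing[of 1 2 \<epsilon>] by (auto intro!: power_decreasing)
    have W2: "\<bar>W - w0\<bar> \<le> K3 * X * \<epsilon>\<^sup>2"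
    proof -
      have "\<bar>k\<bar> \<le> (\<bar>c\<bar> + \<bar>a\<bar> + 1) * X"
      proof -
        have "0 \<le> (\<bar>c\<bar> + \<bar>a\<bar>) * \<bar>x\<bar>" by simp
        hence "\<bar>c\<bar> + \<bar>a\<bar> + \<bar>x\<bar> \<le> (\<bar>c\<bar> + \<bar>a\<bar> + 1) * X" by (simp add: X_def algebra_simps)
        moreover have "\<bar>k\<bar> \<le> \<bar>c\<bar> + \<bar>a\<bar> + \<bar>x\<bar>" unfolding k_def by linarith
        ultimately show ?thesis by linarith
      qed
      hence "\<epsilon>\<^sup>2 * \<bar>k\<bar> \<le> \<epsilon>\<^sup>2 * ((\<bar>c\<bar> + \<bar>a\<bar> + 1) * X)" by (intro mult_left_mono) auto
      moreover have "K2 * X * \<epsilon> ^ 3 \<le> K2 * X * \<epsilon>\<^sup>2" using e32 K2 X by (intro mult_left_mono) auto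
      moreover have "\<bar>\<epsilon>\<^sup>2 * k\<bar> = \<epsilon>\<^sup>2 * \<bar>k\<bar>" by (simp add: abs_mult)
      moreover have "\<epsilon>\<^sup>2 * ((\<bar>c\<bar> + \<bar>a\<bar> + 1) * X) + K2 * X * \<epsilon>\<^sup>2 = K3 * X * \<epsilon>\<^sup>2" by (simp add: K3_def algebra_simps)
      ultimately show ?thesis using W1 unfolding abs_le_iff by linarith
    qed
    have te: "\<bar>\<theta> * \<epsilon>\<bar> \<le> \<epsilon>" unfolding abs_mult using \<theta> \<epsilon> mult_right_mono[of "\<bar>\<theta>\<bar>" 1 \<epsilon>] by simp
    have \<mu>x: "\<bar>\<mu> - x\<bar> \<le> X * \<epsilon>"
    proof -
      have 1: "\<mu> - x = x * (1 / \<nu> - 1) - (\<theta> * \<epsilon>) / \<nu>" unfolding \<mu> by (simp add: diff_divide_distrib right_diff_distrib)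
      have 2: "\<bar>x * (1 / \<nu> - 1)\<bar> \<le> \<bar>x\<bar> * \<epsilon>"
        unfolding abs_mult using \<nu>(5) e32 by (intro mult_left_mono) auto
      have 3: "\<bar>(\<theta> * \<epsilon>) / \<nu>\<bar> \<le> \<epsilon> / 1"
        unfolding abs_divide using te \<nu>(1) by (intro frac_le) auto
      have "\<bar>\<mu> - x\<bar> \<le> \<bar>x\<bar> * \<epsilon> + \<epsilon> / 1"
        unfolding 1 by (intro order_trans[OF abs_triangle_ineq4] add_mono 2 3)
      thus ?thesis by (simp add: X_def algebra_simps)
    qed
    have \<mu>b: "1 + \<bar>\<mu>\<bar> \<le> 1 + X"
    proof -
      have "\<bar>\<mu>\<bar> \<le> \<bar>x - \<theta> * \<epsilon>\<bar> / 1" unfolding \<mu> abs_divide using \<nu>(1) by (intro frac_le) auto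
      also have "\<bar>x - \<theta> * \<epsilon>\<bar> / 1 \<le> \<bar>x\<bar> + \<bar>\<theta> * \<epsilon>\<bar>" using abs_triangle_ineq4[of x "\<theta> * \<epsilon>"] by simp
      also have "\<dots> \<le> \<bar>x\<bar> + 1" using te \<epsilon> by linarith
      finally show ?thesis unfolding X_def by simp
    qed
    have \<mu>X: "1 + \<bar>\<mu>\<bar> \<le> 2 * X" using \<mu>b X by simp
    have "(1 + \<bar>\<mu>\<bar>) ^ 8 \<le> (2 + \<bar>x\<bar>) ^ 8" using \<mu>b by (intro power_mono) (auto simp: X_def)
    hence \<mu>N: "1 + \<mu> ^ 8 \<le> N" using one_plus_power8_le[of \<mu>] xn unfolding N_def by linarith
    obtain C where C: "C \<ge> 0" "\<forall>w. ((\<lambda>w. binom_tail n j (logistic ((\<mu> + w) / sqrt N))) has_real_derivative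
           C * exp (- w\<^sup>2 / 2 + gauss_remainder N (\<mu> + w))) (at w)"
      using binom_tail_gaussian_derivative[OF j] unfolding \<mu>_def N_def by blast
    define T where "T = (\<lambda>w. binom_tail n j (logistic ((\<mu> + w) / sqrt N)))"
    have fl: "filterlim (\<lambda>w. (\<mu> + w) / sqrt N) at_bot at_bot" "filterlim (\<lambda>w. (\<mu> + w) / sqrt N) at_top at_top"
    proof -
      have "\<exists>b. \<forall>w\<le>b. (\<mu> + w) / sqrt N \<le> Z" "\<exists>b. \<forall>w\<ge>b. Z \<le> (\<mu> + w) / sqrt N" for Z
        using N by (auto intro!: exI[of _ "Z * sqrt N - \<mu>"] simp: pos_divide_le_eq pos_le_divide_eq)
      thus "filterlim (\<lambda>w. (\<mu> + w) / sqrt N) at_bot at_bot" "filterlim (\<lambda>w. (\<mu> + w) / sqrt N) at_top at_top"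
        unfolding filterlim_at_top filterlim_at_bot eventually_at_top_linorder eventually_at_bot_linorder by blast+
    qed
    have Tlim: "(T \<longlongrightarrow> 0) at_bot" "(T \<longlongrightarrow> 1) at_top"
      unfolding T_def
      by (rule filterlim_compose[OF binom_tail_logistic_tendsto(1)[OF j] fl(1)]
               filterlim_compose[OF binom_tail_logistic_tendsto(2)[OF j] fl(2)])+
    have "\<bar>T W - (Phi W - std_normal_density W * edge_poly \<mu> W / (12 * N))\<bar> \<le> K4 * (1 + \<bar>\<mu>\<bar>) ^ 8 / N\<^sup>2"
      by (rule K4(3)[OF N(2) \<mu>N C(1) _ Tlim]) (use C(2) in \<open>simp add: T_def\<close>)
    moreover have "T W = binom_tail n j (center_prob s \<rho> n \<theta>)"
      using N by (simp add: T_def W_def cp)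
    ultimately have R1: "\<bar>binom_tail n j (center_prob s \<rho> n \<theta>) - (Phi W - std_normal_density W * edge_poly \<mu> W / (12 * N))\<bar>
        \<le> K4 * (1 + \<bar>\<mu>\<bar>) ^ 8 / N\<^sup>2" by simp
    have XX: "X ^ i \<le> X ^ 8" if "i \<le> 8" for i using X that by (intro power_increasing)
    have R1': "K4 * (1 + \<bar>\<mu>\<bar>) ^ 8 / N\<^sup>2 \<le> 256 * K4 * X ^ 8 * \<epsilon> ^ 3"
    proof -
      have "(1 + \<bar>\<mu>\<bar>) ^ 8 \<le> (2 * X) ^ 8" using \<mu>X by (intro power_mono) auto
      hence "K4 * (1 + \<bar>\<mu>\<bar>) ^ 8 \<le> K4 * (256 * X ^ 8)" using K4(1) by (intro mult_left_mono) (auto simp: power_mult_distrib)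
      moreover have "1 / N\<^sup>2 \<le> \<epsilon> ^ 3"
      proof -
        have "(real n)\<^sup>2 \<le> N\<^sup>2" unfolding N_def by (intro power_mono) auto
        hence "1 / N\<^sup>2 \<le> 1 / (real n)\<^sup>2" using n1 by (intro frac_le) auto
        also have "\<dots> = \<epsilon> ^ 4" using \<epsilon> by (simp add: nn power_divide flip: power_mult)
        finally show ?thesis using e32 by linarith
      qed
      ultimately have "(K4 * (1 + \<bar>\<mu>\<bar>) ^ 8) * (1 / N\<^sup>2) \<le> (K4 * (256 * X ^ 8)) * \<epsilon> ^ 3"
        using K4(1) X by (intro mult_mono) auto
      thus ?thesis by (simp add: mult_ac)
    qed
    define H where "H = (\<lambda>\<mu> w. std_normal_density w * edge_poly \<mu> w)"
    have R2: "\<bar>Phi W - Phi w0 - std_normal_density w0 * (W - w0)\<bar> \<le> K3\<^sup>2 * X ^ 8 * \<epsilon> ^ 3"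
    proof -
      have "\<bar>W - w0\<bar>\<^sup>2 \<le> (K3 * X * \<epsilon>\<^sup>2)\<^sup>2" using W2 by (intro power_mono) auto
      also have "\<dots> = K3\<^sup>2 * (X\<^sup>2 * \<epsilon> ^ 4)" by (simp add: power_mult_distrib flip: power_mult)
      also have "\<dots> \<le> K3\<^sup>2 * (X ^ 8 * \<epsilon> ^ 3)" using e32 XX[of 2] X by (intro mult_left_mono mult_mono) auto
      finally show ?thesis using Phi_taylor[of W w0] by (simp add: mult.assoc)
    qed
    have R3: "\<bar>std_normal_density w0 * (W - w0 - \<epsilon>\<^sup>2 * k)\<bar> \<le> K2 * X ^ 8 * \<epsilon> ^ 3"
    proof -
      have "\<bar>std_normal_density w0\<bar> * \<bar>W - w0 - \<epsilon>\<^sup>2 * k\<bar> \<le> 1 * (K2 * X * \<epsilon> ^ 3)"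
        using W1 std_normal_density_le_1[of w0] by (intro mult_mono) (auto simp: diff_diff_eq)
      also have "\<dots> \<le> K2 * X ^ 8 * \<epsilon> ^ 3"
        using K2 e32 XX[of 1] by (simp add: mult_right_mono)
      finally show ?thesis by (simp add: abs_mult)
    qed
    have R4: "\<bar>(H \<mu> W - H x w0) * (\<epsilon>\<^sup>2 / 12)\<bar> \<le> 16 * K5 * (1 + K3) * X ^ 8 * \<epsilon> ^ 3"
    proof -
      have "\<bar>H \<mu> W - H x w0\<bar> \<le> K5 * (1 + \<bar>\<mu>\<bar> + \<bar>x\<bar>) ^ 4 * (\<bar>\<mu> - x\<bar> + \<bar>W - w0\<bar>)"
        using K5(2)[of W \<mu> w0 x] K5(2)[of w0 x W \<mu>] unfolding H_def abs_le_iff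
        by (simp add: abs_minus_commute add.commute add.left_commute)
      also have "\<dots> \<le> K5 * (16 * X ^ 4) * (X * \<epsilon> + K3 * X * \<epsilon>)"
      proof (intro mult_mono add_mono)
        have "1 + \<bar>\<mu>\<bar> + \<bar>x\<bar> \<le> 2 * X" using \<mu>b unfolding X_def by simp
        hence "(1 + \<bar>\<mu>\<bar> + \<bar>x\<bar>) ^ 4 \<le> (2 * X) ^ 4" by (intro power_mono) auto
        thus "(1 + \<bar>\<mu>\<bar> + \<bar>x\<bar>) ^ 4 \<le> 16 * X ^ 4" by (simp add: power_mult_distrib)
        have "K3 * X * \<epsilon>\<^sup>2 \<le> K3 * X * \<epsilon>" using K3 X e32 by (intro mult_left_mono) auto
        thus "\<bar>W - w0\<bar> \<le> K3 * X * \<epsilon>" using W2 by linarith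
      qed (use \<mu>x K5 K3 X \<epsilon> in auto)
      also have "\<dots> = 16 * K5 * (1 + K3) * (X ^ 5 * \<epsilon>)" by (simp add: algebra_simps eval_nat_numeral)
      also have "\<dots> \<le> 16 * K5 * (1 + K3) * (X ^ 8 * \<epsilon>)"
        using K5 K3 \<epsilon> XX[of 5] by (intro mult_left_mono mult_right_mono) auto
      finally have "\<bar>H \<mu> W - H x w0\<bar> * (\<epsilon>\<^sup>2 / 12) \<le> 16 * K5 * (1 + K3) * (X ^ 8 * \<epsilon>) * \<epsilon>\<^sup>2"
        using K5 K3 X \<epsilon> by (intro mult_mono) auto
      also have "\<dots> = 16 * K5 * (1 + K3) * X ^ 8 * \<epsilon> ^ 3" by (simp add: eval_nat_numeral)
      finally show ?thesis by (simp add: abs_mult)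
    qed
    have R5: "\<bar>H \<mu> W * ((\<epsilon>\<^sup>2 - 1 / N) / 12)\<bar> \<le> 8 * K6 * X ^ 8 * \<epsilon> ^ 3"
    proof -
      have "0 \<le> \<epsilon>\<^sup>2 - 1 / N" "\<epsilon>\<^sup>2 - 1 / N \<le> \<epsilon> ^ 3"
      proof -
        have e1: "\<epsilon>\<^sup>2 - 1 / N = 1 / (real n * N)" using n1 N by (simp add: en N_def field_simps)
        show "0 \<le> \<epsilon>\<^sup>2 - 1 / N" unfolding e1 using N by simp
        have "1 / (real n * N) \<le> 1 / (real n * real n)" using n1 N by (intro frac_le mult_mono) (auto simp: N_def)
        also have "\<dots> = \<epsilon> ^ 4" using \<epsilon> by (simp add: nn power_divide flip: power_add)
        finally show "\<epsilon>\<^sup>2 - 1 / N \<le> \<epsilon> ^ 3" unfolding e1 using e32 by linarith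
      qed
      hence d: "\<bar>(\<epsilon>\<^sup>2 - 1 / N) / 12\<bar> \<le> \<epsilon> ^ 3" using e32 by simp
      have "\<bar>H \<mu> W\<bar> \<le> K6 * (1 + \<bar>\<mu>\<bar>) ^ 3" using K6(2)[of W \<mu>] by (simp add: H_def abs_mult)
      also have "\<dots> \<le> K6 * (2 * X) ^ 3" using K6 \<mu>X by (intro mult_left_mono power_mono) auto
      also have "\<dots> = 8 * K6 * X ^ 3" by (simp add: power_mult_distrib)
      also have "\<dots> \<le> 8 * K6 * X ^ 8" using K6 XX[of 3] by (intro mult_left_mono) auto
      finally have "\<bar>H \<mu> W\<bar> * \<bar>(\<epsilon>\<^sup>2 - 1 / N) / 12\<bar> \<le> 8 * K6 * X ^ 8 * \<epsilon> ^ 3"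
        using d K6 X by (intro mult_mono) auto
      thus ?thesis by (simp add: abs_mult)
    qed
    have tc: "tail_coeff s \<rho> x / n = std_normal_density w0 * (\<epsilon>\<^sup>2 * k) - H x w0 * (\<epsilon>\<^sup>2 / 12)"
      unfolding tail_coeff_def Let_def a_def[symmetric] w0_def[symmetric] c_def[symmetric] H_def k_def en
      by (simp add: algebra_simps diff_divide_distrib add_divide_distrib)
    \<comment> \<open>Here c + a/2 + x/2 is \<open>k\<close>: adding and subtracting its
      contribution isolates the coefficient and leaves one summand for each of the errors
      \<open>R2\<close> to \<open>R5\<close>.\<close>
    have dec: "(Phi W - std_normal_density W * edge_poly \<mu> W / (12 * N)) - (Phi w0 + tail_coeff s \<rho> x / n)
      = (Phi W - Phi w0 - std_normal_density w0 * (W - w0)) + std_normal_density w0 * (W - w0 - \<epsilon>\<^sup>2 * k)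
        - (H \<mu> W - H x w0) * (\<epsilon>\<^sup>2 / 12) + H \<mu> W * ((\<epsilon>\<^sup>2 - 1 / N) / 12)"
    proof -
      have 1: "std_normal_density W * edge_poly \<mu> W / (12 * N) = H \<mu> W * (1 / N / 12)" by (simp add: H_def)
      show ?thesis unfolding 1 tc by (simp add: algebra_simps diff_divide_distrib)
    qed
    have "\<bar>binom_tail n j (center_prob s \<rho> n \<theta>) - (Phi w0 + tail_coeff s \<rho> x / n)\<bar>
      \<le> 256 * K4 * X ^ 8 * \<epsilon> ^ 3 + K3\<^sup>2 * X ^ 8 * \<epsilon> ^ 3 + K2 * X ^ 8 * \<epsilon> ^ 3
         + 16 * K5 * (1 + K3) * X ^ 8 * \<epsilon> ^ 3 + 8 * K6 * X ^ 8 * \<epsilon> ^ 3"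
    proof -
      have tri: "\<bar>T - P\<bar> \<le> b0 + b1 + b2 + b3 + b4"
        if "\<bar>T - Q\<bar> \<le> b0" "\<bar>A\<bar> \<le> b1" "\<bar>B\<bar> \<le> b2" "\<bar>C\<bar> \<le> b3" "\<bar>D\<bar> \<le> b4" "Q - P = A + B - C + D"
        for T P Q A B C D b0 b1 b2 b3 b4 :: real
        using that by linarith
      show ?thesis by (rule tri[OF order_trans[OF R1 R1'] R2 R3 R4 R5 dec])
    qed
    also have "\<dots> = K * X ^ 8 * \<epsilon> ^ 3" by (simp add: K_def algebra_simps)
    finally show ?thesis unfolding w0_def X_def \<epsilon>_def .
  qed
  moreover have "K > 0" using K4 K5 K6 K2 K3 by (auto simp: K_def intro!: add_pos_nonneg)
  moreover have "n0 \<ge> 1"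
  proof -
    have "(1::real) \<le> max (max 1 N0) (s\<^sup>2 / \<delta>\<^sup>2)" by simp
    hence "1 \<le> \<lceil>max (max 1 N0) (s\<^sup>2 / \<delta>\<^sup>2)\<rceil>" by linarith
    thus ?thesis unfolding n0_def by linarith
  qed
  ultimately show ?thesis by blast
qed

section \<open>Exponential tail bounds\<close>

lemma binom_tail_complement:
  assumes "j \<le> Suc n"
  shows "(\<Sum>i<j. real (n choose i) * p ^ i * (1 - p) ^ (n - i)) + binom_tail n j p = 1"
proof -
  have "{..n} = {..<j} \<union> {j..n}" using assms by auto
  hence "(\<Sum>i\<le>n. real (n choose i) * p ^ i * (1 - p) ^ (n - i))
     = (\<Sum>i<j. real (n choose i) * p ^ i * (1 - p) ^ (n - i)) + binom_tail n j p"
    unfolding binom_tail_def by (subst sum.union_disjoint[symmetric]) auto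
  moreover have "(\<Sum>i\<le>n. real (n choose i) * p ^ i * (1 - p) ^ (n - i)) = 1"
    using binomial_ring[of p "1 - p" n] by simp
  ultimately show ?thesis by simp
qed

lemma binom_tail_0: "binom_tail n 0 p = 1"
  using binom_tail_complement[of 0 n p] by simp

lemma binom_tail_beyond: "j > n \<Longrightarrow> binom_tail n j p = 0"
  by (simp add: binom_tail_def)

lemma binom_exponential_moment:
  "(\<Sum>i\<le>n. real (n choose i) * p ^ i * (1 - p) ^ (n - i) * exp (t * (2 * real i - real n)))
     = (p * exp t + (1 - p) * exp (- t)) ^ n"
proof -
  have *: "real (n choose i) * p ^ i * (1 - p) ^ (n - i) * exp (t * (2 * real i - real n))
      = real (n choose i) * (p * exp t) ^ i * ((1 - p) * exp (- t)) ^ (n - i)" if "i \<le> n" for i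
  proof -
    have "exp t ^ i * exp (- t) ^ (n - i) = exp (real i * t + real (n - i) * (- t))"
      unfolding exp_add exp_of_nat_mult ..
    also have "real i * t + real (n - i) * (- t) = t * (2 * real i - real n)"
      using that by (simp add: of_nat_diff algebra_simps)
    finally have e: "exp (t * (2 * real i - real n)) = exp t ^ i * exp (- t) ^ (n - i)" by simp
    show ?thesis unfolding e power_mult_distrib by (simp add: mult_ac)
  qed
  show ?thesis unfolding binomial_ring by (intro sum.cong refl *) auto
qed

text \<open>Markov's inequality with the threshold at the midpoint 2 j - 1 - n. The exponent u (2 i
  - 2 j + 1) is nonnegative on the upper tail for u = t and on the lower tail for u = -t, so one
  computation gives both bounds.\<close>

lemma binom_tail_chernoff:
  assumes p: "0 \<le> p" "p \<le> 1" and t: "0 \<le> t" and j: "j \<le> n"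
  shows "0 \<le> binom_tail n j p" "binom_tail n j p \<le> 1"
    "binom_tail n j p \<le> exp (- t * (2 * real j - 1 - real n)) * (p * exp t + (1 - p) * exp (- t)) ^ n"
    "1 - binom_tail n j p \<le> exp (t * (2 * real j - 1 - real n)) * (p * exp (- t) + (1 - p) * exp t) ^ n"
proof -
  define b where "b = (\<lambda>i. real (n choose i) * p ^ i * (1 - p) ^ (n - i))"
  have b: "b i \<ge> 0" for i using p by (simp add: b_def)
  have T: "binom_tail n j p = sum b {j..n}" by (simp add: binom_tail_def b_def)
  have C: "1 - binom_tail n j p = sum b {..<j}"
    using binom_tail_complement[of j n p] j by (simp add: b_def)
  show "0 \<le> binom_tail n j p" unfolding T by (intro sum_nonneg b)
  have "0 \<le> 1 - binom_tail n j p" unfolding C by (intro sum_nonneg b)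
  thus "binom_tail n j p \<le> 1" by simp
  have *: "sum b I \<le> exp (- u * (2 * real j - 1 - real n)) * (p * exp u + (1 - p) * exp (- u)) ^ n"
    if I: "I \<subseteq> {..n}" "\<And>i. i \<in> I \<Longrightarrow> 0 \<le> u * (2 * real i - 2 * real j + 1)" for I u
  proof -
    have "sum b I \<le> (\<Sum>i\<in>I. b i * exp (u * (2 * real i - 2 * real j + 1)))"
    proof (intro sum_mono)
      fix i assume "i \<in> I"
      hence "b i * 1 \<le> b i * exp (u * (2 * real i - 2 * real j + 1))"
        using I(2) b by (intro mult_left_mono) auto
      thus "b i \<le> b i * exp (u * (2 * real i - 2 * real j + 1))" by simp
    qed
    also have "\<dots> \<le> (\<Sum>i\<le>n. b i * exp (u * (2 * real i - 2 * real j + 1)))"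
      using I(1) b by (intro sum_mono2) auto
    also have "\<dots> = (\<Sum>i\<le>n. exp (- u * (2 * real j - 1 - real n)) * (b i * exp (u * (2 * real i - real n))))"
    proof (intro sum.cong refl)
      fix i
      have "u * (2 * real i - 2 * real j + 1) = - u * (2 * real j - 1 - real n) + u * (2 * real i - real n)"
        by (simp add: algebra_simps)
      hence "exp (u * (2 * real i - 2 * real j + 1)) = exp (- u * (2 * real j - 1 - real n)) * exp (u * (2 * real i - real n))"
        by (simp only: exp_add)
      thus "b i * exp (u * (2 * real i - 2 * real j + 1)) = exp (- u * (2 * real j - 1 - real n)) * (b i * exp (u * (2 * real i - real n)))"
        by simp
    qed
    also have "\<dots> = exp (- u * (2 * real j - 1 - real n)) * (p * exp u + (1 - p) * exp (- u)) ^ n"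
      unfolding sum_distrib_left[symmetric] b_def binom_exponential_moment ..
    finally show ?thesis .
  qed
  show "binom_tail n j p \<le> exp (- t * (2 * real j - 1 - real n)) * (p * exp t + (1 - p) * exp (- t)) ^ n"
    unfolding T using t by (intro *) (auto intro!: mult_nonneg_nonneg)
  have "0 \<le> - t * (2 * real i - 2 * real j + 1)" if "i < j" for i
    using that t by (intro mult_nonpos_nonpos) auto
  from *[of "{..<j}" "- t", OF _ this]
  have "{..<j} \<subseteq> {..n} \<Longrightarrow> sum b {..<j} \<le> exp (t * (2 * real j - 1 - real n)) * (p * exp (- t) + (1 - p) * exp t) ^ n"
    by auto
  moreover have "{..<j} \<subseteq> {..n}" using j by auto
  ultimately show "1 - binom_tail n j p \<le> exp (t * (2 * real j - 1 - real n)) * (p * exp (- t) + (1 - p) * exp t) ^ n"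
    unfolding C by blast
qed

lemma sinh_ge_self: "sinh x \<ge> x" if "x \<ge> 0" for x :: real
proof -
  have "sinh x - x \<ge> 0"
    by (rule nonneg_by_deriv[where F = "\<lambda>x. sinh x - x" and F' = "\<lambda>x. cosh x - 1"])
       (use that in \<open>auto intro!: derivative_eq_intros simp: cosh_real_ge_1\<close>)
  thus ?thesis by simp
qed

lemma cosh_le_exp_half_square: "cosh x \<le> exp (x\<^sup>2 / 2)" for x :: real
proof -
  have "exp (ln (cosh x)) \<le> exp (x\<^sup>2 / 2)" using ln_cosh_bounds(1)[of x] by (simp only: exp_le_cancel_iff)
  thus ?thesis by (simp add: cosh_real_pos)
qed

lemma abs_sinh_le: "\<bar>sinh x\<bar> \<le> \<bar>x\<bar> * cosh x" for x :: real
proof -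
  have *: "sinh y \<le> y * cosh y" if "y \<ge> 0" for y :: real
  proof -
    have "tanh y * cosh y \<le> y * cosh y" using tanh_le_self[OF that] by (intro mult_right_mono) (auto simp: cosh_real_nonneg)
    thus ?thesis by (simp add: tanh_def cosh_real_nonzero)
  qed
  show ?thesis using *[of x] *[of "- x"] by (cases "x \<ge> 0") auto
qed

text \<open>One step has the moment cosh (M \<tau>) + (2 p - 1) sinh (M \<tau>), which is 1 +
  O(\<tau>^2) because 2 p - 1 = O(\<tau>); with \<tau>^2 = s^2/n its n-th power stays below e^(L
  s^2). The same estimate of 2 p - 1 puts p into (0, 1).\<close>

lemma center_prob_moment_bound:
  fixes s \<rho> M :: real
  assumes s: "s > 0"
  shows "\<exists>K>0. \<exists>n0\<ge>1. \<forall>n \<theta>. n \<ge> n0 \<longrightarrow> \<bar>\<theta>\<bar> \<le> 1 \<longrightarrow>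
     0 < center_prob s \<rho> n \<theta> \<and> center_prob s \<rho> n \<theta> < 1 \<and>
     (center_prob s \<rho> n \<theta> * exp (M * (s / sqrt n)) + (1 - center_prob s \<rho> n \<theta>) * exp (- (M * (s / sqrt n)))) ^ n \<le> K"
proof -
  define G where "G = (\<bar>\<rho>\<bar> + 1) / s\<^sup>2"
  have G: "G > 0" using s by (auto simp: G_def intro!: divide_pos_pos)
  define D where "D = 2 * G + 1"
  define L where "L = M\<^sup>2 + 2 * D * \<bar>M\<bar>"
  \<comment> \<open>Every entry b becomes a smallness condition \<tau> b <= 1 once \<tau> B <= 1,
    which the choice of \<open>n0\<close> guarantees.\<close>
  define B where "B = max (max 1 (\<bar>M\<bar> + 1)) (max (2 * D) (2 * G))"
  define n0 where "n0 = nat \<lceil>max 1 (s\<^sup>2 * B\<^sup>2)\<rceil>"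
  define K where "K = exp (L * s\<^sup>2)"
  have "0 < center_prob s \<rho> n \<theta> \<and> center_prob s \<rho> n \<theta> < 1 \<and>
     (center_prob s \<rho> n \<theta> * exp (M * (s / sqrt n)) + (1 - center_prob s \<rho> n \<theta>) * exp (- (M * (s / sqrt n)))) ^ n \<le> K"
    if n: "n \<ge> n0" and \<theta>: "\<bar>\<theta>\<bar> \<le> 1" for n \<theta>
  proof -
    have "max 1 (s\<^sup>2 * B\<^sup>2) \<le> real n" using n unfolding n0_def by linarith
    hence n1: "real n \<ge> 1" "(s * B)\<^sup>2 \<le> real n" by (auto simp: power_mult_distrib)
    define \<tau> where "\<tau> = s / sqrt n"
    define p where "p = center_prob s \<rho> n \<theta>"
    define g where "g = (\<rho> - \<theta> * \<tau>) / n"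
    have \<tau>0: "\<tau> > 0" using s n1 by (simp add: \<tau>_def)
    have B1: "B \<ge> 1" by (simp add: B_def)
    have "s * B \<le> sqrt n" using n1(2) by (rule real_le_rsqrt)
    hence \<tau>B: "\<tau> * B \<le> 1" using n1 by (simp add: \<tau>_def field_simps)
    have tb: "\<tau> * b \<le> 1" if "b \<le> B" for b
      using mult_left_mono[OF that, of \<tau>] \<tau>0 \<tau>B by linarith
    have t1: "\<tau> \<le> 1" using tb[of 1] B1 by simp
    have tM: "\<tau> * \<bar>M\<bar> \<le> 1" by (rule tb) (simp add: B_def)
    have tD: "\<tau> * (2 * D) \<le> 1" by (rule tb) (simp add: B_def)
    have tG: "\<tau> * (2 * G) \<le> 1" by (rule tb) (simp add: B_def)
    have \<tau>2: "\<tau>\<^sup>2 = s\<^sup>2 / n" using n1 by (simp add: \<tau>_def power_divide)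
    have tt: "\<tau>\<^sup>2 \<le> \<tau>" "\<tau>\<^sup>2 \<le> 1" using \<tau>0 t1 power_decreasing[of 1 2 \<tau>] by (auto simp: power_le_one)
    have g1: "\<bar>g\<bar> \<le> G * \<tau>\<^sup>2"
    proof -
      have "\<bar>\<theta> * \<tau>\<bar> \<le> 1" unfolding abs_mult using \<theta> \<tau>0 t1 by (intro mult_le_one) auto
      hence "\<bar>\<rho> - \<theta> * \<tau>\<bar> \<le> \<bar>\<rho>\<bar> + 1" by linarith
      hence "\<bar>\<rho> - \<theta> * \<tau>\<bar> / n \<le> (\<bar>\<rho>\<bar> + 1) / n" using n1 by (intro divide_right_mono) auto
      also have "\<dots> = G * \<tau>\<^sup>2" using s by (simp add: G_def \<tau>2)
      finally show ?thesis by (simp add: g_def)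
    qed
    have "G * \<tau>\<^sup>2 \<le> G * \<tau>" using G tt by (intro mult_left_mono) auto
    moreover have "G * \<tau> = (\<tau> * (2 * G)) / 2" by simp
    ultimately have g2: "\<bar>g\<bar> \<le> 1" using g1 tG by linarith
    have eg: "\<bar>exp g - 1\<bar> \<le> 2 * G * \<tau>\<^sup>2"
    proof (cases "g \<ge> 0")
      case True
      have "exp g \<le> 1 + g + g\<^sup>2" using True g2 by (intro exp_bound) auto
      moreover have "g * g \<le> g * 1" using True g2 by (intro mult_left_mono) auto
      moreover have "exp g \<ge> 1" using True by simp
      ultimately show ?thesis using g1 True by (simp add: power2_eq_square)
    next
      case False
      moreover have "0 \<le> G * \<tau>\<^sup>2" using G by simp
      moreover have "2 * G * \<tau>\<^sup>2 = 2 * (G * \<tau>\<^sup>2)" by simp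
      moreover have "exp g \<le> 1" using False by simp
      ultimately show ?thesis using exp_ge_add_one_self[of g] g1 by linarith
    qed
    have ct: "\<bar>cosh \<tau> - 1\<bar> \<le> \<tau>\<^sup>2"
    proof -
      have "exp (\<tau>\<^sup>2 / 2) \<le> 1 + \<tau>\<^sup>2 / 2 + (\<tau>\<^sup>2 / 2)\<^sup>2" using tt by (intro exp_bound) auto
      also have "(\<tau>\<^sup>2 / 2)\<^sup>2 \<le> \<tau>\<^sup>2 / 2"
      proof -
        have "(\<tau>\<^sup>2 / 2) * (\<tau>\<^sup>2 / 2) \<le> (\<tau>\<^sup>2 / 2) * 1" using tt by (intro mult_left_mono) auto
        thus ?thesis by (simp add: power2_eq_square)
      qed
      finally have "exp (\<tau>\<^sup>2 / 2) \<le> 1 + \<tau>\<^sup>2" by simp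
      thus ?thesis using cosh_le_exp_half_square[of \<tau>] cosh_real_ge_1[of \<tau>] by linarith
    qed
    have sh: "sinh \<tau> \<ge> \<tau>" using \<tau>0 by (intro sinh_ge_self) auto
    have pe: "2 * p - 1 = (exp g - cosh \<tau>) / sinh \<tau>"
    proof -
      have d: "exp \<tau> - exp (- \<tau>) = 2 * sinh \<tau>" by (simp add: sinh_def)
      have "p = (exp g - exp (- \<tau>)) / (2 * sinh \<tau>)"
        unfolding p_def center_prob_def Let_def \<tau>_def[symmetric] g_def[symmetric] d ..
      hence "2 * p - 1 = (exp g - exp (- \<tau>) - sinh \<tau>) / sinh \<tau>" using sh \<tau>0 by (simp add: field_simps)
      moreover have "exp (- \<tau>) + sinh \<tau> = cosh \<tau>" by (simp add: sinh_def cosh_def field_simps)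
      ultimately show ?thesis by (simp add: algebra_simps)
    qed
    have pb: "\<bar>2 * p - 1\<bar> \<le> D * \<tau>"
    proof -
      have "\<bar>exp g - cosh \<tau>\<bar> \<le> D * \<tau>\<^sup>2" using eg ct by (simp add: D_def algebra_simps)
      hence "\<bar>exp g - cosh \<tau>\<bar> / sinh \<tau> \<le> D * \<tau>\<^sup>2 / \<tau>" using sh \<tau>0 by (intro frac_le) auto
      also have "\<dots> = D * \<tau>" using \<tau>0 by (simp add: power2_eq_square)
      finally show ?thesis unfolding pe abs_divide using sh \<tau>0 by simp
    qed
    have "\<bar>2 * p - 1\<bar> \<le> 1 / 2" using pb tD by (simp add: algebra_simps)
    hence p01: "0 < p" "p < 1" unfolding abs_le_iff by linarith+
    define q where "q = p * exp (M * \<tau>) + (1 - p) * exp (- (M * \<tau>))"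
    have q0: "q \<ge> 0" using p01 by (simp add: q_def)
    have qe: "q = cosh (M * \<tau>) + (2 * p - 1) * sinh (M * \<tau>)"
      by (simp add: q_def cosh_def sinh_def field_simps)
    have Mt: "\<bar>M * \<tau>\<bar> \<le> 1" using tM \<tau>0 by (simp add: abs_mult mult.commute)
    have m2: "(M * \<tau>)\<^sup>2 \<le> 1" using Mt by (simp add: abs_square_le_1)
    have "exp ((M * \<tau>)\<^sup>2 / 2) \<le> 1 + (M * \<tau>)\<^sup>2 / 2 + ((M * \<tau>)\<^sup>2 / 2)\<^sup>2" using m2 by (intro exp_bound) auto
    also have "((M * \<tau>)\<^sup>2 / 2)\<^sup>2 \<le> (M * \<tau>)\<^sup>2 / 2"
    proof -
      have "((M * \<tau>)\<^sup>2 / 2) * ((M * \<tau>)\<^sup>2 / 2) \<le> ((M * \<tau>)\<^sup>2 / 2) * 1" using m2 by (intro mult_left_mono) auto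
      thus ?thesis by (simp add: power2_eq_square)
    qed
    finally have cM: "cosh (M * \<tau>) \<le> 1 + (M * \<tau>)\<^sup>2" using cosh_le_exp_half_square[of "M * \<tau>"] by simp
    have sM: "\<bar>sinh (M * \<tau>)\<bar> \<le> 2 * \<bar>M\<bar> * \<tau>"
    proof -
      have "\<bar>M * \<tau>\<bar> * cosh (M * \<tau>) \<le> \<bar>M * \<tau>\<bar> * 2" using cM m2 by (intro mult_left_mono) auto
      thus ?thesis using abs_sinh_le[of "M * \<tau>"] \<tau>0 by (simp add: abs_mult)
    qed
    have "(2 * p - 1) * sinh (M * \<tau>) \<le> (D * \<tau>) * (2 * \<bar>M\<bar> * \<tau>)"
      using abs_mult_le_mult[OF pb sM] by linarith
    hence "q \<le> 1 + ((M * \<tau>)\<^sup>2 + (D * \<tau>) * (2 * \<bar>M\<bar> * \<tau>))" unfolding qe using cM by linarith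
    also have "(M * \<tau>)\<^sup>2 + (D * \<tau>) * (2 * \<bar>M\<bar> * \<tau>) = L * \<tau>\<^sup>2" by (simp add: L_def power2_eq_square algebra_simps)
    also have "1 + L * \<tau>\<^sup>2 \<le> exp (L * \<tau>\<^sup>2)" by (rule exp_ge_add_one_self)
    finally have "q ^ n \<le> exp (L * \<tau>\<^sup>2) ^ n" using q0 by (intro power_mono)
    also have "\<dots> = exp (real n * (L * \<tau>\<^sup>2))" unfolding exp_of_nat_mult ..
    also have "real n * (L * \<tau>\<^sup>2) = L * s\<^sup>2" using n1 by (simp add: \<tau>2)
    finally show ?thesis using p01 unfolding K_def q_def p_def \<tau>_def by blast
  qed
  moreover have "K > 0" by (simp add: K_def)
  moreover have "n0 \<ge> 1"
  proof -
    have "(1::real) \<le> max 1 (s\<^sup>2 * B\<^sup>2)" by simp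
    hence "1 \<le> \<lceil>max 1 (s\<^sup>2 * B\<^sup>2)\<rceil>" by linarith
    thus ?thesis unfolding n0_def by linarith
  qed
  ultimately show ?thesis by blast
qed

text \<open>The strike with log-moneyness \<open>s x\<close> lies halfway (up to the tilt \<open>\<theta>\<close>) between the nodes
  \<open>j - 1\<close> and \<open>j\<close>; the cases \<open>j = 0\<close> and \<open>j > n\<close> are strikes outside the tree.\<close>

definition center_index :: "nat \<Rightarrow> real \<Rightarrow> nat \<Rightarrow> real \<Rightarrow> bool" where
  "center_index n x j \<theta> \<longleftrightarrow> 2 * real j - 1 - real n = sqrt n * x - \<theta>
     \<and> (j \<ge> 1 \<longrightarrow> \<bar>\<theta>\<bar> \<le> 1) \<and> (j = 0 \<longrightarrow> x \<le> - sqrt n) \<and> (j > n \<longrightarrow> x \<ge> sqrt n)"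

text \<open>The parameter t = M s / sqrt n makes t sqrt n x equal to M s x, and the tilt costs at
  most a factor e^(M s). Outside the tree \<theta> is not bounded, but there the tail is exactly 1
  or 0 and the sign of x makes the bound trivial.\<close>

lemma center_tail_chernoff:
  fixes s \<rho> M :: real
  assumes s: "s > 0" and M: "M > 0"
  shows "\<exists>K>0. \<exists>n0\<ge>1. \<forall>n x j \<theta>. n \<ge> n0 \<longrightarrow> center_index n x j \<theta> \<longrightarrow>
     0 \<le> binom_tail n j (center_prob s \<rho> n \<theta>) \<and> binom_tail n j (center_prob s \<rho> n \<theta>) \<le> 1 \<and>
     binom_tail n j (center_prob s \<rho> n \<theta>) \<le> K * exp (- M * s * x) \<and>
     1 - binom_tail n j (center_prob s \<rho> n \<theta>) \<le> K * exp (M * s * x)"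
proof -
  obtain K1 n1 where K1: "K1 > 0" "n1 \<ge> 1" "\<And>n \<theta>. n \<ge> n1 \<Longrightarrow> \<bar>\<theta>\<bar> \<le> 1 \<Longrightarrow>
     0 < center_prob s \<rho> n \<theta> \<and> center_prob s \<rho> n \<theta> < 1 \<and>
     (center_prob s \<rho> n \<theta> * exp (M * (s / sqrt n)) + (1 - center_prob s \<rho> n \<theta>) * exp (- (M * (s / sqrt n)))) ^ n \<le> K1"
    using center_prob_moment_bound[OF s, of \<rho> M] by blast
  obtain K2 n2 where K2: "K2 > 0" "n2 \<ge> 1" "\<And>n \<theta>. n \<ge> n2 \<Longrightarrow> \<bar>\<theta>\<bar> \<le> 1 \<Longrightarrow>
     0 < center_prob s \<rho> n \<theta> \<and> center_prob s \<rho> n \<theta> < 1 \<and>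
     (center_prob s \<rho> n \<theta> * exp (- M * (s / sqrt n)) + (1 - center_prob s \<rho> n \<theta>) * exp (- (- M * (s / sqrt n)))) ^ n \<le> K2"
    using center_prob_moment_bound[OF s, of \<rho> "- M"] by blast
  define K where "K = exp (M * s) * (1 + K1 + K2)"
  define n0 where "n0 = max n1 n2"
  have K: "K \<ge> 1" "exp (M * s) * K1 \<le> K" "exp (M * s) * K2 \<le> K"
  proof -
    have "1 * 1 \<le> exp (M * s) * (1 + K1 + K2)" using M s K1 K2 by (intro mult_mono) auto
    thus "K \<ge> 1" by (simp add: K_def)
  qed (use K1 K2 in \<open>auto simp: K_def\<close>)
  have "0 \<le> binom_tail n j (center_prob s \<rho> n \<theta>) \<and> binom_tail n j (center_prob s \<rho> n \<theta>) \<le> 1 \<and>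
     binom_tail n j (center_prob s \<rho> n \<theta>) \<le> K * exp (- M * s * x) \<and>
     1 - binom_tail n j (center_prob s \<rho> n \<theta>) \<le> K * exp (M * s * x)"
    if n: "n \<ge> n0" and c: "center_index n x j \<theta>" for n x j \<theta>
  proof -
    have nn: "real n \<ge> 1" using n K1 by (simp add: n0_def)
    consider "j = 0" | "j > n" | "1 \<le> j" "j \<le> n" by linarith
    thus ?thesis
    proof cases
      case 1
      hence "x \<le> - sqrt n" using c by (auto simp: center_index_def)
      hence x0: "x \<le> 0" using order_trans[of x "- sqrt n" 0] by simp
      hence "M * s * x \<le> 0" using M s by (intro mult_nonneg_nonpos) auto
      hence "1 \<le> exp (- M * s * x)" by simp
      hence "1 * 1 \<le> K * exp (- M * s * x)" using K by (intro mult_mono) auto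
      thus ?thesis using 1 K by (simp add: binom_tail_0)
    next
      case 2
      hence "sqrt n \<le> x" using c by (auto simp: center_index_def)
      hence x0: "x \<ge> 0" using order_trans[of 0 "sqrt n" x] by simp
      hence "1 \<le> exp (M * s * x)" using M s by simp
      hence "1 * 1 \<le> K * exp (M * s * x)" using K by (intro mult_mono) auto
      thus ?thesis using 2 K by (simp add: binom_tail_beyond)
    next
      case 3
      hence \<theta>: "\<bar>\<theta>\<bar> \<le> 1" using c by (simp add: center_index_def)
      define \<tau> where "\<tau> = s / sqrt n"
      have \<tau>: "\<tau> > 0" using s nn by (simp add: \<tau>_def)
      have "\<tau> * 1 \<le> \<tau> * sqrt n" using nn \<tau> by (intro mult_left_mono) auto
      hence \<tau>s: "\<tau> \<le> s" using nn by (simp add: \<tau>_def)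
      define t where "t = M * \<tau>"
      have t: "t > 0" using M \<tau> by (simp add: t_def)
      define p where "p = center_prob s \<rho> n \<theta>"
      have m1: "0 < p" "p < 1" "(p * exp t + (1 - p) * exp (- t)) ^ n \<le> K1"
        using K1(3)[OF _ \<theta>, of n] n unfolding n0_def p_def t_def \<tau>_def by auto
      have m2: "(p * exp (- t) + (1 - p) * exp t) ^ n \<le> K2"
        using K2(3)[OF _ \<theta>, of n] n unfolding n0_def p_def t_def \<tau>_def by auto
      have tx: "t * (2 * real j - 1 - real n) = M * s * x - t * \<theta>"
      proof -
        have "\<tau> * sqrt n = s" using nn by (simp add: \<tau>_def)
        hence "t * (sqrt n * x) = M * s * x" by (simp add: t_def)
        moreover have "2 * real j - 1 - real n = sqrt n * x - \<theta>" using c by (simp add: center_index_def)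
        ultimately show ?thesis by (simp add: right_diff_distrib)
      qed
      have "\<bar>t * \<theta>\<bar> \<le> M * s * 1" using t M \<tau>s \<theta> by (intro abs_mult_le_mult) (auto simp: t_def)
      hence tt: "t * \<theta> \<le> M * s" "- (t * \<theta>) \<le> M * s" by auto
      note ch = binom_tail_chernoff[of p t j n] m1 t 3
      have a: "binom_tail n j p \<le> K * exp (- M * s * x)"
      proof -
        have "binom_tail n j p \<le> exp (- t * (2 * real j - 1 - real n)) * (p * exp t + (1 - p) * exp (- t)) ^ n"
          using ch by simp
        also have "- t * (2 * real j - 1 - real n) = - M * s * x + t * \<theta>" using tx by simp
        also have "exp (- M * s * x + t * \<theta>) * (p * exp t + (1 - p) * exp (- t)) ^ n
            \<le> (exp (- M * s * x) * exp (M * s)) * K1"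
          using tt m1 unfolding exp_add by (intro mult_mono) auto
        also have "\<dots> = exp (- M * s * x) * (exp (M * s) * K1)" by simp
        also have "\<dots> \<le> exp (- M * s * x) * K" using K by (intro mult_left_mono) auto
        finally show ?thesis by (simp add: mult.commute)
      qed
      have b: "1 - binom_tail n j p \<le> K * exp (M * s * x)"
      proof -
        have "1 - binom_tail n j p \<le> exp (t * (2 * real j - 1 - real n)) * (p * exp (- t) + (1 - p) * exp t) ^ n"
          using ch by simp
        also have "t * (2 * real j - 1 - real n) = M * s * x + - (t * \<theta>)" using tx by simp
        also have "exp (M * s * x + - (t * \<theta>)) * (p * exp (- t) + (1 - p) * exp t) ^ n
            \<le> (exp (M * s * x) * exp (M * s)) * K2"
          using tt m1 m2 unfolding exp_add by (intro mult_mono) auto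
        also have "\<dots> = exp (M * s * x) * (exp (M * s) * K2)" by simp
        also have "\<dots> \<le> exp (M * s * x) * K" using K by (intro mult_left_mono) auto
        finally show ?thesis by (simp add: mult.commute)
      qed
      show ?thesis using a b ch unfolding p_def by auto
    qed
  qed
  moreover have "K > 0" using K by simp
  moreover have "n0 \<ge> 1" using K1 by (simp add: n0_def)
  ultimately show ?thesis by blast
qed

text \<open>With x a log-moneyness, e^(-b |x|) is a power of the strike near 0 and an inverse power
  near infinity. As b is arbitrary, this is decay faster than any power at both ends.\<close>

lemma density_decay:
  fixes a b :: real
  shows "\<exists>K>0. \<forall>x. (1 + \<bar>x\<bar>) ^ m * std_normal_density (a - x) \<le> K * exp (- b * \<bar>x\<bar>)"
proof -
  obtain K1 where K1: "K1 > 0" "\<And>w. (1 + \<bar>w\<bar>) ^ m * exp (\<bar>b\<bar> * w) * std_normal_density w \<le> K1"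
    using std_normal_poly_bounded[of m "\<bar>b\<bar>"] by blast
  obtain K2 where K2: "K2 > 0" "\<And>w. (1 + \<bar>w\<bar>) ^ m * exp (- \<bar>b\<bar> * w) * std_normal_density w \<le> K2"
    using std_normal_poly_bounded[of m "- \<bar>b\<bar>"] by blast
  define C where "C = (1 + \<bar>a\<bar>) ^ m"
  define K where "K = C * exp (\<bar>b\<bar> * \<bar>a\<bar>) * (K1 + K2)"
  have C: "C > 0" by (simp add: C_def add_pos_nonneg)
  have "(1 + \<bar>x\<bar>) ^ m * std_normal_density (a - x) \<le> K * exp (- b * \<bar>x\<bar>)" for x
  proof -
    define w where "w = a - x"
    define W where "W = 1 + \<bar>w\<bar>"
    have xW: "1 + \<bar>x\<bar> \<le> (1 + \<bar>a\<bar>) * W"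
    proof -
      have "\<bar>x\<bar> \<le> \<bar>a\<bar> + \<bar>w\<bar>" by (simp add: w_def)
      moreover have "0 \<le> \<bar>a\<bar> * \<bar>w\<bar>" by simp
      moreover have "(1 + \<bar>a\<bar>) * W = 1 + \<bar>a\<bar> + \<bar>w\<bar> + \<bar>a\<bar> * \<bar>w\<bar>" by (simp add: W_def algebra_simps)
      ultimately show ?thesis by linarith
    qed
    have "(1 + \<bar>x\<bar>) ^ m \<le> ((1 + \<bar>a\<bar>) * W) ^ m" using xW by (intro power_mono) auto
    hence P: "(1 + \<bar>x\<bar>) ^ m * std_normal_density w \<le> C * W ^ m * std_normal_density w"
      unfolding C_def power_mult_distrib by (intro mult_right_mono) auto
    have "exp (b * \<bar>x\<bar>) \<le> exp (\<bar>b\<bar> * \<bar>a\<bar>) * (exp (\<bar>b\<bar> * w) + exp (- \<bar>b\<bar> * w))"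
    proof -
      have "\<bar>x\<bar> \<le> \<bar>a\<bar> + \<bar>w\<bar>" by (simp add: w_def)
      hence "\<bar>b\<bar> * \<bar>x\<bar> \<le> \<bar>b\<bar> * (\<bar>a\<bar> + \<bar>w\<bar>)" by (intro mult_left_mono) auto
      moreover have "b * \<bar>x\<bar> \<le> \<bar>b\<bar> * \<bar>x\<bar>" by (intro mult_right_mono) auto
      ultimately have "exp (b * \<bar>x\<bar>) \<le> exp (\<bar>b\<bar> * \<bar>a\<bar> + \<bar>b\<bar> * \<bar>w\<bar>)" by (simp add: distrib_left)
      also have "\<dots> = exp (\<bar>b\<bar> * \<bar>a\<bar>) * exp (\<bar>b\<bar> * \<bar>w\<bar>)" by (rule exp_add)
      also have "exp (\<bar>b\<bar> * \<bar>w\<bar>) \<le> exp (\<bar>b\<bar> * w) + exp (- \<bar>b\<bar> * w)" by (cases "w \<ge> 0") auto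
      finally show ?thesis by simp
    qed
    hence "exp (b * \<bar>x\<bar>) * ((1 + \<bar>x\<bar>) ^ m * std_normal_density w)
        \<le> (exp (\<bar>b\<bar> * \<bar>a\<bar>) * (exp (\<bar>b\<bar> * w) + exp (- \<bar>b\<bar> * w))) * (C * W ^ m * std_normal_density w)"
      by (rule mult_mono[OF _ P]) auto
    also have "\<dots> = C * exp (\<bar>b\<bar> * \<bar>a\<bar>) *
        ((1 + \<bar>w\<bar>) ^ m * exp (\<bar>b\<bar> * w) * std_normal_density w + (1 + \<bar>w\<bar>) ^ m * exp (- \<bar>b\<bar> * w) * std_normal_density w)"
      by (simp add: W_def algebra_simps)
    also have "\<dots> \<le> C * exp (\<bar>b\<bar> * \<bar>a\<bar>) * (K1 + K2)"
      using C by (intro mult_left_mono add_mono K1 K2) auto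
    finally have "exp (- b * \<bar>x\<bar>) * (exp (b * \<bar>x\<bar>) * ((1 + \<bar>x\<bar>) ^ m * std_normal_density w)) \<le> exp (- b * \<bar>x\<bar>) * K"
      unfolding K_def by (intro mult_left_mono) auto
    moreover have "exp (- b * \<bar>x\<bar>) * (exp (b * \<bar>x\<bar>) * t) = t" for t
      unfolding mult.assoc[symmetric] exp_add[symmetric] by simp
    ultimately show ?thesis unfolding w_def by (metis mult.commute)
  qed
  moreover have "K > 0" using C K1 K2 by (simp add: K_def)
  ultimately show ?thesis by blast
qed

text \<open>The quadratic w^2 + 5 + 4 x w + 6 x^2 is the total derivative of
  \<open>edge_poly x (a - x)\<close> in x, both arguments moving.\<close>

definition tail_coeff_deriv :: "real \<Rightarrow> real \<Rightarrow> real \<Rightarrow> real" where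
  "tail_coeff_deriv s \<rho> x = (let a = \<rho> / s - s / 2; w = a - x in
     std_normal_density w *
       (w * ((\<rho> ^ 3 / (3 * s ^ 3) + \<rho> * s / 12) + a / 2 + x / 2 - edge_poly x w / 12)
        + (1 / 2 - (w\<^sup>2 + 5 + 4 * x * w + 6 * x\<^sup>2) / 12)))"

lemma tail_coeff_has_real_derivative:
  "(tail_coeff s \<rho> has_real_derivative tail_coeff_deriv s \<rho> x) (at x)"
proof -
  define a where "a = \<rho> / s - s / 2"
  define k where "k = (\<rho> ^ 3 / (3 * s ^ 3) + \<rho> * s / 12) + a / 2"
  have w: "((\<lambda>x. a - x) has_real_derivative -1) (at x)" by (auto intro!: derivative_eq_intros)
  have D1: "((\<lambda>x. std_normal_density (a - x)) has_real_derivative (- (a - x) * std_normal_density (a - x)) * (-1)) (at x)"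
    by (rule DERIV_chain2[OF has_real_derivative_std_normal_density w])
  have "((\<lambda>x. (a - x) ^ 3 + 3 * (a - x) + 4 * x * ((a - x)\<^sup>2 + 2) + 6 * x\<^sup>2 * (a - x) + 4 * x ^ 3)
       has_real_derivative (a - x)\<^sup>2 + 5 + 4 * x * (a - x) + 6 * x\<^sup>2) (at x)"
    by (rule derivative_eq_intros refl)+ (simp add: algebra_simps power2_eq_square)
  hence D2: "((\<lambda>x. edge_poly x (a - x)) has_real_derivative (a - x)\<^sup>2 + 5 + 4 * x * (a - x) + 6 * x\<^sup>2) (at x)"
    unfolding edge_poly_def .
  have D3: "((\<lambda>x. k + x / 2 - edge_poly x (a - x) / 12) has_real_derivative
      0 + 1 / 2 - ((a - x)\<^sup>2 + 5 + 4 * x * (a - x) + 6 * x\<^sup>2) / 12) (at x)"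
    by (intro DERIV_add DERIV_diff DERIV_const DERIV_cdivide DERIV_ident D2)
  have eq: "tail_coeff s \<rho> = (\<lambda>x. std_normal_density (a - x) * (k + x / 2 - edge_poly x (a - x) / 12))"
    unfolding tail_coeff_def Let_def a_def[symmetric] k_def ..
  have eq': "tail_coeff_deriv s \<rho> x = std_normal_density (a - x) *
       ((a - x) * (k + x / 2 - edge_poly x (a - x) / 12)
        + (1 / 2 - ((a - x)\<^sup>2 + 5 + 4 * x * (a - x) + 6 * x\<^sup>2) / 12))"
    unfolding tail_coeff_deriv_def Let_def a_def[symmetric] k_def ..
  have gen: "(- w * f * - 1) * p + q * f = f * (w * p + q)" for w f p q :: real
    by (simp add: algebra_simps)
  show ?thesis unfolding eq eq'
    by (rule DERIV_cong[OF DERIV_mult[OF D1 D3]], unfold gen) simp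
qed

lemma tail_coeff_decay:
  fixes s \<rho> b :: real
  shows "\<exists>K>0. \<forall>x. \<bar>tail_coeff s \<rho> x\<bar> \<le> K * exp (- b * \<bar>x\<bar>) \<and> \<bar>tail_coeff_deriv s \<rho> x\<bar> \<le> K * exp (- b * \<bar>x\<bar>)"
proof -
  define a where "a = \<rho> / s - s / 2"
  define k where "k = (\<rho> ^ 3 / (3 * s ^ 3) + \<rho> * s / 12) + a / 2"
  define A where "A = 1 + \<bar>a\<bar>"
  \<comment> \<open>The polynomial factor is bounded crudely by a multiple of (1 + |x|)^6;
    differentiating the density contributes one more factor w, hence the exponent 7.\<close>
  obtain K1 where K1: "K1 > 0" "\<And>x. (1 + \<bar>x\<bar>) ^ 7 * std_normal_density (a - x) \<le> K1 * exp (- b * \<bar>x\<bar>)"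
    using density_decay[of 7 a b] by blast
  define C where "C = \<bar>k\<bar> + 1 + 26 * A ^ 3"
  define C' where "C' = A * C + (1 + A\<^sup>2 + 5 + 4 * A + 6)"
  have A: "A \<ge> 1" by (simp add: A_def)
  have C: "C \<ge> 1" "C' \<ge> C"
  proof -
    have "0 \<le> A ^ 3" using A by simp
    thus 1: "C \<ge> 1" unfolding C_def by linarith
    have "1 * C \<le> A * C" using A 1 by (intro mult_right_mono) auto
    moreover have "0 \<le> A\<^sup>2" by simp
    ultimately show "C' \<ge> C" unfolding C'_def using A by linarith
  qed
  have "\<bar>tail_coeff s \<rho> x\<bar> \<le> C' * K1 * exp (- b * \<bar>x\<bar>) \<and> \<bar>tail_coeff_deriv s \<rho> x\<bar> \<le> C' * K1 * exp (- b * \<bar>x\<bar>)" for x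
  proof -
    define w where "w = a - x"
    define X where "X = 1 + \<bar>x\<bar>"
    have X: "X \<ge> 1" by (simp add: X_def)
    have XX: "X ^ i \<le> X ^ j" if "i \<le> j" for i j using X that by (intro power_increasing)
    have wX: "1 + \<bar>w\<bar> \<le> A * X"
    proof -
      have "\<bar>w\<bar> \<le> \<bar>a\<bar> + \<bar>x\<bar>" by (simp add: w_def)
      moreover have "0 \<le> \<bar>a\<bar> * \<bar>x\<bar>" by simp
      moreover have "A * X = 1 + \<bar>a\<bar> + \<bar>x\<bar> + \<bar>a\<bar> * \<bar>x\<bar>" by (simp add: A_def X_def algebra_simps)
      ultimately show ?thesis by linarith
    qed
    have xX: "\<bar>x\<bar> \<le> X" by (simp add: X_def)
    have t1: "\<bar>k\<bar> \<le> \<bar>k\<bar> * X ^ 6" using XX[of 0 6] mult_left_mono[of 1 "X ^ 6" "\<bar>k\<bar>"] by simp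
    have t2: "\<bar>x / 2\<bar> \<le> 1 * X ^ 6" using XX[of 1 6] xX by simp
    have t3: "\<bar>edge_poly x w / 12\<bar> \<le> 26 * A ^ 3 * X ^ 6"
    proof -
      have "\<bar>edge_poly x w\<bar> \<le> 26 * (X ^ 3 * (1 + \<bar>w\<bar>) ^ 3)" unfolding X_def by (rule abs_edge_poly_le)
      also have "\<dots> \<le> 26 * (X ^ 3 * (A * X) ^ 3)" using wX X by (intro mult_left_mono power_mono) auto
      also have "\<dots> = 26 * A ^ 3 * X ^ 6" by (simp add: power_mult_distrib flip: power_add)
      finally show ?thesis by simp
    qed
    have tri: "\<bar>u + v - y\<bar> \<le> b1 + b2 + b3" if "\<bar>u\<bar> \<le> b1" "\<bar>v\<bar> \<le> b2" "\<bar>y\<bar> \<le> b3" for u v y b1 b2 b3 :: real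
      using that by linarith
    define p where "p = k + x / 2 - edge_poly x w / 12"
    have p: "\<bar>p\<bar> \<le> C * X ^ 6"
      using tri[OF t1 t2 t3] by (simp add: C_def p_def algebra_simps)
    define p' where "p' = 1 / 2 - (w\<^sup>2 + 5 + 4 * x * w + 6 * x\<^sup>2) / 12"
    have p': "\<bar>p'\<bar> \<le> (1 + A\<^sup>2 + 5 + 4 * A + 6) * X\<^sup>2"
    proof -
      have w1: "\<bar>w\<bar> \<le> A * X" using wX by simp
      have "\<bar>w * w\<bar> \<le> (A * X) * (A * X)" "\<bar>x * w\<bar> \<le> X * (A * X)" "\<bar>x * x\<bar> \<le> X * X"
        by (rule abs_mult_le_mult[OF w1 w1] abs_mult_le_mult[OF xX w1] abs_mult_le_mult[OF xX xX])+
      hence 1: "\<bar>w\<^sup>2\<bar> \<le> A\<^sup>2 * X\<^sup>2" "\<bar>x * w\<bar> \<le> A * X\<^sup>2" "\<bar>x\<^sup>2\<bar> \<le> X\<^sup>2"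
        by (simp_all add: power2_eq_square mult_ac)
      have X2: "1 \<le> X\<^sup>2" using X by (simp add: one_le_power)
      have "\<bar>1 / 2 - (w2 + 5 + 4 * xw + 6 * x2) / 12\<bar> \<le> B + 5 * D + 4 * E + 6 * D + D"
        if "\<bar>w2\<bar> \<le> B" "\<bar>xw\<bar> \<le> E" "\<bar>x2\<bar> \<le> D" "1 \<le> D" for w2 xw x2 B D E :: real
        unfolding add_divide_distrib using that by (simp add: abs_le_iff)
      from this[OF 1 X2] show ?thesis by (simp add: p'_def algebra_simps)
    qed
    have q: "\<bar>w * p + p'\<bar> \<le> C' * X ^ 7"
    proof -
      have "\<bar>w * p\<bar> \<le> (A * X) * (C * X ^ 6)" using wX p by (intro abs_mult_le_mult) auto
      moreover have "(A * X) * (C * X ^ 6) = A * C * X ^ 7" by (simp add: eval_nat_numeral)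
      moreover have "(1 + A\<^sup>2 + 5 + 4 * A + 6) * X\<^sup>2 \<le> (1 + A\<^sup>2 + 5 + 4 * A + 6) * X ^ 7"
        using A by (intro mult_left_mono XX) auto
      moreover have "C' * X ^ 7 = A * C * X ^ 7 + (1 + A\<^sup>2 + 5 + 4 * A + 6) * X ^ 7" by (simp add: C'_def distrib_right)
      ultimately show ?thesis using p' abs_triangle_ineq[of "w * p" p'] by linarith
    qed
    have "\<bar>p\<bar> \<le> C' * X ^ 7"
    proof -
      have "C * X ^ 6 \<le> C' * X ^ 7" using C X by (intro mult_mono XX) auto
      thus ?thesis using p by linarith
    qed
    moreover have "\<bar>std_normal_density w * u\<bar> \<le> C' * K1 * exp (- b * \<bar>x\<bar>)" if "\<bar>u\<bar> \<le> C' * X ^ 7" for u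
    proof -
      have "\<bar>std_normal_density w * u\<bar> \<le> std_normal_density w * (C' * X ^ 7)"
        using that by (intro abs_mult_le_mult) auto
      also have "\<dots> = C' * (X ^ 7 * std_normal_density w)" by simp
      also have "\<dots> \<le> C' * (K1 * exp (- b * \<bar>x\<bar>))" unfolding X_def w_def using C by (intro mult_left_mono K1) auto
      finally show ?thesis by simp
    qed
    moreover have "tail_coeff s \<rho> x = std_normal_density w * p"
      unfolding tail_coeff_def Let_def a_def[symmetric] w_def[symmetric] p_def k_def ..
    moreover have "tail_coeff_deriv s \<rho> x = std_normal_density w * (w * p + p')"
      unfolding tail_coeff_deriv_def Let_def a_def[symmetric] w_def[symmetric] p_def k_def p'_def ..
    ultimately show ?thesis using q by metis
  qed
  moreover have "C' * K1 > 0" using C K1 by simp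
  ultimately show ?thesis by blast
qed

text \<open>No cancellation is involved: for x >= 0 the tree tail, \<open>Phi\<close> and the
  coefficient are each small, and for x < 0 the same holds for the two complements and the
  coefficient.\<close>

lemma center_remainder_decay:
  fixes s \<rho> M :: real
  assumes s: "s > 0" and M: "M > 0"
  shows "\<exists>K>0. \<exists>n0\<ge>1. \<forall>n x j \<theta>. n \<ge> n0 \<longrightarrow> center_index n x j \<theta> \<longrightarrow>
     \<bar>binom_tail n j (center_prob s \<rho> n \<theta>) - (Phi (\<rho> / s - s / 2 - x) + tail_coeff s \<rho> x / n)\<bar>
       \<le> K * exp (- M * s * \<bar>x\<bar>)"
proof -
  define a where "a = \<rho> / s - s / 2"
  define b where "b = M * s"
  have b: "b > 0" using s M by (simp add: b_def)
  obtain K1 n1 where K1: "K1 > 0" "n1 \<ge> 1" "\<And>n x j \<theta>. n \<ge> n1 \<Longrightarrow> center_index n x j \<theta> \<Longrightarrow>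
     0 \<le> binom_tail n j (center_prob s \<rho> n \<theta>) \<and> binom_tail n j (center_prob s \<rho> n \<theta>) \<le> 1 \<and>
     binom_tail n j (center_prob s \<rho> n \<theta>) \<le> K1 * exp (- M * s * x) \<and>
     1 - binom_tail n j (center_prob s \<rho> n \<theta>) \<le> K1 * exp (M * s * x)"
    using center_tail_chernoff[OF s M, of \<rho>] by blast
  obtain K2 where K2: "K2 > 0" "\<And>x. \<bar>tail_coeff s \<rho> x\<bar> \<le> K2 * exp (- b * \<bar>x\<bar>)"
    using tail_coeff_decay[of s \<rho> b] by blast
  define K3 where "K3 = exp (b\<^sup>2 / 2) / b * exp (b * \<bar>a\<bar>)"
  have K3: "K3 > 0" using b by (simp add: K3_def)
  define K where "K = K1 + K2 + K3"
  have "\<bar>binom_tail n j (center_prob s \<rho> n \<theta>) - (Phi (a - x) + tail_coeff s \<rho> x / n)\<bar> \<le> K * exp (- b * \<bar>x\<bar>)"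
    if n: "n \<ge> n1" and c: "center_index n x j \<theta>" for n x j \<theta>
  proof -
    have nn: "real n \<ge> 1" using n K1 by simp
    define t where "t = binom_tail n j (center_prob s \<rho> n \<theta>)"
    define e where "e = exp (- b * \<bar>x\<bar>)"
    have tc: "\<bar>tail_coeff s \<rho> x / n\<bar> \<le> K2 * e"
    proof -
      have "\<bar>tail_coeff s \<rho> x\<bar> / n \<le> \<bar>tail_coeff s \<rho> x\<bar>" using nn by (intro divide_le_self) auto
      thus ?thesis using K2(2)[of x] unfolding e_def by simp
    qed
    note T = K1(3)[OF n c, folded t_def]
    have Ke: "K * e = K1 * e + K2 * e + K3 * e" by (simp add: K_def algebra_simps)
    have pos: "0 \<le> K1 * e" "0 \<le> K3 * e" using K1 K3 by (simp_all add: e_def)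
    have "\<bar>t - (Phi (a - x) + tail_coeff s \<rho> x / n)\<bar> \<le> K * e"
    proof (cases "x \<ge> 0")
      case True
      have "t \<le> K1 * e" using T True by (simp add: e_def b_def)
      moreover have "Phi (a - x) \<le> K3 * e"
      proof -
        have "b * (a - x) = b * a + - b * \<bar>x\<bar>" using True by (simp add: algebra_simps)
        hence "Phi (a - x) \<le> exp (b\<^sup>2 / 2) / b * (exp (b * a) * e)"
          using Phi_le_exp[OF b, of "a - x"] unfolding e_def exp_add[symmetric] by simp
        also have "\<dots> \<le> exp (b\<^sup>2 / 2) / b * (exp (b * \<bar>a\<bar>) * e)"
          using b by (intro mult_left_mono mult_right_mono) (auto simp: e_def)
        finally show ?thesis by (simp add: K3_def)
      qed
      ultimately show ?thesis using tc T Phi_bounds[of "a - x"] pos unfolding Ke abs_le_iff by linarith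
    next
      case False
      have "1 - t \<le> K1 * e" using T False by (simp add: e_def b_def)
      moreover have "1 - Phi (a - x) \<le> K3 * e"
      proof -
        have "b * (- (a - x)) = b * (- a) + - b * \<bar>x\<bar>" using False by (simp add: algebra_simps)
        hence "1 - Phi (a - x) \<le> exp (b\<^sup>2 / 2) / b * (exp (b * (- a)) * e)"
          using Phi_le_exp[OF b, of "- (a - x)"] unfolding e_def exp_add[symmetric] one_minus_Phi by simp
        also have "\<dots> \<le> exp (b\<^sup>2 / 2) / b * (exp (b * \<bar>a\<bar>) * e)"
        proof -
          have "b * (- a) \<le> b * \<bar>a\<bar>" using b by (intro mult_left_mono) auto
          thus ?thesis using b by (intro mult_left_mono mult_right_mono) (auto simp: e_def)
        qed
        finally show ?thesis by (simp add: K3_def)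
      qed
      ultimately show ?thesis using tc T Phi_bounds[of "a - x"] pos unfolding Ke abs_le_iff by linarith
    qed
    thus ?thesis unfolding t_def e_def .
  qed
  moreover have "K > 0" using K1 K2 K3 by (simp add: K_def)
  ultimately show ?thesis using K1(2) unfolding a_def b_def by (intro exI[of _ K] conjI exI[of _ n1]) auto
qed

text \<open>The exponents \<open>35/24 < 3/2\<close> here and \<open>17/12\<close> below absorb the polynomial growth in \<open>x\<close> of the
  local error and still leave more than \<open>1 + \<alpha>\<close>.\<close>

lemma center_remainder_uniform:
  fixes s \<rho> :: real
  assumes s: "s > 0"
  shows "\<exists>K>0. \<exists>n0\<ge>1. \<forall>n x j \<theta>. n \<ge> n0 \<longrightarrow> center_index n x j \<theta> \<longrightarrow>
     \<bar>binom_tail n j (center_prob s \<rho> n \<theta>) - (Phi (\<rho> / s - s / 2 - x) + tail_coeff s \<rho> x / n)\<bar>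
       \<le> K * real n powr (- 35 / 24)"
proof -
  define R where "R = (\<lambda>n x j \<theta>. binom_tail n j (center_prob s \<rho> n \<theta>) - (Phi (\<rho> / s - s / 2 - x) + tail_coeff s \<rho> x / real n))"
  obtain K1 n1 where K1: "K1 > 0" "n1 \<ge> 1" "\<And>n x j \<theta>. n \<ge> n1 \<Longrightarrow> center_index n x j \<theta> \<Longrightarrow>
     \<bar>R n x j \<theta>\<bar> \<le> K1 * exp (- 1 * s * \<bar>x\<bar>)"
    using center_remainder_decay[OF s, of 1 \<rho>] unfolding R_def by (metis zero_less_one)
  obtain K2 n2 where K2: "K2 > 0" "n2 \<ge> 1" "\<And>n j x \<theta>. n \<ge> n2 \<Longrightarrow> 1 \<le> j \<Longrightarrow> j \<le> n \<Longrightarrow> \<bar>\<theta>\<bar> \<le> 1 \<Longrightarrow>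
     2 * real j - 1 - real n = sqrt n * x - \<theta> \<Longrightarrow> (2 + \<bar>x\<bar>) ^ 8 \<le> real n \<Longrightarrow>
     \<bar>R n x j \<theta>\<bar> \<le> K2 * (1 + \<bar>x\<bar>) ^ 8 * (1 / sqrt n) ^ 3"
    using binom_tail_local_expansion[OF s, of \<rho>] unfolding R_def by blast
  have "eventually (\<lambda>n. 256 * real n powr (1 / 24) \<le> real n) sequentially"
    "eventually (\<lambda>n. real n powr (1 / 192) < sqrt (real n)) sequentially"
    "eventually (\<lambda>n. exp (- s * (real n powr (1 / 192) - 1)) \<le> real n powr (- 35 / 24)) sequentially"
    using s by real_asymp+
  hence "eventually (\<lambda>n. 256 * real n powr (1 / 24) \<le> real n \<and> real n powr (1 / 192) < sqrt (real n)
    \<and> exp (- s * (real n powr (1 / 192) - 1)) \<le> real n powr (- 35 / 24)) sequentially"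
    by (intro eventually_conj)
  then obtain n3 where n3: "\<And>n. n \<ge> n3 \<Longrightarrow> 256 * real n powr (1 / 24) \<le> real n \<and> real n powr (1 / 192) < sqrt (real n)
    \<and> exp (- s * (real n powr (1 / 192) - 1)) \<le> real n powr (- 35 / 24)"
    unfolding eventually_sequentially by blast
  define n0 where "n0 = max n1 (max n2 n3)"
  define K where "K = K1 + K2"
  have "\<bar>R n x j \<theta>\<bar> \<le> K * real n powr (- 35 / 24)" if n: "n \<ge> n0" and c: "center_index n x j \<theta>" for n x j \<theta>
  \<comment> \<open>The eighth power of n^(1/192) is n^(1/24), so the local error n^(-3/2) degrades
    to n^(-35/24) at most; beyond the threshold the exponential decay beats every power of
    n.\<close>
  proof (cases "1 + \<bar>x\<bar> \<le> real n powr (1 / 192)")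
    case True
    have nn: "n \<ge> n1" "n \<ge> n2" "n \<ge> n3" "real n \<ge> 1" using n K1 by (auto simp: n0_def)
    have "(1 + \<bar>x\<bar>) ^ 8 \<le> (real n powr (1 / 192)) ^ 8" using True by (intro power_mono) auto
    also have "\<dots> = real n powr (1 / 24)" using nn by (simp add: powr_power)
    finally have x8: "(1 + \<bar>x\<bar>) ^ 8 \<le> real n powr (1 / 24)" .
    have "(2 + \<bar>x\<bar>) ^ 8 \<le> (2 * (1 + \<bar>x\<bar>)) ^ 8" by (intro power_mono) auto
    also have "\<dots> = 256 * (1 + \<bar>x\<bar>) ^ 8" by (simp only: power_mult_distrib) simp
    also have "\<dots> \<le> real n" using x8 n3[OF nn(3)] by linarith
    finally have x2: "(2 + \<bar>x\<bar>) ^ 8 \<le> real n" .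
    \<comment> \<open>Strict inequality excludes the two cases outside the tree, where
      \<open>center_index\<close> forces |x| >= sqrt n.\<close>
    have "\<bar>x\<bar> < sqrt n" using True n3[OF nn(3)] by linarith
    hence "1 \<le> j" "j \<le> n" using c unfolding center_index_def by (auto simp: not_less_eq_eq intro!: Suc_leI leI gr0I)
    hence "\<bar>R n x j \<theta>\<bar> \<le> K2 * (1 + \<bar>x\<bar>) ^ 8 * (1 / sqrt n) ^ 3"
      using c unfolding center_index_def by (intro K2(3) nn x2) auto
    also have "(1 / sqrt n) ^ 3 = real n powr (- 3 / 2)"
    proof -
      have "1 / sqrt n = real n powr (- 1 / 2)" using nn by (simp add: powr_half_sqrt[symmetric] powr_minus_divide)
      thus ?thesis using nn by (simp add: powr_power)
    qed
    also have "K2 * (1 + \<bar>x\<bar>) ^ 8 * real n powr (- 3 / 2) \<le> K2 * real n powr (1 / 24) * real n powr (- 3 / 2)"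
      using x8 K2 by (intro mult_right_mono mult_left_mono) auto
    also have "\<dots> = K2 * real n powr (- 35 / 24)" by (simp flip: powr_add)
    also have "\<dots> \<le> K * real n powr (- 35 / 24)" using K1 by (intro mult_right_mono) (auto simp: K_def)
    finally show ?thesis .
  next
    case False
    have nn: "n \<ge> n1" "n \<ge> n3" using n by (auto simp: n0_def)
    have "\<bar>R n x j \<theta>\<bar> \<le> K1 * exp (- 1 * s * \<bar>x\<bar>)" by (rule K1(3)[OF nn(1) c])
    also have "\<dots> \<le> K1 * exp (- s * (real n powr (1 / 192) - 1))"
    proof -
      have "s * (real n powr (1 / 192) - 1) \<le> s * \<bar>x\<bar>" using False s by (intro mult_left_mono) auto
      thus ?thesis using K1 by (intro mult_left_mono) auto
    qed
    also have "\<dots> \<le> K1 * real n powr (- 35 / 24)" using n3[OF nn(2)] K1 by (intro mult_left_mono) auto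
    also have "\<dots> \<le> K * real n powr (- 35 / 24)" using K2 by (intro mult_right_mono) (auto simp: K_def)
    finally show ?thesis .
  qed
  moreover have "K > 0" using K1 K2 by (simp add: K_def)
  moreover have "n0 \<ge> 1" using K1 by (simp add: n0_def)
  ultimately show ?thesis unfolding R_def by blast
qed

text \<open>The weight base A is 1 + a/S0 for strike a. If A^q <= n^(1/24), the uniform bound loses
  just this factor: 35/24 - 1/24 = 17/12. Otherwise the decay rate 40 q s gives the power -40 of A^q
  up to a constant; one power pays for the weight and the other 39 leave less than
  n^(-39/24).\<close>

lemma center_remainder_weighted:
  fixes s \<rho> :: real and q :: nat
  assumes s: "s > 0" and q: "q \<ge> 1"
  shows "\<exists>K>0. \<exists>n0\<ge>1. \<forall>n x j \<theta>. n \<ge> n0 \<longrightarrow> center_index n x j \<theta> \<longrightarrow>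
     (1 + exp (s * x)) ^ q *
     \<bar>binom_tail n j (center_prob s \<rho> n \<theta>) - (Phi (\<rho> / s - s / 2 - x) + tail_coeff s \<rho> x / n)\<bar>
       \<le> K * real n powr (- 17 / 12)"
proof -
  define R where "R = (\<lambda>n x j \<theta>. binom_tail n j (center_prob s \<rho> n \<theta>) - (Phi (\<rho> / s - s / 2 - x) + tail_coeff s \<rho> x / real n))"
  obtain K1 n1 where K1: "K1 > 0" "n1 \<ge> 1" "\<And>n x j \<theta>. n \<ge> n1 \<Longrightarrow> center_index n x j \<theta> \<Longrightarrow>
     \<bar>R n x j \<theta>\<bar> \<le> K1 * exp (- real (40 * q) * s * \<bar>x\<bar>)"
  proof -
    have "real (40 * q) > 0" using q by simp
    from center_remainder_decay[OF s this, of \<rho>] that show ?thesis unfolding R_def by blast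
  qed
  obtain K2 n2 where K2: "K2 > 0" "n2 \<ge> 1" "\<And>n x j \<theta>. n \<ge> n2 \<Longrightarrow> center_index n x j \<theta> \<Longrightarrow>
     \<bar>R n x j \<theta>\<bar> \<le> K2 * real n powr (- 35 / 24)"
    using center_remainder_uniform[OF s, of \<rho>] unfolding R_def by blast
  have "eventually (\<lambda>n. 2 ^ q \<le> real n powr (1 / 24)) sequentially" by real_asymp
  then obtain n3 where n3: "\<And>n. n \<ge> n3 \<Longrightarrow> 2 ^ q \<le> real n powr (1 / 24)"
    unfolding eventually_sequentially by blast
  define n0 where "n0 = max n1 (max n2 n3)"
  define K where "K = K1 * 2 ^ (40 * q) + K2"
  have "(1 + exp (s * x)) ^ q * \<bar>R n x j \<theta>\<bar> \<le> K * real n powr (- 17 / 12)"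
    if n: "n \<ge> n0" and c: "center_index n x j \<theta>" for n x j \<theta>
  proof -
    have nn: "n \<ge> n1" "n \<ge> n2" "n \<ge> n3" "real n \<ge> 1" using n K1 by (auto simp: n0_def)
    define A where "A = 1 + exp (s * x)"
    have A: "A \<ge> 1" by (simp add: A_def)
    show ?thesis
    proof (cases "A ^ q \<le> real n powr (1 / 24)")
      case True
      have "A ^ q * \<bar>R n x j \<theta>\<bar> \<le> real n powr (1 / 24) * (K2 * real n powr (- 35 / 24))"
        using True K2(3)[OF nn(2) c] A by (intro mult_mono) auto
      also have "\<dots> = K2 * real n powr (- 17 / 12)" by (simp flip: powr_add)
      also have "\<dots> \<le> K * real n powr (- 17 / 12)" using K1 by (intro mult_right_mono) (auto simp: K_def)
      finally show ?thesis by (simp add: A_def)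
    next
      case False
      \<comment> \<open>For x <= 0 the weight is at most 2^q, which for n >= \<open>n3\<close> lies
        below the threshold.\<close>
      have x0: "x > 0"
      proof (rule ccontr)
        assume "\<not> x > 0"
        hence "s * x \<le> 0" using s by (intro mult_nonneg_nonpos) auto
        hence "A \<le> 2" by (simp add: A_def)
        hence "A ^ q \<le> 2 ^ q" using A by (intro power_mono) auto
        thus False using False n3[OF nn(3)] by linarith
      qed
      have E: "A \<le> 2 * exp (s * x)" using s x0 by (simp add: A_def)
      have "exp (- real (40 * q) * s * \<bar>x\<bar>) = exp (real (40 * q) * (- (s * x)))" using x0 by (simp add: mult_ac)
      also have "\<dots> = exp (- (s * x)) ^ (40 * q)" by (rule exp_of_nat_mult)
      also have "\<dots> = (1 / exp (s * x)) ^ (40 * q)" by (simp add: exp_minus inverse_eq_divide)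
      also have "\<dots> \<le> (2 / A) ^ (40 * q)"
        using E A by (intro power_mono) (auto simp: field_simps)
      also have "\<dots> = 2 ^ (40 * q) * (1 / A ^ q) ^ 40"
        by (simp add: power_divide power_mult[symmetric] mult.commute)
      finally have X: "exp (- real (40 * q) * s * \<bar>x\<bar>) \<le> 2 ^ (40 * q) * (1 / A ^ q) ^ 40" .
      have Aq: "A ^ q \<ge> 1" using A by (rule one_le_power)
      have "A ^ q * \<bar>R n x j \<theta>\<bar> \<le> A ^ q * (K1 * (2 ^ (40 * q) * (1 / A ^ q) ^ 40))"
        using K1(3)[OF nn(1) c] X K1(1) A
        by (intro mult_left_mono order_trans[OF K1(3)[OF nn(1) c]]) auto
      also have "\<dots> = K1 * 2 ^ (40 * q) * (A ^ q * (1 / A ^ q) ^ 40)" by simp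
      also have "A ^ q * (1 / A ^ q) ^ 40 = (1 / A ^ q) ^ 39"
      proof -
        have "(1 / A ^ q) ^ 40 = (1 / A ^ q) ^ 39 * (1 / A ^ q)" using power_add[of "1 / A ^ q" 39 1] by (simp only: power_one_right) simp
        thus ?thesis using Aq by simp
      qed
      also have "(1 / A ^ q) ^ 39 \<le> (1 / real n powr (1 / 24)) ^ 39"
        using False Aq nn by (intro power_mono frac_le) auto
      also have "(1 / real n powr (1 / 24)) ^ 39 = real n powr (- 39 / 24)"
      proof -
        have "1 / real n powr (1 / 24) = real n powr (- 1 / 24)" by (simp add: powr_minus_divide)
        thus ?thesis using nn by (simp add: powr_power)
      qed
      also have "real n powr (- 39 / 24) \<le> real n powr (- 17 / 12)" using nn by (intro powr_mono) auto
      finally have "A ^ q * \<bar>R n x j \<theta>\<bar> \<le> K1 * 2 ^ (40 * q) * real n powr (- 17 / 12)"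
        using K1 by (simp add: mult_left_mono)
      also have "\<dots> \<le> K * real n powr (- 17 / 12)" using K2 by (intro mult_right_mono) (auto simp: K_def)
      finally show ?thesis by (simp add: A_def)
    qed
  qed
  moreover have "K > 0" using K1 K2 by (simp add: K_def add_pos_pos)
  moreover have "n0 \<ge> 1" using K1 by (simp add: n0_def)
  ultimately show ?thesis unfolding R_def by blast
qed

section \<open>Digital options in the center model\<close>

text \<open>Identifies the coefficient found here with the claimed one: k stands for r T / (\<sigma>
  sqrt T), s for \<sigma> sqrt T, w for \<open>d2\<close>, w + s for \<open>d1\<close>, and k - s/2
  - w for the standardized log-moneyness.\<close>

lemma tail_coeff_polynomial:
  fixes s k w :: real
  shows "(k ^ 3 / 3 + k * s\<^sup>2 / 12) + (k - s / 2) / 2 + (k - s / 2 - w) / 2 - edge_poly (k - s / 2 - w) w / 12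
     = ((w + s) ^ 3 + (w + s) * w\<^sup>2 + 2 * w - 4 * (w + s)) / 24 + ((2 - (w + s) * w - (w + s)\<^sup>2) * k / 6 + (w + s) * k\<^sup>2 / 2)"
  unfolding edge_poly_def by (simp add: field_simps eval_nat_numeral)

context
  fixes S0 \<sigma> r T :: real
  assumes pos: "S0 > 0" "\<sigma> > 0" "T > 0"
begin

lemma d2_eq: "a > 0 \<Longrightarrow> d2 S0 \<sigma> r T a = r * T / (\<sigma> * sqrt T) - \<sigma> * sqrt T / 2 - ln (a / S0) / (\<sigma> * sqrt T)"
proof -
  assume a: "a > 0"
  have "sqrt T * sqrt T = T" using pos by simp
  hence 1: "\<sigma>\<^sup>2 * T = (\<sigma> * sqrt T) * (\<sigma> * sqrt T)" by (simp add: power2_eq_square)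
  have 2: "ln (S0 / a) = - ln (a / S0)" using a pos by (simp add: ln_div)
  have s: "\<sigma> * sqrt T > 0" using pos by simp
  have "d1 S0 \<sigma> r T a = (- ln (a / S0) + r * T + (\<sigma> * sqrt T) * (\<sigma> * sqrt T) / 2) / (\<sigma> * sqrt T)"
    unfolding d1_def 2 1[symmetric] by (simp add: algebra_simps)
  also have "\<dots> = - ln (a / S0) / (\<sigma> * sqrt T) + r * T / (\<sigma> * sqrt T) + \<sigma> * sqrt T / 2"
    using s unfolding add_divide_distrib by simp
  finally show ?thesis unfolding d2_def by simp
qed

lemma digital_coeff_eq:
  assumes a: "a > 0"
  shows "digital_coeff S0 \<sigma> r T a = exp (- r * T) * tail_coeff (\<sigma> * sqrt T) (r * T) (ln (a / S0) / (\<sigma> * sqrt T))"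
proof -
  define s where "s = \<sigma> * sqrt T"
  define k where "k = r * T / s"
  define x where "x = ln (a / S0) / s"
  define w where "w = k - s / 2 - x"
  have s: "s > 0" using pos by (simp add: s_def)
  have TT: "sqrt T * sqrt T = T" using pos by simp
  have d2: "d2 S0 \<sigma> r T a = w" unfolding d2_eq[OF a] w_def x_def k_def s_def ..
  have d1: "d1 S0 \<sigma> r T a = w + s" using d2 unfolding d2_def s_def by simp
  have x: "x = k - s / 2 - w" by (simp add: w_def)
  have kr: "k = r * (sqrt T / \<sigma>)"
    unfolding k_def s_def using pos TT by (simp add: field_simps)
  have k1: "(2 - (w + s) * w - (w + s)\<^sup>2) * sqrt T / (6 * \<sigma>) * r = (2 - (w + s) * w - (w + s)\<^sup>2) * k / 6"
  proof -
    have "A * sqrt T / (6 * \<sigma>) * r = A * (r * (sqrt T / \<sigma>)) / 6" for A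
      using pos by (simp add: field_simps)
    thus ?thesis unfolding kr by metis
  qed
  have k2: "T * (w + s) * r\<^sup>2 / (2 * \<sigma>\<^sup>2) = (w + s) * k\<^sup>2 / 2"
  proof -
    have "k\<^sup>2 = r\<^sup>2 * T / \<sigma>\<^sup>2"
      unfolding kr using pos by (simp add: power_divide power_mult_distrib)
    moreover have "T * B * r\<^sup>2 / (2 * \<sigma>\<^sup>2) = B * (r\<^sup>2 * T / \<sigma>\<^sup>2) / 2" for B
      using pos by (simp add: field_simps)
    ultimately show ?thesis by metis
  qed
  have k3: "(r * T) ^ 3 / (3 * s ^ 3) = k ^ 3 / 3" "r * T * s / 12 = k * s\<^sup>2 / 12"
    using s by (simp_all add: k_def power_divide power2_eq_square)
  have kw: "k - s / 2 - x = w" by (simp add: w_def)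
  have "tail_coeff s (r * T) x = std_normal_density w *
      ((k ^ 3 / 3 + k * s\<^sup>2 / 12) + (k - s / 2) / 2 + (k - s / 2 - w) / 2 - edge_poly (k - s / 2 - w) w / 12)"
    unfolding tail_coeff_def Let_def k_def[symmetric] kw k3 x[symmetric] ..
  also have "\<dots> = std_normal_density w *
      (((w + s) ^ 3 + (w + s) * w\<^sup>2 + 2 * w - 4 * (w + s)) / 24 + ((2 - (w + s) * w - (w + s)\<^sup>2) * k / 6 + (w + s) * k\<^sup>2 / 2))"
    unfolding tail_coeff_polynomial ..
  finally show ?thesis
    unfolding digital_coeff_def Let_def d1 d2 k1 k2 s_def[symmetric] x_def[symmetric]
    by (simp add: std_normal_density_def distrib_left add_divide_distrib)
qed

lemma prob_stock_exceeds:
  assumes a: "a > 0"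
  shows "measure std_normal {z. bs_stock S0 \<sigma> r T z > a} = Phi (d2 S0 \<sigma> r T a)"
proof -
  define s where "s = \<sigma> * sqrt T"
  have s: "s > 0" using pos by (simp add: s_def)
  have TT: "sqrt T * sqrt T = T" using pos by simp
  have "bs_stock S0 \<sigma> r T z > a \<longleftrightarrow> - d2 S0 \<sigma> r T a < z" for z
  proof -
    have "bs_stock S0 \<sigma> r T z > a \<longleftrightarrow> a / S0 < exp ((r - \<sigma>\<^sup>2 / 2) * T + s * z)"
      using pos by (simp add: bs_stock_def s_def field_simps)
    also have "\<dots> \<longleftrightarrow> ln (a / S0) < (r - \<sigma>\<^sup>2 / 2) * T + s * z"
      using a pos by (metis divide_pos_pos exp_less_cancel_iff exp_ln)
    also have "(r - \<sigma>\<^sup>2 / 2) * T = s * (r * T / s - s / 2)"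
    proof -
      have "s * (r * T / s - s / 2) = r * T - s * s / 2" using s by (simp add: right_diff_distrib)
      moreover have "s * s = \<sigma>\<^sup>2 * T" using TT by (simp add: s_def power2_eq_square)
      ultimately show ?thesis by (simp add: algebra_simps)
    qed
    also have "ln (a / S0) = s * (ln (a / S0) / s)" using s by simp
    also have "s * (ln (a / S0) / s) < s * (r * T / s - s / 2) + s * z
        \<longleftrightarrow> ln (a / S0) / s < (r * T / s - s / 2) + z"
      using s unfolding distrib_left[symmetric] by (simp only: mult_less_cancel_left_pos)
    also have "\<dots> \<longleftrightarrow> - d2 S0 \<sigma> r T a < z" unfolding d2_eq[OF a] s_def[symmetric] by linarith
    finally show ?thesis .
  qed
  hence "{z. bs_stock S0 \<sigma> r T z > a} = {- d2 S0 \<sigma> r T a<..}" by auto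
  thus ?thesis by (simp add: Phi_def)
qed

text \<open>The tilt multiplies both the up and the down factor by the same e^\<delta>. In the
  risk-neutral probability this factor cancels except against the bond growth, which is how \<theta>
  enters \<open>center_prob\<close>; in the stock price it accumulates to e^(\<theta>
  \<tau>).\<close>

lemma center_digital_price_eq:
  assumes a: "a > 0" and n: "n \<ge> 1"
  shows "\<exists>j \<theta>. center_index n (ln (a / S0) / (\<sigma> * sqrt T)) j \<theta> \<and>
     center_digital_price S0 \<sigma> r T n a = exp (- r * T) * binom_tail n j (center_prob (\<sigma> * sqrt T) (r * T) n \<theta>)"
proof -
  define s where "s = \<sigma> * sqrt T"
  define x where "x = ln (a / S0) / s"
  define \<tau> where "\<tau> = \<sigma> * sqrt (T / n)"
  define j where "j = center_j0 S0 \<sigma> T n a"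
  define \<theta> where "\<theta> = sqrt n * x - (2 * real j - 1 - real n)"
  define \<gamma> where "\<gamma> = center_gamma S0 \<sigma> T n a"
  define l where "l = center_lambda S0 \<sigma> T n a"
  have s: "s > 0" using pos by (simp add: s_def)
  have nn: "real n \<ge> 1" "sqrt n > 0" "sqrt n * sqrt n = n" using n by auto
  have \<tau>s: "\<tau> = s / sqrt n" by (simp add: \<tau>_def s_def real_sqrt_divide)
  have \<tau>: "\<tau> > 0" using s nn by (simp add: \<tau>s)
  have lx: "ln (a / S0) = sqrt n * x * \<tau>" using s nn by (simp add: x_def \<tau>s)
  have \<gamma>: "\<gamma> = (sqrt n * x + n) / 2"
  proof -
    have "\<gamma> = (sqrt n * x * \<tau> + n * \<tau>) / (2 * \<tau>)"
      unfolding \<gamma>_def center_gamma_def lx \<tau>_def by (simp add: mult.assoc)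
    thus ?thesis using \<tau> unfolding distrib_right[symmetric] by simp
  qed
  have \<theta>\<gamma>: "\<theta> = 2 * \<gamma> - 2 * real j + 1" unfolding \<theta>_def \<gamma> by simp
  have j1: "real j \<ge> \<gamma>"
    unfolding j_def center_j0_def \<gamma>_def[symmetric] by (rule LeastI_ex) (rule real_arch_simple)
  \<comment> \<open>Together with \<open>j1\<close> this gives |\<theta>| <= 1. For j = 0 minimality
    says nothing about a predecessor, which is why \<open>center_index\<close> treats that case
    separately.\<close>
  have j2: "real j - 1 < \<gamma>" if "j \<ge> 1"
  proof -
    have "j - 1 < (LEAST m::nat. real m \<ge> \<gamma>)" using that unfolding j_def center_j0_def \<gamma>_def by simp
    hence "\<not> real (j - 1) \<ge> \<gamma>" by (rule not_less_Least)
    thus ?thesis using that by (simp add: of_nat_diff)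
  qed
  have ci: "center_index n x j \<theta>"
    unfolding center_index_def
  proof (intro conjI impI)
    show "2 * real j - 1 - real n = sqrt n * x - \<theta>" by (simp add: \<theta>_def)
    show "\<bar>\<theta>\<bar> \<le> 1" if "1 \<le> j" using j1 j2[OF that] unfolding \<theta>\<gamma> by simp
    show "x \<le> - sqrt n" if "j = 0"
    proof -
      have "sqrt n * x \<le> - real n" using j1 that \<gamma> by simp
      hence "sqrt n * x \<le> sqrt n * (- sqrt n)" using nn by simp
      thus ?thesis by (rule mult_left_le_imp_le) (rule nn)
    qed
    show "sqrt n \<le> x" if "n < j"
    proof -
      have "real n \<le> real j - 1" using that by simp
      hence "real n < \<gamma>" using j2 that by linarith
      hence "real n \<le> sqrt n * x" using \<gamma> by simp
      hence "sqrt n * sqrt n \<le> sqrt n * x" using nn by simp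
      thus ?thesis by (rule mult_left_le_imp_le) (rule nn)
    qed
  qed
  define \<delta> where "\<delta> = \<theta> * \<tau> / n"
  have ld: "l * \<sigma>\<^sup>2 * (T / n) = \<delta>"
  proof -
    have "l = (\<theta> * \<tau>) / (n * (\<sigma>\<^sup>2 * (T / n)))"
      unfolding l_def center_lambda_def j_def[symmetric] lx \<theta>_def
      by (simp add: \<tau>_def left_diff_distrib mult.assoc)
    moreover have "\<sigma>\<^sup>2 * (T / n) > 0" using pos nn by simp
    ultimately show ?thesis using nn pos unfolding \<delta>_def by (simp add: mult.assoc)
  qed
  have ud: "up \<sigma> T n l = exp (\<tau> + \<delta>)" "down \<sigma> T n l = exp (- \<tau> + \<delta>)"
    unfolding up_def down_def ld \<tau>_def by simp_all
  have rp: "rn_prob \<sigma> r T n l = center_prob s (r * T) n \<theta>"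
  proof -
    have "r * (T / n) = (r * T - \<theta> * \<tau>) / n + \<delta>" using nn by (simp add: \<delta>_def diff_divide_distrib)
    hence 1: "exp (r * (T / n)) = exp ((r * T - \<theta> * \<tau>) / n) * exp \<delta>" by (simp only: exp_add)
    have "rn_prob \<sigma> r T n l = (exp ((r * T - \<theta> * \<tau>) / n) * exp \<delta> - exp (- \<tau>) * exp \<delta>)
        / (exp \<tau> * exp \<delta> - exp (- \<tau>) * exp \<delta>)"
      unfolding rn_prob_def ud exp_add 1 ..
    also have "\<dots> = ((exp ((r * T - \<theta> * \<tau>) / n) - exp (- \<tau>)) * exp \<delta>) / ((exp \<tau> - exp (- \<tau>)) * exp \<delta>)"
      by (simp only: left_diff_distrib)
    also have "\<dots> = (exp ((r * T - \<theta> * \<tau>) / n) - exp (- \<tau>)) / (exp \<tau> - exp (- \<tau>))" by simp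
    finally show ?thesis unfolding center_prob_def Let_def \<tau>s[symmetric] .
  qed
  \<comment> \<open>On the log scale node i lies (2 i - 2 j + 1) \<tau> above the strike, an odd
    multiple of \<tau>, so the strict inequality for the payoff never meets a tie.\<close>
  have bs: "binom_stock S0 \<sigma> T n l i > a \<longleftrightarrow> j \<le> i" if "i \<le> n" for i
  proof -
    have "exp (\<tau> + \<delta>) ^ i * exp (- \<tau> + \<delta>) ^ (n - i) = exp (real i * (\<tau> + \<delta>) + real (n - i) * (- \<tau> + \<delta>))"
      unfolding exp_add exp_of_nat_mult by (simp add: exp_add exp_of_nat_mult[symmetric])
    also have "real i * (\<tau> + \<delta>) + real (n - i) * (- \<tau> + \<delta>) = (2 * real i - n) * \<tau> + n * \<delta>"
      using that by (simp add: of_nat_diff algebra_simps)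
    also have "n * \<delta> = \<theta> * \<tau>" using nn by (simp add: \<delta>_def)
    also have "(2 * real i - n) * \<tau> + \<theta> * \<tau> = ln (a / S0) + (2 * real i - 2 * real j + 1) * \<tau>"
      unfolding lx \<theta>_def by (simp add: algebra_simps)
    also have "exp \<dots> = a / S0 * exp ((2 * real i - 2 * real j + 1) * \<tau>)"
      using a pos by (simp add: exp_add)
    finally have "binom_stock S0 \<sigma> T n l i = a * exp ((2 * real i - 2 * real j + 1) * \<tau>)"
      unfolding binom_stock_def ud mult.assoc using pos by simp
    hence "binom_stock S0 \<sigma> T n l i > a \<longleftrightarrow> 1 < exp ((2 * real i - 2 * real j + 1) * \<tau>)"
      using a by (simp add: mult_less_cancel_left1)
    also have "\<dots> \<longleftrightarrow> 0 < (2 * real i - 2 * real j + 1)" using \<tau> by (simp add: zero_less_mult_iff)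
    also have "\<dots> \<longleftrightarrow> j \<le> i" by linarith
    finally show ?thesis .
  qed
  have "{i. i \<le> n \<and> binom_stock S0 \<sigma> T n l i > a} = {j..n}" using bs by auto
  hence "digital_price S0 \<sigma> r T n l a = exp (- r * T) * binom_tail n j (center_prob s (r * T) n \<theta>)"
    unfolding digital_price_def rp binom_tail_def by simp
  thus ?thesis using ci a unfolding center_digital_price_def l_def s_def x_def by auto
qed

end

section \<open>The trapezoidal rule on a growing interval\<close>

text \<open>The error as a function of the right end point vanishes at u and has derivative (z -
  u)/2 (F' x - F' z) with u < x < z, by the mean value theorem for F; a Lipschitz F' makes this
  O(h^2). Derivatives of F are asked for in the open interval only, since at strike 0 just
  continuity will be available.\<close>

lemma trapezoid_step:
  fixes F F' P :: "real \<Rightarrow> real"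
  assumes h: "0 < h" and B0: "0 \<le> B"
    and P: "\<And>t. u \<le> t \<Longrightarrow> t \<le> u + h \<Longrightarrow> (P has_real_derivative F t) (at t within {u..u + h})"
    and F: "\<And>t. u < t \<Longrightarrow> t < u + h \<Longrightarrow> (F has_real_derivative F' t) (at t)"
    and Fc: "continuous_on {u..u + h} F"
    and B: "\<And>x y. u < x \<Longrightarrow> x < y \<Longrightarrow> y < u + h \<Longrightarrow> \<bar>F' y - F' x\<bar> \<le> B * (y - x)"
  shows "\<bar>P (u + h) - P u - h / 2 * (F u + F (u + h))\<bar> \<le> B * h ^ 3"
proof -
  define e where "e = (\<lambda>t. P t - P u - (t - u) / 2 * (F u + F t))"
  have Pc: "continuous_on {u..u + h} P"
    using P by (intro DERIV_continuous_on) auto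
  have de: "(e has_real_derivative (F t - (1 / 2 * (F u + F t) + F' t * ((t - u) / 2)))) (at t)"
    if t: "u < t" "t < u + h" for t
  proof -
    have "(P has_real_derivative F t) (at t)"
      using P[of t] t at_within_interior[of t "{u..u + h}"] by simp
    moreover have "((\<lambda>t. (t - u) / 2) has_real_derivative 1 / 2) (at t)"
      by (auto intro!: derivative_eq_intros)
    moreover have "((\<lambda>t. F u + F t) has_real_derivative F' t) (at t)"
      by (rule DERIV_cong[OF DERIV_add[OF DERIV_const F[OF t]]]) simp
    ultimately show ?thesis unfolding e_def
      by (rule DERIV_cong[OF DERIV_diff[OF DERIV_diff[OF _ DERIV_const] DERIV_mult]]) simp
  qed
  have "\<exists>l z. u < z \<and> z < u + h \<and> (e has_real_derivative l) (at z) \<and> e (u + h) - e u = (u + h - u) * l"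
  proof (rule MVT)
    show "continuous_on {u..u + h} e" unfolding e_def by (intro continuous_intros Pc Fc) simp
    show "e differentiable (at x)" if "u < x" "x < u + h" for x
      using de[OF that] real_differentiable_def by blast
  qed (use h in simp)
  then obtain l z where z: "u < z" "z < u + h" "(e has_real_derivative l) (at z)" "e (u + h) - e u = h * l" by auto
  have l: "l = F z - (1 / 2 * (F u + F z) + F' z * ((z - u) / 2))"
    using DERIV_unique[OF z(3) de[OF z(1,2)]] .
  have "\<exists>l x. u < x \<and> x < z \<and> (F has_real_derivative l) (at x) \<and> F z - F u = (z - u) * l"
  proof (rule MVT)
    show "continuous_on {u..z} F" using Fc by (rule continuous_on_subset) (use z in auto)
    show "F differentiable (at x)" if "u < x" "x < z" for x
      using F[of x] that z real_differentiable_def by fastforce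
  qed (use z in simp)
  then obtain l' x where x: "u < x" "x < z" "(F has_real_derivative l') (at x)" "F z - F u = (z - u) * l'" by auto
  have "l' = F' x" using DERIV_unique[OF x(3) F] x z by simp
  hence "l = (z - u) / 2 * (F' x - F' z)"
    unfolding l using x(4) by (simp add: field_simps)
  hence "\<bar>l\<bar> = \<bar>(z - u) / 2\<bar> * \<bar>F' x - F' z\<bar>" by (simp only: abs_mult)
  also have "\<dots> = (z - u) / 2 * \<bar>F' z - F' x\<bar>" using z by (simp add: abs_minus_commute)
  also have "\<dots> \<le> h * (B * h)"
  proof (rule mult_mono)
    have "\<bar>F' z - F' x\<bar> \<le> B * (z - x)" using B x z by simp
    also have "\<dots> \<le> B * h" using B0 x z by (intro mult_left_mono) auto
    finally show "\<bar>F' z - F' x\<bar> \<le> B * h" .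
  qed (use z h in auto)
  finally have "\<bar>h * l\<bar> \<le> h * (h * (B * h))" using h by (simp add: abs_mult)
  moreover have "P (u + h) - P u - h / 2 * (F u + F (u + h)) = h * l"
    using z(4) by (simp add: e_def)
  ultimately show ?thesis by (simp add: power3_eq_cube mult_ac)
qed

text \<open>For the coefficient term, which enters with a factor 1/n: there the total error h^2 =
  n^(2\<alpha>-2) is small enough and one derivative suffices.\<close>

lemma trapezoid_step_lipschitz:
  fixes F F' P :: "real \<Rightarrow> real"
  assumes h: "0 < h"
    and P: "\<And>t. u \<le> t \<Longrightarrow> t \<le> u + h \<Longrightarrow> (P has_real_derivative F t) (at t within {u..u + h})"
    and F: "\<And>t. u < t \<Longrightarrow> t < u + h \<Longrightarrow> (F has_real_derivative F' t) (at t)"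
    and Fc: "continuous_on {u..u + h} F"
    and B: "\<And>x. u < x \<Longrightarrow> x < u + h \<Longrightarrow> \<bar>F' x\<bar> \<le> B"
  shows "\<bar>P (u + h) - P u - h / 2 * (F u + F (u + h))\<bar> \<le> B * h ^ 2"
proof -
  have lip: "\<bar>F y - F x\<bar> \<le> B * h" if "u \<le> x" "x < y" "y \<le> u + h" for x y
  proof -
    have "\<exists>l z. x < z \<and> z < y \<and> (F has_real_derivative l) (at z) \<and> F y - F x = (y - x) * l"
    proof (rule MVT)
      show "continuous_on {x..y} F" using Fc by (rule continuous_on_subset) (use that in auto)
      show "F differentiable (at z)" if "x < z" "z < y" for z
        using F[of z] that \<open>u \<le> x\<close> \<open>y \<le> u + h\<close> real_differentiable_def by fastforce
    qed (use that in simp)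
    then obtain l z where z: "x < z" "z < y" "(F has_real_derivative l) (at z)" "F y - F x = (y - x) * l" by auto
    have "l = F' z" using DERIV_unique[OF z(3) F] z that by simp
    hence "\<bar>F y - F x\<bar> \<le> h * B" unfolding z(4) using B[of z] that z by (intro abs_mult_le_mult) auto
    thus ?thesis by (simp add: mult.commute)
  qed
  have "\<exists>l z. u < z \<and> z < u + h \<and> (P has_real_derivative l) (at z) \<and> P (u + h) - P u = (u + h - u) * l"
  proof (rule MVT)
    show "continuous_on {u..u + h} P" using P by (intro DERIV_continuous_on) auto
    show "P differentiable (at x)" if "u < x" "x < u + h" for x
      using P[of x] that at_within_interior[of x "{u..u + h}"] real_differentiable_def by fastforce
  qed (use h in simp)
  then obtain l z where z: "u < z" "z < u + h" "(P has_real_derivative l) (at z)" "P (u + h) - P u = h * l" by auto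
  have "(P has_real_derivative F z) (at z)"
    using P[of z] z at_within_interior[of z "{u..u + h}"] by simp
  hence "l = F z" using DERIV_unique z(3) by blast
  hence "P (u + h) - P u - h / 2 * (F u + F (u + h)) = h / 2 * ((F z - F u) - (F (u + h) - F z))"
    unfolding z(4) by (simp add: field_simps)
  also have "\<bar>\<dots>\<bar> \<le> h / 2 * (B * h + B * h)"
  proof (rule abs_mult_le_mult)
    have "\<bar>F z - F u\<bar> \<le> B * h" "\<bar>F (u + h) - F z\<bar> \<le> B * h"
      using lip[of u z] lip[of z "u + h"] z by auto
    thus "\<bar>(F z - F u) - (F (u + h) - F z)\<bar> \<le> B * h + B * h"
      by (rule order_trans[OF abs_triangle_ineq4 add_mono])
  qed (use h in simp)
  finally show ?thesis by (simp add: power2_eq_square mult_ac)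
qed

lemma composite_trapezoid:
  fixes F P :: "real \<Rightarrow> real"
  assumes "\<And>k. k < n \<Longrightarrow> \<bar>P (real k * h + h) - P (real k * h) - h / 2 * (F (real k * h) + F (real k * h + h))\<bar> \<le> E"
  shows "\<bar>(h / 2 * (\<Sum>k<n. F (real k * h)) + h / 2 * (\<Sum>k<n. F ((real k + 1) * h))) - (P (real n * h) - P 0)\<bar> \<le> real n * E"
proof -
  have "P (real n * h) - P 0 = (\<Sum>k<n. P (real (Suc k) * h) - P (real k * h))"
    using sum_lessThan_telescope[of "\<lambda>k. P (real k * h)" n] by simp
  moreover have "real (Suc k) * h = real k * h + h" "(real k + 1) * h = real k * h + h" for k by (simp_all add: algebra_simps)
  ultimately have "(h / 2 * (\<Sum>k<n. F (real k * h)) + h / 2 * (\<Sum>k<n. F ((real k + 1) * h))) - (P (real n * h) - P 0)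
     = (\<Sum>k<n. - (P (real k * h + h) - P (real k * h) - h / 2 * (F (real k * h) + F (real k * h + h))))"
    by (simp add: sum_distrib_left sum.distrib sum_subtractf distrib_left sum_negf)
  also have "\<bar>\<dots>\<bar> \<le> (\<Sum>k<n. E)"
    by (rule order_trans[OF sum_abs sum_mono]) (metis abs_minus_cancel assms lessThan_iff)
  finally show ?thesis by simp
qed

lemma set_integrable_cauchy_decay:
  fixes F :: "real \<Rightarrow> real"
  assumes c: "continuous_on {0<..} F" and B: "\<And>a. a > 0 \<Longrightarrow> (1 + a)\<^sup>2 * \<bar>F a\<bar> \<le> K"
  shows "set_integrable lborel {0<..} F"
proof -
  have I: "integrable lborel (\<lambda>x. K * inverse (1 + x\<^sup>2))"
    using integrable_inverse_1_plus_square by (auto simp: set_integrable_def)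
  show ?thesis unfolding set_integrable_def
  proof (rule Bochner_Integration.integrable_bound[OF I])
    show "(\<lambda>x. indicat_real {0<..} x *\<^sub>R F x) \<in> borel_measurable lborel"
      using borel_measurable_continuous_on_indicator[OF _ c] by simp
    show "AE x in lborel. norm (indicat_real {0<..} x *\<^sub>R F x) \<le> norm (K * inverse (1 + x\<^sup>2))"
    proof (rule AE_I2)
      fix x :: real
      show "norm (indicat_real {0<..} x *\<^sub>R F x) \<le> norm (K * inverse (1 + x\<^sup>2))"
      proof (cases "x > 0")
        case True
        have p: "1 + x\<^sup>2 > 0" by (simp add: add_pos_nonneg)
        have "(1 + x\<^sup>2) * \<bar>F x\<bar> \<le> (1 + x)\<^sup>2 * \<bar>F x\<bar>" using True by (intro mult_right_mono) (auto simp: power2_sum)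
        hence "(1 + x\<^sup>2) * \<bar>F x\<bar> \<le> K" using B[OF True] by linarith
        hence "\<bar>F x\<bar> \<le> K * inverse (1 + x\<^sup>2)" using p by (simp add: field_simps)
        thus ?thesis using True by simp
      qed simp
    qed
  qed
qed

text \<open>Of the m + 2 powers of 1 + a, two give the integrable majorant 1/(1 + a^2) and m give
  the rate L^(-m). The constant is chosen before F, K and L, so it serves every n and both
  integrands.\<close>

lemma improper_integral_tail_bound:
  fixes m :: nat
  shows "\<exists>I\<ge>0. \<forall>(F :: real \<Rightarrow> real) K L. continuous_on {0..} F \<longrightarrow> (\<forall>a>0. (1 + a) ^ (m + 2) * \<bar>F a\<bar> \<le> K) \<longrightarrow> 0 < L \<longrightarrow>
     \<bar>integral {0..L} F - (LINT a:{0<..}|lborel. F a)\<bar> \<le> K * I / L ^ m"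
proof -
  define I where "I = (LINT x|lborel. inverse (1 + (x::real)\<^sup>2))"
  have II: "integrable lborel (\<lambda>x::real. inverse (1 + x\<^sup>2))"
    using integrable_inverse_1_plus_square by (auto simp: set_integrable_def)
  have I0: "I \<ge> 0" unfolding I_def by (intro integral_nonneg_AE) auto
  show ?thesis
  proof (intro exI[of _ I] conjI allI impI)
    fix F :: "real \<Rightarrow> real" and K L :: real
    assume c: "continuous_on {0..} F" and B: "\<forall>a>0. (1 + a) ^ (m + 2) * \<bar>F a\<bar> \<le> K" and L: "0 < L"
    have B2: "(1 + a)\<^sup>2 * \<bar>F a\<bar> \<le> K" if "a > 0" for a
    proof -
      have "(1 + a)\<^sup>2 * \<bar>F a\<bar> \<le> (1 + a) ^ (m + 2) * \<bar>F a\<bar>" using that by (intro mult_right_mono power_increasing) auto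
      thus ?thesis using B that by force
    qed
    have int: "set_integrable lborel {0<..} F"
      using B2 by (intro set_integrable_cauchy_decay[of F K] continuous_on_subset[OF c]) auto
    have i1: "set_integrable lborel {0<..L} F" and i2: "set_integrable lborel {L<..} F"
      using L by (auto intro!: set_integrable_subset[OF int])
    have "{0<..} = {0<..L} \<union> {L<..}" using L by auto
    hence "(LINT a:{0<..}|lborel. F a) = (LINT a:{0<..L}|lborel. F a) + (LINT a:{L<..}|lborel. F a)"
      using set_integral_Un[OF _ i1 i2] by fastforce
    also have "(LINT a:{0<..L}|lborel. F a) = integral {0<..L} F"
      by (rule set_borel_integral_eq_integral(2)[OF i1])
    also have "integral {0<..L} F = integral {0..L} F"
    proof (rule integral_spike_set)
      show "negligible {x \<in> {0<..L} - {0..L}. F x \<noteq> 0}" by (rule negligible_subset[OF negligible_empty]) auto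
      show "negligible {x \<in> {0..L} - {0<..L}. F x \<noteq> 0}" by (rule negligible_subset[OF negligible_sing[of 0]]) auto
    qed
    finally have "\<bar>integral {0..L} F - (LINT a:{0<..}|lborel. F a)\<bar> = \<bar>LINT a:{L<..}|lborel. F a\<bar>" by simp
    also have "\<dots> \<le> (\<integral>x. K / L ^ m * inverse (1 + x\<^sup>2) \<partial>lborel)"
      unfolding set_lebesgue_integral_def
    proof (rule order_trans[OF integral_abs_bound integral_mono])
      show "integrable lborel (\<lambda>x. \<bar>indicat_real {L<..} x *\<^sub>R F x\<bar>)"
        using i2 unfolding set_integrable_def by (rule integrable_abs)
      show "integrable lborel (\<lambda>x. K / L ^ m * inverse (1 + x\<^sup>2))" using II by simp
      fix x :: real
      have K0: "K \<ge> 0" using B2[of 1] by (smt (verit) mult_nonneg_nonneg zero_le_power2 abs_ge_zero)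
      show "\<bar>indicat_real {L<..} x *\<^sub>R F x\<bar> \<le> K / L ^ m * inverse (1 + x\<^sup>2)"
      proof (cases "x > L")
        case True
        have p: "1 + x\<^sup>2 > 0" "L ^ m > 0" using L by (auto simp: add_pos_nonneg)
        have "L ^ m * (1 + x\<^sup>2) \<le> (1 + x) ^ m * (1 + x)\<^sup>2"
          using True L by (intro mult_mono power_mono) (auto simp: power2_sum)
        hence "(L ^ m * (1 + x\<^sup>2)) * \<bar>F x\<bar> \<le> (1 + x) ^ (m + 2) * \<bar>F x\<bar>"
          unfolding power_add by (intro mult_right_mono) auto
        also have "\<dots> \<le> K" using B True L by force
        finally have "\<bar>F x\<bar> * (L ^ m * (1 + x\<^sup>2)) \<le> K" by (simp add: mult.commute)
        hence "\<bar>F x\<bar> \<le> K / (L ^ m * (1 + x\<^sup>2))" using p by (simp only: pos_le_divide_eq[OF mult_pos_pos[OF p(2) p(1)]])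
        also have "\<dots> = K / L ^ m * inverse (1 + x\<^sup>2)" by (simp add: divide_inverse)
        finally have "\<bar>F x\<bar> \<le> K / L ^ m * inverse (1 + x\<^sup>2)" .
        thus ?thesis using True by simp
      next
        case False
        have "0 \<le> K / L ^ m * inverse (1 + x\<^sup>2)" using K0 L by simp
        thus ?thesis using False by simp
      qed
    qed
    also have "\<dots> = K * I / L ^ m" by (simp add: I_def)
    finally show "\<bar>integral {0..L} F - (LINT a:{0<..}|lborel. F a)\<bar> \<le> K * I / L ^ m" .
  qed (rule I0)
qed

text \<open>Valid for every sufficiently large natural exponent, so that a single q can serve all
  three derivatives of the payoff.\<close>

lemma poly_bounded_imp_power_bound:
  assumes "poly_bounded \<phi>"
  shows "\<exists>C>0. \<exists>q0. \<forall>q\<ge>q0. \<forall>a\<ge>0. \<bar>\<phi> a\<bar> \<le> C * (1 + a) ^ q"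
proof -
  obtain c1 c2 p where c: "c1 > 0" "c2 > 0" "p > 0" "\<And>a. a \<ge> 0 \<Longrightarrow> \<bar>\<phi> a\<bar> \<le> c1 + c2 * a powr p"
    using assms unfolding poly_bounded_def by blast
  have "\<bar>\<phi> a\<bar> \<le> (c1 + c2) * (1 + a) ^ q" if q: "q \<ge> nat \<lceil>p\<rceil>" and a: "a \<ge> 0" for q a
  proof -
    have pq: "p \<le> real q" using q by linarith
    have "a powr p \<le> (1 + a) powr p" using a c by (intro powr_mono2) auto
    also have "\<dots> \<le> (1 + a) powr real q" using a pq by (intro powr_mono) auto
    also have "\<dots> = (1 + a) ^ q" using a by (simp add: powr_realpow)
    finally have 1: "a powr p \<le> (1 + a) ^ q" .
    have "1 \<le> (1 + a) ^ q" using a by (intro one_le_power) auto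
    hence "c1 * 1 + c2 * a powr p \<le> c1 * (1 + a) ^ q + c2 * (1 + a) ^ q"
      using 1 c by (intro add_mono mult_left_mono) auto
    thus ?thesis using c(4)[OF a] by (simp add: distrib_right)
  qed
  thus ?thesis using c by (intro exI[of _ "c1 + c2"] conjI exI[of _ "nat \<lceil>p\<rceil>"]) auto
qed

section \<open>The Black--Scholes digital price as a function of the strike\<close>

text \<open>The value at 0 is the limit of the other branch; \<open>d2\<close> there would be
  computed from the default value of the logarithm.\<close>

definition bs_digital :: "real \<Rightarrow> real \<Rightarrow> real \<Rightarrow> real \<Rightarrow> real \<Rightarrow> real" where
  "bs_digital S0 \<sigma> r T a = (if a = 0 then exp (- r * T) else exp (- r * T) * Phi (d2 S0 \<sigma> r T a))"

definition bs_digital_deriv :: "real \<Rightarrow> real \<Rightarrow> real \<Rightarrow> real \<Rightarrow> real \<Rightarrow> real" where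
  "bs_digital_deriv S0 \<sigma> r T a = - exp (- r * T) * std_normal_density (d2 S0 \<sigma> r T a) / (\<sigma> * sqrt T * a)"

definition bs_digital_deriv2 :: "real \<Rightarrow> real \<Rightarrow> real \<Rightarrow> real \<Rightarrow> real \<Rightarrow> real" where
  "bs_digital_deriv2 S0 \<sigma> r T a = exp (- r * T) * std_normal_density (d2 S0 \<sigma> r T a)
     * (1 - d2 S0 \<sigma> r T a / (\<sigma> * sqrt T)) / (\<sigma> * sqrt T * a\<^sup>2)"

text \<open>At \<open>a = 0\<close> the junk value \<open>ln (S0 / 0) = 0\<close> would make the coefficient discontinuous.\<close>

definition digital_coeff0 :: "real \<Rightarrow> real \<Rightarrow> real \<Rightarrow> real \<Rightarrow> real \<Rightarrow> real" where
  "digital_coeff0 S0 \<sigma> r T a = (if a = 0 then 0 else digital_coeff S0 \<sigma> r T a)"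

definition digital_coeff_deriv :: "real \<Rightarrow> real \<Rightarrow> real \<Rightarrow> real \<Rightarrow> real \<Rightarrow> real" where
  "digital_coeff_deriv S0 \<sigma> r T a = exp (- r * T)
     * tail_coeff_deriv (\<sigma> * sqrt T) (r * T) (ln (a / S0) / (\<sigma> * sqrt T)) / (\<sigma> * sqrt T * a)"

text \<open>The strike enters through its logarithm, so at 0 a linear bound on the increment takes
  the place of a derivative.\<close>

lemma continuous_on_atLeast_0I:
  fixes g g' :: "real \<Rightarrow> real"
  assumes "\<And>a. a > 0 \<Longrightarrow> (g has_real_derivative g' a) (at a)" and "\<And>a. a > 0 \<Longrightarrow> \<bar>g a - g 0\<bar> \<le> K * a"
  shows "continuous_on {0..} g"
proof -
  have "continuous (at a within {0..}) g" if "a \<ge> 0" for a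
  proof (cases "a = 0")
    case False
    hence "a > 0" using that by simp
    thus ?thesis by (rule continuous_at_imp_continuous_at_within[OF DERIV_isCont[OF assms(1)]])
  next
    case True
    have "((\<lambda>x. g x - g 0) \<longlongrightarrow> 0) (at 0 within {0..})"
    proof (rule Lim_null_comparison)
      show "\<forall>\<^sub>F x in at 0 within {0..}. norm (g x - g 0) \<le> K * x"
        unfolding eventually_at_filter
      proof (intro always_eventually allI impI)
        fix x :: real assume "x \<noteq> 0" "x \<in> {0..}"
        hence "x > 0" by simp
        thus "norm (g x - g 0) \<le> K * x" using assms(2) by simp
      qed
      show "((\<lambda>x. K * x) \<longlongrightarrow> 0) (at 0 within {0..})" by (rule tendsto_eq_intros refl | simp)+
    qed
    hence "(g \<longlongrightarrow> g 0) (at 0 within {0..})" by (simp add: LIM_zero_iff)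
    thus ?thesis using True by (simp add: continuous_within)
  qed
  thus ?thesis by (simp add: continuous_on_eq_continuous_within)
qed

context
  fixes S0 \<sigma> r T :: real
  assumes pos: "S0 > 0" "\<sigma> > 0" "T > 0"
begin

abbreviation "vol \<equiv> \<sigma> * sqrt T"
abbreviation "moneyness a \<equiv> ln (a / S0) / vol"

lemma vol_pos: "vol > 0" using pos by simp

lemma d2_moneyness: "a > 0 \<Longrightarrow> d2 S0 \<sigma> r T a = r * T / vol - vol / 2 - moneyness a"
  by (rule d2_eq[OF pos])

lemma strike_eq: "a > 0 \<Longrightarrow> a = S0 * exp (vol * moneyness a)"
  using vol_pos pos by simp

lemma moneyness_deriv: "a > 0 \<Longrightarrow> ((\<lambda>a. moneyness a) has_real_derivative 1 / (vol * a)) (at a)"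
proof -
  assume a: "a > 0"
  have "((\<lambda>a. ln (a / S0)) has_real_derivative 1 / a) (at a)"
    using a pos by (auto intro!: derivative_eq_intros)
  from DERIV_cdivide[OF this, of vol] show ?thesis by (simp add: mult.commute)
qed

lemma d2_deriv: "a > 0 \<Longrightarrow> (d2 S0 \<sigma> r T has_real_derivative - (1 / (vol * a))) (at a)"
proof -
  assume a: "a > 0"
  have "((\<lambda>a. r * T / vol - vol / 2 - moneyness a) has_real_derivative 0 - 1 / (vol * a)) (at a)"
    by (intro DERIV_diff DERIV_const moneyness_deriv[OF a])
  hence 1: "((\<lambda>a. r * T / vol - vol / 2 - moneyness a) has_real_derivative - (1 / (vol * a))) (at a)" by simp
  show ?thesis
    by (rule has_field_derivative_transform_within_open[OF 1, of "{0<..}"]) (use a d2_moneyness in auto)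
qed

lemma bs_digital_has_deriv: "a > 0 \<Longrightarrow> (bs_digital S0 \<sigma> r T has_real_derivative bs_digital_deriv S0 \<sigma> r T a) (at a)"
proof -
  assume a: "a > 0"
  have "((\<lambda>a. exp (- r * T) * Phi (d2 S0 \<sigma> r T a)) has_real_derivative
      exp (- r * T) * (std_normal_density (d2 S0 \<sigma> r T a) * - (1 / (vol * a)))) (at a)"
    by (intro DERIV_cmult DERIV_chain2[OF Phi_has_real_derivative d2_deriv[OF a]])
  hence 1: "((\<lambda>a. exp (- r * T) * Phi (d2 S0 \<sigma> r T a)) has_real_derivative bs_digital_deriv S0 \<sigma> r T a) (at a)"
    by (simp add: bs_digital_deriv_def)
  show ?thesis
    by (rule has_field_derivative_transform_within_open[OF 1, of "{0<..}"]) (use a in \<open>auto simp: bs_digital_def\<close>)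
qed

lemma bs_digital_has_deriv2: "a > 0 \<Longrightarrow> (bs_digital_deriv S0 \<sigma> r T has_real_derivative bs_digital_deriv2 S0 \<sigma> r T a) (at a)"
proof -
  assume a: "a > 0"
  define w where "w = d2 S0 \<sigma> r T a"
  have D: "((\<lambda>a. std_normal_density (d2 S0 \<sigma> r T a)) has_real_derivative
      - w * std_normal_density w * - (1 / (vol * a))) (at a)"
    unfolding w_def by (rule DERIV_chain2[OF has_real_derivative_std_normal_density d2_deriv[OF a]])
  have E: "((\<lambda>a. vol * a) has_real_derivative vol * 1) (at a)" by (intro DERIV_cmult DERIV_ident)
  have va: "vol * a \<noteq> 0" using a pos by simp
  have D': "((\<lambda>a. - exp (- r * T) * std_normal_density (d2 S0 \<sigma> r T a) / (vol * a)) has_real_derivative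
     (- exp (- r * T) * (- w * std_normal_density w * - (1 / (vol * a))) * (vol * a)
       - - exp (- r * T) * std_normal_density w * (vol * 1)) / (vol * a * (vol * a))) (at a)"
    unfolding w_def by (rule DERIV_divide[OF DERIV_cmult[OF D[unfolded w_def]] E va])
  have gen: "(- e * (- w * d * - (1 / (v * a))) * (v * a) - - e * d * (v * 1)) / (v * a * (v * a))
     = e * d * (1 - w / v) / (v * a\<^sup>2)" if "v \<noteq> 0" for e d v :: real
  proof -
    have "v * a \<noteq> 0" using that a by simp
    hence "- e * (- w * d * - (1 / (v * a))) * (v * a) - - e * d * (v * 1) = e * d * (v - w)"
      by (simp add: algebra_simps)
    moreover have "1 - w / v = (v - w) / v" using that by (simp add: diff_divide_distrib)
    ultimately show ?thesis by (simp add: power2_eq_square)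
  qed
  have "vol \<noteq> 0" using vol_pos by linarith
  thus ?thesis unfolding bs_digital_deriv_def[abs_def] bs_digital_deriv2_def w_def[symmetric]
    by (intro DERIV_cong[OF D'] gen)
qed

lemma digital_coeff0_has_deriv:
  "a > 0 \<Longrightarrow> (digital_coeff0 S0 \<sigma> r T has_real_derivative digital_coeff_deriv S0 \<sigma> r T a) (at a)"
proof -
  assume a: "a > 0"
  have "((\<lambda>a. exp (- r * T) * tail_coeff vol (r * T) (moneyness a)) has_real_derivative
      exp (- r * T) * (tail_coeff_deriv vol (r * T) (moneyness a) * (1 / (vol * a)))) (at a)"
    by (intro DERIV_cmult DERIV_chain2[OF tail_coeff_has_real_derivative moneyness_deriv[OF a]])
  hence 1: "((\<lambda>a. exp (- r * T) * tail_coeff vol (r * T) (moneyness a)) has_real_derivative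
      digital_coeff_deriv S0 \<sigma> r T a) (at a)"
    by (simp add: digital_coeff_deriv_def)
  show ?thesis
    by (rule has_field_derivative_transform_within_open[OF 1, of "{0<..}"])
       (use a digital_coeff_eq[OF pos] in \<open>auto simp: digital_coeff0_def\<close>)
qed

text \<open>As a = S0 e^(vol x), both a and 1/a are at most a constant times e^(vol |x|).\<close>

lemma weight_le_exp:
  assumes a: "a > 0"
  shows "(1 + a) ^ q * (1 / a) ^ i \<le> (1 + S0) ^ q * (1 / S0) ^ i * exp (real (q + i) * vol * \<bar>moneyness a\<bar>)"
proof -
  define x where "x = moneyness a"
  define E where "E = exp (vol * \<bar>x\<bar>)"
  have E1: "E \<ge> 1" using vol_pos by (simp add: E_def)
  have ax: "a = S0 * exp (vol * x)" unfolding x_def by (rule strike_eq[OF a])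
  have "vol * x \<le> vol * \<bar>x\<bar>" "- (vol * x) \<le> vol * \<bar>x\<bar>"
    using mult_left_mono[of x "\<bar>x\<bar>" vol] mult_left_mono[of "- x" "\<bar>x\<bar>" vol] vol_pos by auto
  hence e: "exp (vol * x) \<le> E" "exp (- (vol * x)) \<le> E" by (simp_all add: E_def)
  have "1 + a \<le> (1 + S0) * E"
  proof -
    have "S0 * exp (vol * x) \<le> S0 * E" using e pos by (intro mult_left_mono) auto
    thus ?thesis using E1 ax by (simp add: distrib_right)
  qed
  hence 1: "(1 + a) ^ q \<le> ((1 + S0) * E) ^ q" using a by (intro power_mono) auto
  have "1 / a = 1 / S0 * exp (- (vol * x))" unfolding ax by (simp add: exp_minus field_simps)
  also have "\<dots> \<le> 1 / S0 * E" using e pos by (intro mult_left_mono) auto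
  finally have 2: "(1 / a) ^ i \<le> (1 / S0 * E) ^ i" using a by (intro power_mono) auto
  have "(1 + a) ^ q * (1 / a) ^ i \<le> ((1 + S0) * E) ^ q * (1 / S0 * E) ^ i"
    using 1 2 a pos E1 by (intro mult_mono) auto
  also have "\<dots> = (1 + S0) ^ q * (1 / S0) ^ i * E ^ (q + i)" by (simp add: power_mult_distrib power_add power_divide)
  also have "E ^ (q + i) = exp (real (q + i) * (vol * \<bar>x\<bar>))" unfolding E_def exp_of_nat_mult ..
  finally show ?thesis by (simp add: x_def mult.assoc)
qed

text \<open>The powers of 1/a stem from differentiating the moneyness in the strike. Decay at rate
  (q + i) vol in the moneyness pays both for them near 0 and for the weight near infinity.\<close>

lemma weighted_bound:
  assumes "\<And>a. a > 0 \<Longrightarrow> \<bar>g a\<bar> \<le> K0 * (1 / a) ^ i * exp (- (real (q + i) * vol) * \<bar>moneyness a\<bar>)" and K0: "K0 \<ge> 0"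
  shows "\<exists>K\<ge>0. \<forall>a>0. (1 + a) ^ q * \<bar>g a\<bar> \<le> K"
proof -
  define K where "K = K0 * ((1 + S0) ^ q * (1 / S0) ^ i)"
  have "(1 + a) ^ q * \<bar>g a\<bar> \<le> K" if a: "a > 0" for a
  proof -
    define e where "e = real (q + i) * vol * \<bar>moneyness a\<bar>"
    have "(1 + a) ^ q * \<bar>g a\<bar> \<le> (1 + a) ^ q * (K0 * (1 / a) ^ i * exp (- e))"
      using assms(1)[OF a] a by (intro mult_left_mono) (auto simp: e_def)
    also have "\<dots> = K0 * ((1 + a) ^ q * (1 / a) ^ i) * exp (- e)" by simp
    also have "\<dots> \<le> K0 * ((1 + S0) ^ q * (1 / S0) ^ i * exp e) * exp (- e)"
      using weight_le_exp[OF a, of q i] K0 unfolding e_def by (intro mult_right_mono mult_left_mono) auto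
    also have "\<dots> = K" by (simp add: K_def exp_minus)
    finally show ?thesis .
  qed
  moreover have "K \<ge> 0" using K0 pos by (simp add: K_def)
  ultimately show ?thesis by blast
qed

lemma digital_coeff_weighted_bound: "\<exists>K\<ge>0. \<forall>a>0. (1 + a) ^ q * \<bar>digital_coeff0 S0 \<sigma> r T a\<bar> \<le> K"
proof -
  obtain K where K: "K > 0" "\<And>x. \<bar>tail_coeff vol (r * T) x\<bar> \<le> K * exp (- (real (q + 0) * vol) * \<bar>x\<bar>)"
    using tail_coeff_decay by blast
  show ?thesis
  proof (rule weighted_bound)
    show "exp (- r * T) * K \<ge> 0" using K by simp
    fix a :: real assume a: "a > 0"
    have "\<bar>digital_coeff0 S0 \<sigma> r T a\<bar> = exp (- r * T) * \<bar>tail_coeff vol (r * T) (moneyness a)\<bar>"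
      using a digital_coeff_eq[OF pos a] by (simp add: digital_coeff0_def abs_mult)
    also have "\<dots> \<le> exp (- r * T) * (K * exp (- (real (q + 0) * vol) * \<bar>moneyness a\<bar>))"
      by (intro mult_left_mono K) auto
    finally show "\<bar>digital_coeff0 S0 \<sigma> r T a\<bar> \<le> exp (- r * T) * K * (1 / a) ^ 0 * exp (- (real (q + 0) * vol) * \<bar>moneyness a\<bar>)"
      by simp
  qed
qed

lemma digital_coeff_deriv_weighted_bound: "\<exists>K\<ge>0. \<forall>a>0. (1 + a) ^ q * \<bar>digital_coeff_deriv S0 \<sigma> r T a\<bar> \<le> K"
proof -
  obtain K where K: "K > 0" "\<And>x. \<bar>tail_coeff_deriv vol (r * T) x\<bar> \<le> K * exp (- (real (q + 1) * vol) * \<bar>x\<bar>)"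
    using tail_coeff_decay by blast
  show ?thesis
  proof (rule weighted_bound)
    show "exp (- r * T) * K / vol \<ge> 0" using K vol_pos by simp
    fix a :: real assume a: "a > 0"
    have "\<bar>digital_coeff_deriv S0 \<sigma> r T a\<bar> = exp (- r * T) * \<bar>tail_coeff_deriv vol (r * T) (moneyness a)\<bar> / (vol * a)"
      using a pos by (simp add: digital_coeff_deriv_def abs_mult)
    also have "\<dots> \<le> exp (- r * T) * (K * exp (- (real (q + 1) * vol) * \<bar>moneyness a\<bar>)) / (vol * a)"
      using a vol_pos by (intro divide_right_mono mult_left_mono K) auto
    finally show "\<bar>digital_coeff_deriv S0 \<sigma> r T a\<bar> \<le> exp (- r * T) * K / vol * (1 / a) ^ 1 * exp (- (real (q + 1) * vol) * \<bar>moneyness a\<bar>)"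
      by simp
  qed
qed

lemma bs_digital_deriv_weighted_bound: "\<exists>K\<ge>0. \<forall>a>0. (1 + a) ^ q * \<bar>bs_digital_deriv S0 \<sigma> r T a\<bar> \<le> K"
proof -
  define e where "e = r * T / vol - vol / 2"
  obtain K where K: "K > 0" "\<And>x. (1 + \<bar>x\<bar>) ^ 0 * std_normal_density (e - x) \<le> K * exp (- (real (q + 1) * vol) * \<bar>x\<bar>)"
    using density_decay by blast
  show ?thesis
  proof (rule weighted_bound)
    show "exp (- r * T) * K / vol \<ge> 0" using K vol_pos by simp
    fix a :: real assume a: "a > 0"
    have "\<bar>bs_digital_deriv S0 \<sigma> r T a\<bar> = exp (- r * T) * std_normal_density (e - moneyness a) / (vol * a)"
      using a pos by (simp add: bs_digital_deriv_def abs_mult d2_moneyness e_def)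
    also have "\<dots> \<le> exp (- r * T) * (K * exp (- (real (q + 1) * vol) * \<bar>moneyness a\<bar>)) / (vol * a)"
      using a vol_pos K(2)[of "moneyness a"] by (intro divide_right_mono mult_left_mono) auto
    finally show "\<bar>bs_digital_deriv S0 \<sigma> r T a\<bar> \<le> exp (- r * T) * K / vol * (1 / a) ^ 1 * exp (- (real (q + 1) * vol) * \<bar>moneyness a\<bar>)"
      by simp
  qed
qed

lemma bs_digital_deriv2_weighted_bound: "\<exists>K\<ge>0. \<forall>a>0. (1 + a) ^ q * \<bar>bs_digital_deriv2 S0 \<sigma> r T a\<bar> \<le> K"
proof -
  define e where "e = r * T / vol - vol / 2"
  obtain K where K: "K > 0" "\<And>x. (1 + \<bar>x\<bar>) ^ 1 * std_normal_density (e - x) \<le> K * exp (- (real (q + 2) * vol) * \<bar>x\<bar>)"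
    using density_decay by blast
  define C where "C = 1 + (\<bar>e\<bar> + 1) / vol"
  have C: "C \<ge> 0" using vol_pos by (simp add: C_def)
  show ?thesis
  proof (rule weighted_bound)
    show "exp (- r * T) * C * K / vol \<ge> 0" using K vol_pos C by simp
    fix a :: real assume a: "a > 0"
    define x where "x = moneyness a"
    have c: "\<bar>1 - (e - x) / vol\<bar> \<le> C * (1 + \<bar>x\<bar>)"
    proof -
      have "\<bar>1 - (e - x) / vol\<bar> \<le> 1 + \<bar>e - x\<bar> / vol"
        using abs_triangle_ineq4[of 1 "(e - x) / vol"] vol_pos by (simp add: abs_divide)
      also have "\<dots> \<le> (1 + \<bar>x\<bar>) + ((\<bar>e\<bar> + 1) * (1 + \<bar>x\<bar>)) / vol"
      proof (intro add_mono divide_right_mono)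
        have "0 \<le> \<bar>e\<bar> * \<bar>x\<bar>" by simp
        moreover have "(\<bar>e\<bar> + 1) * (1 + \<bar>x\<bar>) = \<bar>e\<bar> + 1 + \<bar>e\<bar> * \<bar>x\<bar> + \<bar>x\<bar>" by (simp add: algebra_simps)
        ultimately show "\<bar>e - x\<bar> \<le> (\<bar>e\<bar> + 1) * (1 + \<bar>x\<bar>)" using abs_triangle_ineq4[of e x] by linarith
      qed (use vol_pos in auto)
      also have "\<dots> = C * (1 + \<bar>x\<bar>)" by (simp add: C_def distrib_right)
      finally show ?thesis .
    qed
    have "\<bar>bs_digital_deriv2 S0 \<sigma> r T a\<bar> = exp (- r * T) * std_normal_density (e - x) * \<bar>1 - (e - x) / vol\<bar> / (vol * a\<^sup>2)"
      using a pos unfolding bs_digital_deriv2_def d2_moneyness[OF a] e_def[symmetric] x_def[symmetric]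
      by (simp add: abs_mult)
    also have "\<dots> \<le> exp (- r * T) * std_normal_density (e - x) * (C * (1 + \<bar>x\<bar>)) / (vol * a\<^sup>2)"
      using a vol_pos c by (intro divide_right_mono mult_left_mono) auto
    also have "\<dots> = exp (- r * T) * C * ((1 + \<bar>x\<bar>) ^ 1 * std_normal_density (e - x)) / (vol * a\<^sup>2)" by simp
    also have "\<dots> \<le> exp (- r * T) * C * (K * exp (- (real (q + 2) * vol) * \<bar>x\<bar>)) / (vol * a\<^sup>2)"
      using a vol_pos C by (intro divide_right_mono mult_left_mono K) auto
    finally show "\<bar>bs_digital_deriv2 S0 \<sigma> r T a\<bar> \<le> exp (- r * T) * C * K / vol * (1 / a) ^ 2 * exp (- (real (q + 2) * vol) * \<bar>moneyness a\<bar>)"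
      by (simp add: x_def power_divide)
  qed
qed

text \<open>The price does not decay at strike 0, so the two-sided \<open>weighted_bound\<close>
  does not apply: the Gaussian tail is used for x >= 0, while for x < 0 the weight is bounded
  because a <= S0.\<close>

lemma bs_digital_weighted_bound:
  assumes q: "q \<ge> 1"
  shows "\<exists>K\<ge>0. \<forall>a>0. (1 + a) ^ q * \<bar>bs_digital S0 \<sigma> r T a\<bar> \<le> K"
proof -
  define e where "e = r * T / vol - vol / 2"
  define b where "b = real q * vol"
  have b: "b > 0" using q vol_pos by (simp add: b_def)
  define K1 where "K1 = exp (b\<^sup>2 / 2) / b * exp (b * e)"
  define K where "K = exp (- r * T) * ((1 + S0) ^ q * (1 + K1))"
  have K1: "K1 \<ge> 0" using b by (simp add: K1_def)
  have "(1 + a) ^ q * \<bar>bs_digital S0 \<sigma> r T a\<bar> \<le> K" if a: "a > 0" for a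
  proof -
    define x where "x = moneyness a"
    have "(1 + a) ^ q * Phi (e - x) \<le> (1 + S0) ^ q * (1 + K1)"
    proof (cases "x \<ge> 0")
      case True
      have "Phi (e - x) \<le> exp (b\<^sup>2 / 2) / b * exp (b * (e - x))" by (rule Phi_le_exp[OF b])
      also have "exp (b * (e - x)) = exp (b * e) * exp (- (b * x))" by (simp add: right_diff_distrib flip: exp_add)
      finally have "Phi (e - x) \<le> K1 * exp (- (b * x))" by (simp add: K1_def)
      hence "(1 + a) ^ q * Phi (e - x) \<le> ((1 + S0) ^ q * exp (b * x)) * (K1 * exp (- (b * x)))"
        using weight_le_exp[OF a, of q 0] True a pos Phi_bounds[of "e - x"] unfolding x_def[symmetric] b_def
        by (intro mult_mono) auto
      also have "\<dots> = (1 + S0) ^ q * K1" by (simp add: exp_minus)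
      also have "\<dots> \<le> (1 + S0) ^ q * (1 + K1)" using pos by (intro mult_left_mono) auto
      finally show ?thesis .
    next
      case False
      hence "vol * x \<le> 0" using vol_pos by (intro mult_nonneg_nonpos) auto
      hence "exp (vol * x) \<le> 1" by simp
      hence "a \<le> S0 * 1" using strike_eq[OF a] pos mult_left_mono[of "exp (vol * x)" 1 S0] unfolding x_def[symmetric] by linarith
      hence "(1 + a) ^ q \<le> (1 + S0) ^ q" using a by (intro power_mono) auto
      hence "(1 + a) ^ q * Phi (e - x) \<le> (1 + S0) ^ q * (1 + K1)"
        using Phi_bounds[of "e - x"] K1 pos a by (intro mult_mono) auto
      thus ?thesis .
    qed
    hence "exp (- r * T) * ((1 + a) ^ q * Phi (e - x)) \<le> K" unfolding K_def by (intro mult_left_mono) auto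
    moreover have "bs_digital S0 \<sigma> r T a = exp (- r * T) * Phi (e - x)"
      using a d2_moneyness[OF a] by (simp add: bs_digital_def e_def x_def)
    ultimately show ?thesis using Phi_bounds[of "e - x"] by (simp add: abs_mult mult_ac)
  qed
  moreover have "K \<ge> 0" using K1 pos by (simp add: K_def)
  ultimately show ?thesis by blast
qed

lemma exp_vol_moneyness: "a > 0 \<Longrightarrow> exp (vol * moneyness a) = a / S0"
  using pos vol_pos by simp

lemma bs_digital_continuous: "continuous_on {0..} (bs_digital S0 \<sigma> r T)"
proof -
  define e where "e = r * T / vol - vol / 2"
  define K where "K = exp (- r * T) * (exp (vol\<^sup>2 / 2) / vol * exp (- (vol * e))) / S0"
  have "\<bar>bs_digital S0 \<sigma> r T a - bs_digital S0 \<sigma> r T 0\<bar> \<le> K * a" if a: "a > 0" for a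
  proof -
    have "d2 S0 \<sigma> r T a = e - moneyness a" by (simp add: d2_moneyness[OF a] e_def)
    hence "bs_digital S0 \<sigma> r T 0 - bs_digital S0 \<sigma> r T a = exp (- r * T) * (1 - Phi (e - moneyness a))"
      using a by (simp add: bs_digital_def right_diff_distrib)
    also have "1 - Phi (e - moneyness a) = Phi (- (e - moneyness a))" by (rule one_minus_Phi)
    finally have eq: "bs_digital S0 \<sigma> r T 0 - bs_digital S0 \<sigma> r T a = exp (- r * T) * Phi (- (e - moneyness a))" .
    \<comment> \<open>The rate \<open>vol\<close> is the one for which the exponential equals a/S0
      up to a constant, giving a bound linear in the strike.\<close>
    have "Phi (- (e - moneyness a)) \<le> exp (vol\<^sup>2 / 2) / vol * exp (vol * - (e - moneyness a))"
      by (rule Phi_le_exp[OF vol_pos])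
    also have "vol * - (e - moneyness a) = - (vol * e) + vol * moneyness a" by (simp add: algebra_simps)
    also have "exp \<dots> = exp (- (vol * e)) * (a / S0)" unfolding exp_add exp_vol_moneyness[OF a] ..
    finally have "exp (- r * T) * Phi (- (e - moneyness a)) \<le> exp (- r * T) * (exp (vol\<^sup>2 / 2) / vol * (exp (- (vol * e)) * (a / S0)))"
      by (intro mult_left_mono) auto
    hence "exp (- r * T) * Phi (- (e - moneyness a)) \<le> K * a" by (simp add: K_def)
    moreover have "0 \<le> exp (- r * T) * Phi (- (e - moneyness a))" using Phi_bounds by simp
    ultimately show ?thesis using eq by linarith
  qed
  from continuous_on_atLeast_0I[OF bs_digital_has_deriv this] show ?thesis by simp
qed

lemma digital_coeff0_continuous: "continuous_on {0..} (digital_coeff0 S0 \<sigma> r T)"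
proof -
  obtain K where K: "K > 0" "\<And>x. \<bar>tail_coeff vol (r * T) x\<bar> \<le> K * exp (- vol * \<bar>x\<bar>)"
    using tail_coeff_decay by blast
  have "\<bar>digital_coeff0 S0 \<sigma> r T a - digital_coeff0 S0 \<sigma> r T 0\<bar> \<le> (exp (- r * T) * K / S0) * a" if a: "a > 0" for a
  proof -
    have "\<bar>digital_coeff0 S0 \<sigma> r T a - digital_coeff0 S0 \<sigma> r T 0\<bar> = exp (- r * T) * \<bar>tail_coeff vol (r * T) (moneyness a)\<bar>"
      using a digital_coeff_eq[OF pos a] by (simp add: digital_coeff0_def abs_mult)
    also have "\<dots> \<le> exp (- r * T) * (K * exp (- vol * \<bar>moneyness a\<bar>))" by (intro mult_left_mono K) auto
    also have "\<dots> \<le> exp (- r * T) * (K * exp (vol * moneyness a))"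
    proof -
      have "vol * (- \<bar>moneyness a\<bar>) \<le> vol * moneyness a" using vol_pos abs_ge_minus_self[of "moneyness a"]
        by (intro mult_left_mono) linarith+
      thus ?thesis using K by (intro mult_left_mono) auto
    qed
    also have "\<dots> = (exp (- r * T) * K / S0) * a" unfolding exp_vol_moneyness[OF a] by simp
    finally show ?thesis .
  qed
  from continuous_on_atLeast_0I[OF digital_coeff0_has_deriv this] show ?thesis by simp
qed

lemma center_digital_price_expansion:
  assumes q: "q \<ge> 1"
  shows "\<exists>K>0. \<exists>n0\<ge>1. \<forall>n a. n \<ge> n0 \<longrightarrow> 0 \<le> a \<longrightarrow>
     (1 + a) ^ q * \<bar>center_digital_price S0 \<sigma> r T n a - (bs_digital S0 \<sigma> r T a + digital_coeff0 S0 \<sigma> r T a / n)\<bar>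
       \<le> K * real n powr (- 17 / 12)"
proof -
  obtain K n0 where K: "K > 0" "n0 \<ge> 1" "\<And>n x j \<theta>. n \<ge> n0 \<Longrightarrow> center_index n x j \<theta> \<Longrightarrow>
     (1 + exp (vol * x)) ^ q *
     \<bar>binom_tail n j (center_prob vol (r * T) n \<theta>) - (Phi (r * T / vol - vol / 2 - x) + tail_coeff vol (r * T) x / n)\<bar>
       \<le> K * real n powr (- 17 / 12)"
    using center_remainder_weighted[OF vol_pos q, of "r * T"] by blast
  define K' where "K' = exp (- r * T) * (1 + S0) ^ q * K"
  have K': "K' > 0" using K pos by (simp add: K'_def add_pos_pos)
  have "(1 + a) ^ q * \<bar>center_digital_price S0 \<sigma> r T n a - (bs_digital S0 \<sigma> r T a + digital_coeff0 S0 \<sigma> r T a / n)\<bar>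
       \<le> K' * real n powr (- 17 / 12)" if n: "n \<ge> n0" and a: "a \<ge> 0" for n a
  \<comment> \<open>At strike 0 both prices are e^(-r T) by convention and the coefficient is 0, so
    the error vanishes.\<close>
  proof (cases "a = 0")
    case True
    thus ?thesis using K' by (simp add: center_digital_price_def bs_digital_def digital_coeff0_def)
  next
    case False
    hence a0: "a > 0" using a by simp
    define x where "x = moneyness a"
    obtain j \<theta> where j: "center_index n x j \<theta>"
      "center_digital_price S0 \<sigma> r T n a = exp (- r * T) * binom_tail n j (center_prob vol (r * T) n \<theta>)"
    proof -
      have "n \<ge> 1" using n K(2) by simp
      from center_digital_price_eq[OF pos a0 this, of r] that show ?thesis unfolding x_def by blast
    qed
    define R where "R = binom_tail n j (center_prob vol (r * T) n \<theta>) - (Phi (r * T / vol - vol / 2 - x) + tail_coeff vol (r * T) x / n)"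
    have "center_digital_price S0 \<sigma> r T n a - (bs_digital S0 \<sigma> r T a + digital_coeff0 S0 \<sigma> r T a / n) = exp (- r * T) * R"
      using a0 unfolding j(2) R_def bs_digital_def digital_coeff0_def digital_coeff_eq[OF pos a0] d2_moneyness[OF a0] x_def
      by (simp add: algebra_simps)
    hence eq: "\<bar>center_digital_price S0 \<sigma> r T n a - (bs_digital S0 \<sigma> r T a + digital_coeff0 S0 \<sigma> r T a / n)\<bar> = exp (- r * T) * \<bar>R\<bar>"
      by (simp add: abs_mult)
    have ex: "exp (vol * x) = a / S0" unfolding x_def by (rule exp_vol_moneyness[OF a0])
    \<comment> \<open>Passes from the weight in a, which the payoff requires, to the weight in a/S0
      = e^(vol x) of the tree estimate.\<close>
    have "1 + a \<le> (1 + S0) * (1 + a / S0)" using pos a0 by (simp add: field_simps)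
    hence "(1 + a) ^ q \<le> ((1 + S0) * (1 + a / S0)) ^ q" using a0 by (intro power_mono) auto
    hence "(1 + a) ^ q * (exp (- r * T) * \<bar>R\<bar>) \<le> ((1 + S0) * (1 + a / S0)) ^ q * (exp (- r * T) * \<bar>R\<bar>)"
      by (intro mult_right_mono) auto
    also have "\<dots> = exp (- r * T) * (1 + S0) ^ q * ((1 + exp (vol * x)) ^ q * \<bar>R\<bar>)"
      unfolding ex power_mult_distrib by simp
    also have "\<dots> \<le> exp (- r * T) * (1 + S0) ^ q * (K * real n powr (- 17 / 12))"
      unfolding R_def using pos by (intro mult_left_mono K(3)[OF n j(1)]) auto
    finally show ?thesis unfolding eq by (simp add: K'_def mult.assoc)
  qed
  thus ?thesis using K' K(2) by blast
qed

end

section \<open>Payoffs as superpositions of digital options\<close>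

lemma integral_std_normal:
  fixes f :: "real \<Rightarrow> real"
  assumes "f \<in> borel_measurable borel"
  shows "integrable std_normal f \<longleftrightarrow> integrable lborel (\<lambda>z. std_normal_density z * f z)"
    and "(LINT z|std_normal. f z) = (LINT z|lborel. std_normal_density z * f z)"
  unfolding std_normal_def using assms
  by (simp_all add: integrable_density integral_density)

lemma measure_std_normal_eq:
  assumes "A \<in> sets borel"
  shows "integrable lborel (\<lambda>z. std_normal_density z * indicat_real A z)"
    and "(LINT z|lborel. std_normal_density z * indicat_real A z) = measure std_normal A"
proof -
  have A: "A \<in> sets std_normal" using assms by (simp add: std_normal_def)
  have "integrable std_normal (indicat_real A)"
    using A by (intro integrable_real_indicator) (auto simp: std_normal.emeasure_eq_measure)
  thus "integrable lborel (\<lambda>z. std_normal_density z * indicat_real A z)"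
    using integral_std_normal(1)[of "indicat_real A"] assms by simp
  have "(LINT z|std_normal. indicat_real A z) = measure std_normal A"
    using A by (simp add: std_normal_def)
  thus "(LINT z|lborel. std_normal_density z * indicat_real A z) = measure std_normal A"
    using integral_std_normal(2)[of "indicat_real A"] assms by simp
qed

lemma set_integral_deriv:
  fixes f f' :: "real \<Rightarrow> real"
  assumes c: "c > 0" and f: "\<And>x. x \<ge> 0 \<Longrightarrow> (f has_real_derivative f' x) (at x within {0..})"
    and cont: "continuous_on {0..} f'"
  shows "(LINT a:{0<..<c}|lborel. f' a) = f c - f 0"
proof -
  have "set_integrable lborel {0..c} f'"
    by (intro borel_integrable_atLeastAtMost' continuous_on_subset[OF cont]) auto
  hence i: "set_integrable lborel {0<..<c} f'" by (rule set_integrable_subset) auto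
  have "(LINT a:{0<..<c}|lborel. f' a) = integral {0<..<c} f'"
    by (rule set_borel_integral_eq_integral(2)[OF i])
  also have "\<dots> = integral {0..c} f'" 
  proof (rule integral_spike_set)
    show "negligible {x \<in> {0<..<c} - {0..c}. f' x \<noteq> 0}" by (rule negligible_subset[OF negligible_empty]) auto
    show "negligible {x \<in> {0..c} - {0<..<c}. f' x \<noteq> 0}"
      by (rule negligible_subset[OF negligible_finite[of "{0, c}"]]) auto
  qed
  also have "(f' has_integral (f c - f 0)) {0..c}"
  proof (rule fundamental_theorem_of_calculus)
    show "(f has_vector_derivative f' x) (at x within {0..c})" if "x \<in> {0..c}" for x
      using f[of x] that has_field_derivative_subset[of f "f' x" x "{0..}" "{0..c}"]
      unfolding has_real_derivative_iff_has_vector_derivative[symmetric] by auto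
  qed (use c in simp)
  hence "integral {0..c} f' = f c - f 0" by (rule integral_unique)
  finally show ?thesis .
qed

text \<open>\<open>f(S) - f(0)\<close> is the integral of \<open>f'(a)\<close> over \<open>0 < a < S\<close>; exchanging it with the expectation
  turns the payoff into a superposition of digital options.\<close>

lemma bs_price_as_digitals:
  fixes f f' :: "real \<Rightarrow> real"
  assumes pos: "S0 > 0" "\<sigma> > 0" "T > 0"
    and f: "\<And>x. x \<ge> 0 \<Longrightarrow> (f has_real_derivative f' x) (at x within {0..})"
    and cont: "continuous_on {0..} f'"
    and int: "set_integrable lborel {0<..} (\<lambda>a. f' a * bs_digital S0 \<sigma> r T a)"
  shows "integrable std_normal (\<lambda>z. f (bs_stock S0 \<sigma> r T z))"
    and "bs_price S0 \<sigma> r T f = exp (- r * T) * f 0 + (LINT a:{0<..}|lborel. f' a * bs_digital S0 \<sigma> r T a)"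
proof -
  define S where "S = bs_stock S0 \<sigma> r T"
  have S0: "S z > 0" for z using pos by (simp add: S_def bs_stock_def)
  have Sc: "continuous_on UNIV S" unfolding S_def bs_stock_def[abs_def] by (intro continuous_intros)
  have Sm [measurable]: "S \<in> borel_measurable borel" using Sc by (rule borel_measurable_continuous_onI)
  define g where "g = (\<lambda>a. indicat_real {0<..} a * f' a)"
  have gm [measurable]: "g \<in> borel_measurable borel"
  proof -
    have "(\<lambda>a. indicat_real {0<..} a *\<^sub>R f' a) \<in> borel_measurable borel"
      by (intro borel_measurable_continuous_on_indicator continuous_on_subset[OF cont]) auto
    thus ?thesis by (simp add: g_def)
  qed
  define k where "k = (\<lambda>a z. g a * (std_normal_density z * (if a < S z then 1 else 0)))"
  have km: "case_prod k \<in> borel_measurable (lborel \<Otimes>\<^sub>M lborel)"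
    unfolding k_def by measurable
  have ind: "(if a < S z then 1 else 0) = indicat_real {z. a < S z} z" for a z by (simp add: indicator_def)
  have Am: "{z. a < S z} \<in> sets borel" for a
  proof -
    have "{z \<in> space borel. a < S z} \<in> sets borel" by measurable
    thus ?thesis by simp
  qed
  have inner: "(LINT z|lborel. std_normal_density z * (if a < S z then 1 else 0)) = Phi (d2 S0 \<sigma> r T a)" if "a > 0" for a
    unfolding ind measure_std_normal_eq(2)[OF Am] using prob_stock_exceeds[OF pos that, of r] by (simp add: S_def)
  have i2: "integrable lborel (\<lambda>z. k a z)" for a
    unfolding k_def ind by (intro integrable_mult_right measure_std_normal_eq(1) Am)
  have ka: "(LINT z|lborel. k a z) = exp (r * T) * (indicat_real {0<..} a *\<^sub>R (f' a * bs_digital S0 \<sigma> r T a))" for a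
  proof (cases "a > 0")
    case True
    have "(LINT z|lborel. k a z) = g a * Phi (d2 S0 \<sigma> r T a)"
      unfolding k_def using inner[OF True] by simp
    moreover have "Phi (d2 S0 \<sigma> r T a) = exp (r * T) * bs_digital S0 \<sigma> r T a"
      using True by (simp add: bs_digital_def flip: exp_add mult.assoc)
    ultimately show ?thesis by (simp add: g_def)
  qed (simp add: k_def g_def)
  have kn: "norm (k a z) = \<bar>g a\<bar> * (std_normal_density z * (if a < S z then 1 else 0))" for a z
    by (simp add: k_def abs_mult)
  \<comment> \<open>For fixed a the kernel has constant sign in z, so the integral of its norm is
    the absolute value of its integral, and Fubini reduces to integrability of f' times the digital
    price.\<close>
  have kan: "(LINT z|lborel. norm (k a z)) = \<bar>exp (r * T) * (indicat_real {0<..} a *\<^sub>R (f' a * bs_digital S0 \<sigma> r T a))\<bar>" for a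
  proof -
    have "0 \<le> (LINT z|lborel. std_normal_density z * (if a < S z then 1 else 0))" by (intro integral_nonneg_AE AE_I2) simp
    hence "(LINT z|lborel. norm (k a z)) = \<bar>LINT z|lborel. k a z\<bar>" unfolding kn k_def by (simp add: abs_mult)
    thus ?thesis unfolding ka .
  qed
  have "integrable (lborel \<Otimes>\<^sub>M lborel) (case_prod k)"
  proof (rule lborel_pair.Fubini_integrable[OF km])
    show "integrable lborel (\<lambda>a. LINT z|lborel. norm (case_prod k (a, z)))"
      unfolding prod.case kan using int unfolding set_integrable_def by (intro integrable_abs integrable_mult_right)
    show "AE a in lborel. integrable lborel (\<lambda>z. case_prod k (a, z))" using i2 by simp
  qed
  note fub = lborel_pair.Fubini_integral[OF this] lborel_pair.integrable_snd[OF this]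
  have kz: "(LINT a|lborel. k a z) = std_normal_density z * (f (S z) - f 0)" for z
  proof -
    have "(LINT a|lborel. k a z) = (LINT a|lborel. std_normal_density z * (indicat_real {0<..<S z} a *\<^sub>R f' a))"
      by (intro Bochner_Integration.integral_cong) (auto simp: k_def g_def indicator_def)
    also have "\<dots> = std_normal_density z * (LINT a:{0<..<S z}|lborel. f' a)"
      unfolding set_lebesgue_integral_def by simp
    also have "(LINT a:{0<..<S z}|lborel. f' a) = f (S z) - f 0"
      by (rule set_integral_deriv[OF S0 f cont])
    finally show ?thesis .
  qed
  have fc: "continuous_on {0..} f" using f by (intro DERIV_continuous_on) auto
  have fSm: "(\<lambda>z. f (S z)) \<in> borel_measurable borel"
  proof (rule borel_measurable_continuous_onI)
    show "continuous_on UNIV (\<lambda>z. f (S z))"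
      by (rule continuous_on_compose2[OF fc Sc]) (use S0 in \<open>auto intro: less_imp_le\<close>)
  qed
  hence fSm0: "(\<lambda>z. f (S z) - f 0) \<in> borel_measurable borel" by measurable
  have i0: "integrable std_normal (\<lambda>z. f (S z) - f 0)"
    using fub(2) unfolding kz integral_std_normal(1)[OF fSm0] .
  have "integrable std_normal (\<lambda>z. (f (S z) - f 0) + f 0)"
    by (intro Bochner_Integration.integrable_add i0) simp
  thus iS: "integrable std_normal (\<lambda>z. f (bs_stock S0 \<sigma> r T z))" by (simp add: S_def)
  have "(LINT z|std_normal. f (S z)) = (LINT z|std_normal. (f (S z) - f 0) + f 0)" by simp
  also have "\<dots> = (LINT z|std_normal. f (S z) - f 0) + (LINT z|std_normal. f 0)"
    by (intro Bochner_Integration.integral_add i0) simp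
  also have "(LINT z|std_normal. f 0) = f 0" using std_normal.prob_space by simp
  also have "(LINT z|std_normal. f (S z) - f 0) = (LINT z|lborel. LINT a|lborel. k a z)"
    unfolding kz by (rule integral_std_normal(2)[OF fSm0])
  also have "\<dots> = exp (r * T) * (LINT a:{0<..}|lborel. f' a * bs_digital S0 \<sigma> r T a)"
    unfolding fub(1) ka set_lebesgue_integral_def by simp
  finally have "bs_price S0 \<sigma> r T f
      = exp (- r * T) * (exp (r * T) * (LINT a:{0<..}|lborel. f' a * bs_digital S0 \<sigma> r T a) + f 0)"
    unfolding bs_price_def S_def by simp
  also have "\<dots> = exp (- r * T) * exp (r * T) * (LINT a:{0<..}|lborel. f' a * bs_digital S0 \<sigma> r T a) + exp (- r * T) * f 0"
    by (simp add: distrib_left)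
  also have "exp (- r * T) * exp (r * T) = 1" by (simp flip: exp_add)
  finally show "bs_price S0 \<sigma> r T f = exp (- r * T) * f 0 + (LINT a:{0<..}|lborel. f' a * bs_digital S0 \<sigma> r T a)"
    by simp
qed

section \<open>Payoff growth against decay in the strike, and the total trapezoidal error\<close>

lemma weighted_product_bound:
  fixes u v :: "real \<Rightarrow> real"
  assumes u: "\<And>a. a > 0 \<Longrightarrow> \<bar>u a\<bar> \<le> C * (1 + a) ^ q" and v: "\<forall>a>0. (1 + a) ^ (q + j) * \<bar>v a\<bar> \<le> K" and C: "C \<ge> 0"
    and a: "a > 0"
  shows "(1 + a) ^ j * \<bar>u a * v a\<bar> \<le> C * K"
proof -
  have "(1 + a) ^ j * \<bar>u a * v a\<bar> = \<bar>u a\<bar> * ((1 + a) ^ j * \<bar>v a\<bar>)" by (simp add: abs_mult)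
  also have "\<dots> \<le> (C * (1 + a) ^ q) * ((1 + a) ^ j * \<bar>v a\<bar>)" using u[OF a] a by (intro mult_right_mono) auto
  also have "\<dots> = C * ((1 + a) ^ (q + j) * \<bar>v a\<bar>)" by (simp add: power_add)
  also have "\<dots> \<le> C * K" using v a C by (intro mult_left_mono) auto
  finally show ?thesis .
qed

lemma has_deriv_at_interior:
  "(f has_real_derivative D) (at x within {0..}) \<Longrightarrow> x > 0 \<Longrightarrow> (f has_real_derivative D) (at x)" for x :: real
  by (subst (asm) at_within_interior) auto

lemma integral_has_deriv_within_step:
  fixes F :: "real \<Rightarrow> real"
  assumes F: "continuous_on {0..} F" and u: "0 \<le> u" "u \<le> t" "t \<le> u + h"
  shows "((\<lambda>t. integral {0..t} F) has_real_derivative F t) (at t within {u..u + h})"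
proof -
  have "((\<lambda>t. integral {0..t} F) has_real_derivative F t) (at t within {0..u + h})"
    by (rule integral_has_real_derivative) (use u in \<open>auto intro: continuous_on_subset[OF F]\<close>)
  thus ?thesis by (rule DERIV_subset) (use u in auto)
qed

text \<open>The trapezoidal sum approximates the integral of f' against digital prices, that is
  e^(-r T) times the expectation of f(S_T) - f(0). Hence e^(-r T) f(0) is added for general f, and
  the expansion as displayed is the case f(0) = 0. The integrability claims exclude that the price
  or C is the default value of a divergent integral.\<close>

theorem theorem3p4:
  fixes S0 \<sigma> r T \<alpha> :: real and f f' f'' f''' :: "real \<Rightarrow> real"
  assumes "S0 > 0" and "\<sigma> > 0" and "T > 0"
    and "0 < \<alpha>" and "\<alpha> < 1 / 3"
    and "\<And>x. x \<ge> 0 \<Longrightarrow> (f has_real_derivative f' x) (at x within {0..})"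
    and "\<And>x. x \<ge> 0 \<Longrightarrow> (f' has_real_derivative f'' x) (at x within {0..})"
    and "\<And>x. x \<ge> 0 \<Longrightarrow> (f'' has_real_derivative f''' x) (at x within {0..})"
    and "continuous_on {0..} f'''"
    and "poly_bounded f'" and "poly_bounded f''" and "poly_bounded f'''"
  shows "integrable std_normal (\<lambda>z. f (bs_stock S0 \<sigma> r T z))
    \<and> set_integrable lborel {0<..} (\<lambda>a. f' a * digital_coeff S0 \<sigma> r T a)
    \<and> (let C = (LINT a:{0<..}|lborel. f' a * digital_coeff S0 \<sigma> r T a) in
         (\<lambda>n. (exp (- r * T) * f 0 + trapezoid_price S0 \<sigma> r T \<alpha> f' n)
              - (bs_price S0 \<sigma> r T f + C / real n)) \<in> o(\<lambda>n. 1 / real n)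
       \<and> (f 0 = 0 \<longrightarrow>
           (\<lambda>n. trapezoid_price S0 \<sigma> r T \<alpha> f' n
              - (bs_price S0 \<sigma> r T f + C / real n)) \<in> o(\<lambda>n. 1 / real n)))"
proof -
  note pos = assms(1-3)
  define G where "G = bs_digital S0 \<sigma> r T"
  define G1 where "G1 = bs_digital_deriv S0 \<sigma> r T"
  define G2 where "G2 = bs_digital_deriv2 S0 \<sigma> r T"
  define D where "D = digital_coeff0 S0 \<sigma> r T"
  define D1 where "D1 = digital_coeff_deriv S0 \<sigma> r T"
  define V where "V = center_digital_price S0 \<sigma> r T"
  define F where "F = (\<lambda>a. f' a * G a)"
  define F1 where "F1 = (\<lambda>a. f'' a * G a + G1 a * f' a)"
  define F2 where "F2 = (\<lambda>a. (f''' a * G a + G1 a * f'' a) + (G2 a * f' a + f'' a * G1 a))"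
  define H where "H = (\<lambda>a. f' a * D a)"
  define H1 where "H1 = (\<lambda>a. f'' a * D a + D1 a * f' a)"

  obtain C1 q1 where C1: "C1 > 0" "\<And>q a. q \<ge> q1 \<Longrightarrow> a \<ge> 0 \<Longrightarrow> \<bar>f' a\<bar> \<le> C1 * (1 + a) ^ q"
    using poly_bounded_imp_power_bound[OF assms(10)] by blast
  obtain C2 q2 where C2: "C2 > 0" "\<And>q a. q \<ge> q2 \<Longrightarrow> a \<ge> 0 \<Longrightarrow> \<bar>f'' a\<bar> \<le> C2 * (1 + a) ^ q"
    using poly_bounded_imp_power_bound[OF assms(11)] by blast
  obtain C3 q3 where C3: "C3 > 0" "\<And>q a. q \<ge> q3 \<Longrightarrow> a \<ge> 0 \<Longrightarrow> \<bar>f''' a\<bar> \<le> C3 * (1 + a) ^ q"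
    using poly_bounded_imp_power_bound[OF assms(12)] by blast
  \<comment> \<open>One growth exponent for all three derivatives, positive as the weighted bound on
    the digital price requires.\<close>
  define q where "q = max 1 (max q1 (max q2 q3))"
  have q1: "q \<ge> 1" by (simp add: q_def)
  have f'b: "\<bar>f' a\<bar> \<le> C1 * (1 + a) ^ q" if "a \<ge> 0" for a using C1(2)[of q a] that by (simp add: q_def)
  have f''b: "\<bar>f'' a\<bar> \<le> C2 * (1 + a) ^ q" if "a \<ge> 0" for a using C2(2)[of q a] that by (simp add: q_def)
  have f'''b: "\<bar>f''' a\<bar> \<le> C3 * (1 + a) ^ q" if "a \<ge> 0" for a using C3(2)[of q a] that by (simp add: q_def)
  \<comment> \<open>With \<alpha> m >= 2, truncation at L = n^\<alpha> costs L^(-m) <= n^(-2),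
    however small \<alpha> is.\<close>
  define m where "m = nat \<lceil>2 / \<alpha>\<rceil>"
  have m: "\<alpha> * real m \<ge> 2"
  proof -
    have "2 / \<alpha> \<le> real m" unfolding m_def by linarith
    thus ?thesis using assms(4) by (simp add: field_simps)
  qed

  \<comment> \<open>The q powers absorb the growth of f', and the other m + 2 feed the tail bound;
    where only boundedness of a product is wanted, q powers are enough.\<close>
  obtain KG where KG: "KG \<ge> 0" "\<forall>a>0. (1 + a) ^ (q + (m + 2)) * \<bar>G a\<bar> \<le> KG"
    using bs_digital_weighted_bound[OF pos, of "q + (m + 2)" r] unfolding G_def by auto
  obtain KG0 where KG0: "KG0 \<ge> 0" "\<forall>a>0. (1 + a) ^ (q + 0) * \<bar>G a\<bar> \<le> KG0"
    using bs_digital_weighted_bound[OF pos, of "q + 0" r] q1 unfolding G_def by auto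
  obtain KG1 where KG1: "KG1 \<ge> 0" "\<forall>a>0. (1 + a) ^ (q + 0) * \<bar>G1 a\<bar> \<le> KG1"
    using bs_digital_deriv_weighted_bound[OF pos, of "q + 0" r] unfolding G1_def by auto
  obtain KG2 where KG2: "KG2 \<ge> 0" "\<forall>a>0. (1 + a) ^ (q + 0) * \<bar>G2 a\<bar> \<le> KG2"
    using bs_digital_deriv2_weighted_bound[OF pos, of "q + 0" r] unfolding G2_def by auto
  obtain KD where KD: "KD \<ge> 0" "\<forall>a>0. (1 + a) ^ (q + (m + 2)) * \<bar>D a\<bar> \<le> KD"
    using digital_coeff_weighted_bound[OF pos, of "q + (m + 2)" r] unfolding D_def by auto
  obtain KD0 where KD0: "KD0 \<ge> 0" "\<forall>a>0. (1 + a) ^ (q + 0) * \<bar>D a\<bar> \<le> KD0"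
    using digital_coeff_weighted_bound[OF pos, of "q + 0" r] unfolding D_def by auto
  obtain KD1 where KD1: "KD1 \<ge> 0" "\<forall>a>0. (1 + a) ^ (q + 0) * \<bar>D1 a\<bar> \<le> KD1"
    using digital_coeff_deriv_weighted_bound[OF pos, of "q + 0" r] unfolding D1_def by auto
  obtain KV n0 where KV: "KV > 0" "n0 \<ge> 1" "\<And>n a. n \<ge> n0 \<Longrightarrow> 0 \<le> a \<Longrightarrow>
     (1 + a) ^ q * \<bar>V n a - (G a + D a / n)\<bar> \<le> KV * real n powr (- 17 / 12)"
    using center_digital_price_expansion[OF pos q1, of r] unfolding V_def G_def D_def by blast

  have f'd: "(f' has_real_derivative f'' a) (at a)" if "a > 0" for a
    using assms(7)[of a] that by (intro has_deriv_at_interior) auto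
  have f''d: "(f'' has_real_derivative f''' a) (at a)" if "a > 0" for a
    using assms(8)[of a] that by (intro has_deriv_at_interior) auto
  have Gd: "(G has_real_derivative G1 a) (at a)" if "a > 0" for a
    unfolding G_def G1_def by (rule bs_digital_has_deriv[OF pos that])
  have G1d: "(G1 has_real_derivative G2 a) (at a)" if "a > 0" for a
    unfolding G1_def G2_def by (rule bs_digital_has_deriv2[OF pos that])
  have Dd: "(D has_real_derivative D1 a) (at a)" if "a > 0" for a
    unfolding D_def D1_def by (rule digital_coeff0_has_deriv[OF pos that])
  have Fd: "(F has_real_derivative F1 a) (at a)" if "a > 0" for a
    unfolding F_def F1_def by (intro DERIV_mult f'd Gd that)
  have F1d: "(F1 has_real_derivative F2 a) (at a)" if "a > 0" for a
    unfolding F1_def F2_def by (intro DERIV_add DERIV_mult f'd f''d Gd G1d that)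
  have Hd: "(H has_real_derivative H1 a) (at a)" if "a > 0" for a
    unfolding H_def H1_def by (intro DERIV_mult f'd Dd that)
  have f'c: "continuous_on {0..} f'" using assms(7) by (intro DERIV_continuous_on) auto
  have Fc: "continuous_on {0..} F" unfolding F_def G_def
    by (intro continuous_on_mult f'c bs_digital_continuous[OF pos])
  have Hc: "continuous_on {0..} H" unfolding H_def D_def
    by (intro continuous_on_mult f'c digital_coeff0_continuous[OF pos])

  \<comment> \<open>One constant for the second derivative of \<open>F\<close> and the first
    derivative of \<open>H\<close>; each uses its own summands, and the others are
    nonnegative.\<close>
  define B where "B = C3 * KG0 + C2 * KG1 + (C1 * KG2 + C2 * KG1) + (C2 * KD0 + C1 * KD1)"
  have F2b: "\<bar>F2 a\<bar> \<le> B" if a: "a > 0" for a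
  proof -
    have "\<bar>f''' a * G a\<bar> \<le> C3 * KG0" "\<bar>f'' a * G1 a\<bar> \<le> C2 * KG1" "\<bar>f' a * G2 a\<bar> \<le> C1 * KG2"
      using weighted_product_bound[OF f'''b KG0(2) _ a] weighted_product_bound[OF f''b KG1(2) _ a]
        weighted_product_bound[OF f'b KG2(2) _ a] C1(1) C2(1) C3(1) by auto
    moreover have "0 \<le> C2 * KD0 + C1 * KD1" using C1 C2 KD0 KD1 by simp
    ultimately show ?thesis unfolding F2_def B_def by (simp add: mult.commute abs_le_iff)
  qed
  have H1b: "\<bar>H1 a\<bar> \<le> B" if a: "a > 0" for a
  proof -
    have "\<bar>f'' a * D a\<bar> \<le> C2 * KD0" "\<bar>f' a * D1 a\<bar> \<le> C1 * KD1"
      using weighted_product_bound[OF f''b KD0(2) _ a] weighted_product_bound[OF f'b KD1(2) _ a] C1(1) C2(1) by auto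
    moreover have "0 \<le> C3 * KG0" "0 \<le> C2 * KG1" "0 \<le> C1 * KG2" using C1 C2 C3 KG0 KG1 KG2 by simp_all
    ultimately show ?thesis unfolding H1_def B_def by (simp add: mult.commute abs_le_iff)
  qed
  have Fw: "\<forall>a>0. (1 + a) ^ (m + 2) * \<bar>F a\<bar> \<le> C1 * KG"
    unfolding F_def using weighted_product_bound[OF f'b KG(2)] C1(1) by auto
  have Hw: "\<forall>a>0. (1 + a) ^ (m + 2) * \<bar>H a\<bar> \<le> C1 * KD"
    unfolding H_def using weighted_product_bound[OF f'b KD(2)] C1(1) by auto
  have w2: "(1 + a)\<^sup>2 * \<bar>u\<bar> \<le> K" if "a > 0" "(1 + a) ^ (m + 2) * \<bar>u\<bar> \<le> K" for a u K :: real
  proof -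
    have "(1 + a)\<^sup>2 * \<bar>u\<bar> \<le> (1 + a) ^ (m + 2) * \<bar>u\<bar>" using that by (intro mult_right_mono power_increasing) auto
    thus ?thesis using that by linarith
  qed
  have Fi: "set_integrable lborel {0<..} F"
    by (rule set_integrable_cauchy_decay[OF continuous_on_subset[OF Fc] w2]) (use Fw in auto)
  have Hi: "set_integrable lborel {0<..} H"
    by (rule set_integrable_cauchy_decay[OF continuous_on_subset[OF Hc] w2]) (use Hw in auto)
  \<comment> \<open>\<open>digital_coeff0\<close> and \<open>digital_coeff\<close> differ at most at
    strike 0, which lies outside the domain of integration.\<close>
  have HD: "H a = f' a * digital_coeff S0 \<sigma> r T a" if "a \<in> {0<..}" for a
    using that by (simp add: H_def D_def digital_coeff0_def)
  have Hi': "set_integrable lborel {0<..} (\<lambda>a. f' a * digital_coeff S0 \<sigma> r T a)"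
    by (subst set_integrable_cong[OF refl refl HD[symmetric]]) (auto simp: Hi)
  define IF where "IF = (LINT a:{0<..}|lborel. F a)"
  define IH where "IH = (LINT a:{0<..}|lborel. H a)"
  have IH: "(LINT a:{0<..}|lborel. f' a * digital_coeff S0 \<sigma> r T a) = IH"
    unfolding IH_def by (rule set_lebesgue_integral_cong[symmetric]) (use HD in auto)
  note bs = bs_price_as_digitals[OF pos assms(6) f'c Fi[unfolded F_def G_def]]
  have bsIF: "bs_price S0 \<sigma> r T f = exp (- r * T) * f 0 + IF"
    unfolding IF_def F_def G_def by (rule bs(2))

  obtain I where I: "I \<ge> 0" "\<And>(F :: real \<Rightarrow> real) K L. continuous_on {0..} F \<Longrightarrow>
      (\<forall>a>0. (1 + a) ^ (m + 2) * \<bar>F a\<bar> \<le> K) \<Longrightarrow> 0 < L \<Longrightarrow>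
     \<bar>integral {0..L} F - (LINT a:{0<..}|lborel. F a)\<bar> \<le> K * I / L ^ m"
    using improper_integral_tail_bound[of m] by blast

  \<comment> \<open>One entry per source of error: \<alpha> - 17/12 < -1 - 1/12 for the digital
    prices, 3 \<alpha> - 2 = -1 - (1 - 3 \<alpha>) for the trapezoidal rule on \<open>F\<close>, and
    -2 for truncation. The rule on \<open>H\<close> gives 2 \<alpha> - 2, which lies below 3
    \<alpha> - 2.\<close>
  define \<delta> where "\<delta> = min (1 / 12) (min (1 - 3 * \<alpha>) 1)"
  have \<delta>: "\<delta> > 0" using assms(5) by (simp add: \<delta>_def)
  define K where "K = C1 * KV + 2 * B + (C1 * KG * I + C1 * KD * I)"
  have B0: "B \<ge> 0" using C1 C2 C3 KG0 KG1 KG2 KD0 KD1 by (simp add: B_def)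
  have main: "\<bar>trapezoid_price S0 \<sigma> r T \<alpha> f' n - (IF + IH / real n)\<bar> \<le> K * real n powr (- 1 - \<delta>)"
    if n: "n \<ge> n0" for n
  proof -
    have n1: "real n \<ge> 1" using n KV(2) by simp
    define h where "h = real n powr (\<alpha> - 1)"
    define L where "L = real n * h"
    have h: "h > 0" using n1 by (simp add: h_def)
    have L: "L = real n powr \<alpha>"
    proof -
      have "L = real n powr 1 * real n powr (\<alpha> - 1)" using n1 by (simp add: L_def h_def)
      also have "\<dots> = real n powr \<alpha>" by (subst powr_add[symmetric]) simp
      finally show ?thesis .
    qed
    have L0: "L > 0" using n1 by (simp add: L)
    have pw: "real n powr e \<le> real n powr (- 1 - \<delta>)" if "e \<le> - 1 - \<delta>" for e
      using n1 that by (rule powr_mono[rotated])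
    define trap where "trap = (\<lambda>\<phi>. h / 2 * (\<Sum>k<n. \<phi> (real k * h)) + h / 2 * (\<Sum>k<n. \<phi> ((real k + 1) * h)) :: real)"
    have trap_lin: "trap (\<lambda>a. \<phi> a + \<psi> a) = trap \<phi> + trap \<psi>" "trap (\<lambda>a. \<phi> a / c) = trap \<phi> / c" for \<phi> \<psi> c
      by (simp_all add: trap_def sum.distrib sum_divide_distrib[symmetric] distrib_left add_divide_distrib)
    have trap_bound: "\<bar>trap \<phi>\<bar> \<le> L * b" if "\<And>a. a \<ge> 0 \<Longrightarrow> \<bar>\<phi> a\<bar> \<le> b" for \<phi> b
    proof -
      have *: "\<bar>h / 2 * (\<Sum>k<n. \<phi> (g k))\<bar> \<le> h / 2 * (real n * b)" if "\<And>k. g k \<ge> 0" for g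
      proof -
        have "\<bar>\<Sum>k<n. \<phi> (g k)\<bar> \<le> (\<Sum>k<n. b)"
          by (rule order_trans[OF sum_abs sum_mono]) (use that \<open>\<And>a. a \<ge> 0 \<Longrightarrow> \<bar>\<phi> a\<bar> \<le> b\<close> in auto)
        hence "\<bar>\<Sum>k<n. \<phi> (g k)\<bar> \<le> real n * b" by simp
        thus ?thesis using h by (intro abs_mult_le_mult) auto
      qed
      have "\<bar>trap \<phi>\<bar> \<le> h / 2 * (real n * b) + h / 2 * (real n * b)"
        unfolding trap_def using h by (intro order_trans[OF abs_triangle_ineq] add_mono *) auto
      also have "\<dots> = L * b" by (simp add: L_def)
      finally show ?thesis .
    qed
    \<comment> \<open>Isolates the error of the tree prices. The rest of the sum is the trapezoidal
      rule for the smooth integrands \<open>F\<close> and \<open>H\<close>, where n enters only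
      through the mesh and the factor 1/n.\<close>
    define R where "R = (\<lambda>a. f' a * (V n a - (G a + D a / n)))"
    have Rb: "\<bar>R a\<bar> \<le> C1 * KV * real n powr (- 17 / 12)" if a: "a \<ge> 0" for a
    proof -
      have "\<bar>R a\<bar> \<le> C1 * (1 + a) ^ q * \<bar>V n a - (G a + D a / n)\<bar>"
        unfolding R_def abs_mult using f'b[OF a] by (intro mult_right_mono) auto
      also have "\<dots> = C1 * ((1 + a) ^ q * \<bar>V n a - (G a + D a / n)\<bar>)" by simp
      also have "\<dots> \<le> C1 * (KV * real n powr (- 17 / 12))" using C1(1) by (intro mult_left_mono KV(3) n a) auto
      finally show ?thesis by simp
    qed
    have "trapezoid_price S0 \<sigma> r T \<alpha> f' n = trap (\<lambda>a. f' a * V n a)"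
      by (simp add: trapezoid_price_def Let_def trap_def h_def V_def)
    also have "(\<lambda>a. f' a * V n a) = (\<lambda>a. R a + (F a + H a / n))"
      by (rule ext) (simp add: R_def F_def H_def algebra_simps)
    finally have split: "trapezoid_price S0 \<sigma> r T \<alpha> f' n = trap R + (trap F + trap H / n)"
      unfolding trap_lin .
    have E1: "\<bar>trap R\<bar> \<le> C1 * KV * real n powr (- 1 - \<delta>)"
    proof -
      have "\<bar>trap R\<bar> \<le> L * (C1 * KV * real n powr (- 17 / 12))" by (rule trap_bound[OF Rb])
      also have "\<dots> = C1 * KV * real n powr (\<alpha> - 17 / 12)" by (simp add: L powr_add[symmetric])
      also have "\<dots> \<le> C1 * KV * real n powr (- 1 - \<delta>)"
      proof (intro mult_left_mono pw)
        show "\<alpha> - 17 / 12 \<le> - 1 - \<delta>" using assms(5) unfolding \<delta>_def by simp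
      qed (use C1 KV in auto)
      finally show ?thesis .
    qed
    have hh: "h ^ 3 = real n powr (3 * \<alpha> - 3)" "h ^ 2 = real n powr (2 * \<alpha> - 2)"
      using n1 by (simp_all add: h_def powr_power algebra_simps)
    have E2: "\<bar>trap F - integral {0..L} F\<bar> \<le> B * real n powr (- 1 - \<delta>)"
    proof -
      have "\<bar>trap F - (integral {0..real n * h} F - integral {0..0} F)\<bar> \<le> real n * (B * h ^ 3)"
        unfolding trap_def
      proof (rule composite_trapezoid)
        fix k assume "k < n"
        have k0: "0 \<le> real k * h" using h by simp
        show "\<bar>integral {0..real k * h + h} F - integral {0..real k * h} F - h / 2 * (F (real k * h) + F (real k * h + h))\<bar> \<le> B * h ^ 3"
        proof (rule trapezoid_step[where P = "\<lambda>t. integral {0..t} F" and F' = F1])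
          show "\<bar>F1 y - F1 x\<bar> \<le> B * (y - x)" if xy: "real k * h < x" "x < y" "y < real k * h + h" for x y
          proof -
            have x0: "x > 0" using xy k0 by linarith
            obtain z where z: "x < z" "z < y" "F1 y - F1 x = (y - x) * F2 z"
              using MVT2[OF xy(2), of F1 F2] F1d x0 by force
            have "\<bar>F2 z\<bar> \<le> B" using F2b z x0 by simp
            hence "(y - x) * \<bar>F2 z\<bar> \<le> (y - x) * B" using xy by (intro mult_left_mono) auto
            thus ?thesis unfolding z(3) using xy by (simp add: abs_mult mult.commute)
          qed
          show "((\<lambda>t. integral {0..t} F) has_real_derivative F t) (at t within {real k * h..real k * h + h})"
            if "real k * h \<le> t" "t \<le> real k * h + h" for t
            by (rule integral_has_deriv_within_step[OF Fc k0 that])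
          show "(F has_real_derivative F1 t) (at t)" if "real k * h < t" for t using Fd k0 that by simp
          show "continuous_on {real k * h..real k * h + h} F" using k0 by (intro continuous_on_subset[OF Fc]) auto
        qed (use h B0 in auto)
      qed
      also have "real n * (B * h ^ 3) = B * real n powr (3 * \<alpha> - 2)"
      proof -
        have "real n * h ^ 3 = real n powr 1 * real n powr (3 * \<alpha> - 3)" using n1 by (simp add: hh)
        also have "\<dots> = real n powr (3 * \<alpha> - 2)" by (subst powr_add[symmetric]) simp
        finally show ?thesis by (simp add: mult.left_commute)
      qed
      also have "\<dots> \<le> B * real n powr (- 1 - \<delta>)"
        using B0 by (intro mult_left_mono pw) (auto simp: \<delta>_def)
      finally show ?thesis by (simp add: L_def)
    qed
    have E3: "\<bar>(trap H - integral {0..L} H) / n\<bar> \<le> B * real n powr (- 1 - \<delta>)"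
    proof -
      have "\<bar>trap H - (integral {0..real n * h} H - integral {0..0} H)\<bar> \<le> real n * (B * h ^ 2)"
        unfolding trap_def
      proof (rule composite_trapezoid)
        fix k assume "k < n"
        have k0: "0 \<le> real k * h" using h by simp
        show "\<bar>integral {0..real k * h + h} H - integral {0..real k * h} H - h / 2 * (H (real k * h) + H (real k * h + h))\<bar> \<le> B * h ^ 2"
        proof (rule trapezoid_step_lipschitz[where P = "\<lambda>t. integral {0..t} H" and F' = H1])
          show "\<bar>H1 x\<bar> \<le> B" if "real k * h < x" for x using H1b k0 that by simp
          show "((\<lambda>t. integral {0..t} H) has_real_derivative H t) (at t within {real k * h..real k * h + h})"
            if "real k * h \<le> t" "t \<le> real k * h + h" for t
            by (rule integral_has_deriv_within_step[OF Hc k0 that])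
          show "(H has_real_derivative H1 t) (at t)" if "real k * h < t" for t using Hd k0 that by simp
          show "continuous_on {real k * h..real k * h + h} H" using k0 by (intro continuous_on_subset[OF Hc]) auto
        qed (use h in auto)
      qed
      hence "\<bar>(trap H - integral {0..L} H) / n\<bar> \<le> B * h ^ 2"
        using n1 by (simp add: L_def abs_divide divide_le_eq mult.commute)
      also have "\<dots> \<le> B * real n powr (- 1 - \<delta>)"
        unfolding hh using B0 assms(5) by (intro mult_left_mono pw) (auto simp: \<delta>_def min_def)
      finally show ?thesis .
    qed
    have Lm: "1 / L ^ m \<le> real n powr (- 1 - \<delta>)"
    proof -
      have "1 / L ^ m = real n powr (- (\<alpha> * real m))" using n1 by (simp add: L powr_power powr_minus_divide mult.commute)
      also have "\<dots> \<le> real n powr (- 1 - \<delta>)" using m by (intro pw) (simp add: \<delta>_def)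
      finally show ?thesis .
    qed
    have tail: "K' * I / L ^ m \<le> K' * I * real n powr (- 1 - \<delta>)" if "K' \<ge> 0" for K'
      using mult_left_mono[OF Lm, of "K' * I"] that I(1) by simp
    have E4: "\<bar>integral {0..L} F - IF\<bar> \<le> C1 * KG * I * real n powr (- 1 - \<delta>)"
      unfolding IF_def by (rule order_trans[OF I(2)[OF Fc Fw L0] tail]) (use C1 KG in simp)
    have E5: "\<bar>(integral {0..L} H - IH) / n\<bar> \<le> C1 * KD * I * real n powr (- 1 - \<delta>)"
    proof -
      have "\<bar>integral {0..L} H - IH\<bar> \<le> C1 * KD * I * real n powr (- 1 - \<delta>)"
        unfolding IH_def by (rule order_trans[OF I(2)[OF Hc Hw L0] tail]) (use C1 KD in simp)
      moreover have "\<bar>integral {0..L} H - IH\<bar> / n \<le> \<bar>integral {0..L} H - IH\<bar>" using n1 by (intro divide_le_self) auto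
      ultimately show ?thesis using n1 by (simp add: abs_divide)
    qed
    have tri: "\<bar>a + b + c + d + e\<bar> \<le> b1 + b2 + b3 + b4 + b5"
      if "\<bar>a\<bar> \<le> b1" "\<bar>b\<bar> \<le> b2" "\<bar>c\<bar> \<le> b3" "\<bar>d\<bar> \<le> b4" "\<bar>e\<bar> \<le> b5" for a b c d e b1 b2 b3 b4 b5 :: real
      using that by linarith
    have "trapezoid_price S0 \<sigma> r T \<alpha> f' n - (IF + IH / real n) = trap R + (trap F - integral {0..L} F)
        + (trap H - integral {0..L} H) / n + (integral {0..L} F - IF) + (integral {0..L} H - IH) / n"
      unfolding split by (simp add: diff_divide_distrib)
    also have "\<bar>\<dots>\<bar> \<le> C1 * KV * real n powr (- 1 - \<delta>) + B * real n powr (- 1 - \<delta>) + B * real n powr (- 1 - \<delta>)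
        + C1 * KG * I * real n powr (- 1 - \<delta>) + C1 * KD * I * real n powr (- 1 - \<delta>)"
      by (rule tri[OF E1 E2 E3 E4 E5])
    also have "\<dots> = K * real n powr (- 1 - \<delta>)" by (simp add: K_def algebra_simps)
    finally show ?thesis .
  qed
  have lim: "(\<lambda>n. trapezoid_price S0 \<sigma> r T \<alpha> f' n - (IF + IH / real n)) \<in> o(\<lambda>n. 1 / real n)"
  proof (rule landau_o.big_small_trans)
    show "(\<lambda>n. trapezoid_price S0 \<sigma> r T \<alpha> f' n - (IF + IH / real n)) \<in> O(\<lambda>n. real n powr (- 1 - \<delta>))"
      by (rule bigoI[of _ K]) (use main in \<open>auto simp: eventually_sequentially intro!: exI[of _ n0]\<close>)
    show "(\<lambda>n. real n powr (- 1 - \<delta>)) \<in> o(\<lambda>n. 1 / real n)" using \<delta> by real_asymp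
  qed
  show ?thesis
    unfolding Let_def IH bsIF using bs(1) Hi' lim by (simp add: algebra_simps)
qed

end
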